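(* Let $T\in\mathrm{Aut}(X,\mu)$ and $S\in\mathrm{Aut}(Y,\nu)$ be rank-one transformations of standard non-atomic probability spaces $(X,\mu)$ and $(Y,\nu)$. Then $T$ and $S$ are sub-$L^1$ orbit equivalent; that is, for every increasing map $\omega\colon\mathbb{R}_+\to\mathbb{R}_+$ with $\lim_{r\to\infty}\omega(r)/r=0$, the transformations $T$ and $S$ are $\omega$-integrably orbit equivalent.
   Context: All probability spaces are standard (Lebesgue) and non-atomic; $\mathrm{Aut}(X,\mu)$ is the group of probability-measure-preserving bijections of $(X,\mu)$ up to equality almost everywhere; set-theoretic statements about measurable sets are understood up to null sets. **Orbit equivalence.** An orbit equivalence between free ergodic $T\in\mathrm{Aut}(X,\mu)$ and $S\in\mathrm{Aut}(Y,\nu)$ is a measure isomorphism $\varphi\colon X\to Y$ for which there exist (measurable) maps $c_T\colon X\to\mathbb{Z}$, $c_S\colon Y\to\mathbb{Z}$ (orbit cocycles) with $\varphi(Tx)=S^{c_T(x)}\varphi(x)$ and $\varphi^{-1}(Sy)=T^{c_S(y)}\varphi^{-1}(y)$ almost surely. Given an increasing map $\omega\colon\mathbb{R}_+\to\mathbb{R}_+$, $T$ and $S$ are $\omega$-integrably orbit equivalent if an orbit equivalence $\varphi$ between them can be chosen (possibly depending on $\omega$) so that $\int_X\omega(|c_T(x)|)\,d\mu(x)<\infty$ and $\int_Y\omega(|c_S(y)|)\,d\nu(y)<\infty$. **Rank-one transformations.** $T\in\mathrm{Aut}(X,\mu)$ is of rank one if there exist: (1) positive integers $q_n$ (cutting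 parameters) and non-negative integers $\sigma_{n,0},\dots,\sigma_{n,q_n}$ (spacing parameters), $n\ge 0$, such that, with $\sigma_n=\sigma_{n,0}+\dots+\sigma_{n,q_n}$, $k_0=1$ and $k_{n+1}=q_nk_n+\sigma_n$, one has $\sum_{n\ge0}\sigma_n/k_{n+1}<\infty$; (2) measurable subsets $B_n$ ($n\ge0$), $B_{n,i}$ ($n\ge 0$, $0\le i\le q_n-1$), $\Sigma_{n,i,j}$ ($n\ge0$, $0\le i\le q_n$, $1\le j\le\sigma_{n,i}$) of $X$ such that for all $n\ge 0$: (a) $B_n,T(B_n),\dots,T^{k_n-1}(B_n)$ are pairwise disjoint; (b) $(B_{n,0},\dots,B_{n,q_n-1})$ is a partition of $B_n$; (c) for $0\le i\le q_n-1$: $T^{k_n}(B_{n,i})=\Sigma_{n,i+1,1}$ if $\sigma_{n,i+1}>0$, and $T^{k_n}(B_{n,i})=B_{n,i+1}$ if $\sigma_{n,i+1}=0$ and $i<q_n-1$; (d) if $\sigma_{n,i}>0$: $T(\Sigma_{n,i,j})=\Sigma_{n,i,j+1}$ if $j<\sigma_{n,i}$, and $T(\Sigma_{n,i,\sigma_{n,i}})=B_{n,i}$ if $i\le q_n-1$; (e) $B_{n+1}=\Sigma_{n,0,1}$ if $\sigma_{n,0}>0$, and $B_{n+1}=B_{n,0}$ if $\sigma_{n,0}=0$; (f) the Rokhlin towers $\mathcal{R}_n=(T^k(B_n))_{0\le k\le k_n-1}$, $n\ge0$, generate the $\sigma$-algebra of measurable subsets of $X$ (modulo null sets). Rank-one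 transformations are ergodic, hence free. *)

theory Defs
  imports "HOL-Probability.Probability"
begin

text \<open>
  A measure isomorphism is understood modulo null sets: it is a pair of measure-preserving maps
  that are inverse to each other almost everywhere.
\<close>

definition measure_iso :: "'a measure \<Rightarrow> 'b measure \<Rightarrow> ('a \<Rightarrow> 'b) \<Rightarrow> ('b \<Rightarrow> 'a) \<Rightarrow> bool" where
  "measure_iso M N \<phi> \<psi> \<longleftrightarrow>
     \<phi> \<in> measurable M N \<and> distr M N \<phi> = N \<and>
     \<psi> \<in> measurable N M \<and> distr N M \<psi> = M \<and>
     (AE x in M. \<psi> (\<phi> x) = x) \<and> (AE y in N. \<phi> (\<psi> y) = y)"

text \<open>
  Lebesgue spaces in the sense of Rokhlin. Since every standard Borel space is Borel isomorphic to
  a Borel subset of the line, it suffices to let the model range over the completions of all Borel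
  probability measures on the line.
\<close>

definition lebesgue_prob_space :: "'a measure \<Rightarrow> bool" where
  "lebesgue_prob_space M \<longleftrightarrow>
     prob_space M \<and> complete_measure M \<and>
     (\<exists>(L :: real measure) f g. real_distribution L \<and> measure_iso M (completion L) f g)"

definition non_atomic :: "'a measure \<Rightarrow> bool" where
  "non_atomic M \<longleftrightarrow>
     (\<forall>A\<in>sets M. emeasure M A > 0 \<longrightarrow>
        (\<exists>B\<in>sets M. B \<subseteq> A \<and> 0 < emeasure M B \<and> emeasure M B < emeasure M A))"

text \<open>
  The maps below represent the elements of the automorphism group of the measure space, in which
  two such maps are identified if they agree almost everywhere.
\<close>

definition pmp_automorphism :: "'a measure \<Rightarrow> ('a \<Rightarrow> 'a) \<Rightarrow> bool" where
  "pmp_automorphism M T \<longleftrightarrow>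
     bij_betw T (space M) (space M) \<and>
     T \<in> measurable M M \<and> inv_into (space M) T \<in> measurable M M \<and> distr M M T = M"

definition iterate_int :: "'a measure \<Rightarrow> ('a \<Rightarrow> 'a) \<Rightarrow> int \<Rightarrow> 'a \<Rightarrow> 'a" where
  "iterate_int M T k =
     (if k \<ge> 0 then T ^^ nat k else inv_into (space M) T ^^ nat (- k))"

definition orbit_cocycles ::
  "'a measure \<Rightarrow> 'b measure \<Rightarrow> ('a \<Rightarrow> 'a) \<Rightarrow> ('b \<Rightarrow> 'b) \<Rightarrow> ('a \<Rightarrow> 'b) \<Rightarrow> ('b \<Rightarrow> 'a)
     \<Rightarrow> ('a \<Rightarrow> int) \<Rightarrow> ('b \<Rightarrow> int) \<Rightarrow> bool" where
  "orbit_cocycles M N T S \<phi> \<psi> c\<^sub>T c\<^sub>S \<longleftrightarrow>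
     c\<^sub>T \<in> measurable M (count_space UNIV) \<and>
     c\<^sub>S \<in> measurable N (count_space UNIV) \<and>
     (AE x in M. \<phi> (T x) = iterate_int N S (c\<^sub>T x) (\<phi> x)) \<and>
     (AE y in N. \<psi> (S y) = iterate_int M T (c\<^sub>S y) (\<psi> y))"

definition integrably_orbit_equivalent ::
  "(real \<Rightarrow> real) \<Rightarrow> 'a measure \<Rightarrow> 'b measure \<Rightarrow> ('a \<Rightarrow> 'a) \<Rightarrow> ('b \<Rightarrow> 'b) \<Rightarrow> bool" where
  "integrably_orbit_equivalent \<omega> M N T S \<longleftrightarrow>
     (\<exists>\<phi> \<psi> c\<^sub>T c\<^sub>S.
        measure_iso M N \<phi> \<psi> \<and> orbit_cocycles M N T S \<phi> \<psi> c\<^sub>T c\<^sub>S \<and>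
        (\<integral>\<^sup>+ x. ennreal (\<omega> (real_of_int \<bar>c\<^sub>T x\<bar>)) \<partial>M) < \<infinity> \<and>
        (\<integral>\<^sup>+ y. ennreal (\<omega> (real_of_int \<bar>c\<^sub>S y\<bar>)) \<partial>N) < \<infinity>)"

definition eq_mod_null :: "'a measure \<Rightarrow> 'a set \<Rightarrow> 'a set \<Rightarrow> bool" where
  "eq_mod_null M A C \<longleftrightarrow> (AE x in M. x \<in> A \<longleftrightarrow> x \<in> C)"

definition disjoint_mod_null :: "'a measure \<Rightarrow> 'a set \<Rightarrow> 'a set \<Rightarrow> bool" where
  "disjoint_mod_null M A C \<longleftrightarrow> (AE x in M. \<not> (x \<in> A \<and> x \<in> C))"

text \<open>
  The cutting parameters are \<open>q n\<close>; the spacing parameters are \<open>\<sigma> n i\<close>, of which only those with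
  \<open>i \<le> q n\<close> are relevant. In the construction, \<open>C n i\<close> are the pieces of the base \<open>B n\<close>, and identities between sets hold
  modulo null sets.
\<close>

definition total_spacing :: "(nat \<Rightarrow> nat) \<Rightarrow> (nat \<Rightarrow> nat \<Rightarrow> nat) \<Rightarrow> nat \<Rightarrow> nat" where
  "total_spacing q \<sigma> n = (\<Sum>i\<le>q n. \<sigma> n i)"

primrec tower_height :: "(nat \<Rightarrow> nat) \<Rightarrow> (nat \<Rightarrow> nat \<Rightarrow> nat) \<Rightarrow> nat \<Rightarrow> nat" where
  "tower_height q \<sigma> 0 = 1"
| "tower_height q \<sigma> (Suc n) = q n * tower_height q \<sigma> n + total_spacing q \<sigma> n"

definition rank_one_parameters :: "(nat \<Rightarrow> nat) \<Rightarrow> (nat \<Rightarrow> nat \<Rightarrow> nat) \<Rightarrow> bool" where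
  "rank_one_parameters q \<sigma> \<longleftrightarrow>
     (\<forall>n. q n > 0) \<and>
     summable (\<lambda>n. real (total_spacing q \<sigma> n) / real (tower_height q \<sigma> (Suc n)))"

definition rank_one_construction ::
  "'a measure \<Rightarrow> ('a \<Rightarrow> 'a) \<Rightarrow> (nat \<Rightarrow> nat) \<Rightarrow> (nat \<Rightarrow> nat \<Rightarrow> nat)
     \<Rightarrow> (nat \<Rightarrow> 'a set) \<Rightarrow> (nat \<Rightarrow> nat \<Rightarrow> 'a set) \<Rightarrow> (nat \<Rightarrow> nat \<Rightarrow> nat \<Rightarrow> 'a set) \<Rightarrow> bool" where
  "rank_one_construction M T q \<sigma> B C \<Sigma> \<longleftrightarrow>
     (\<forall>n. B n \<in> sets M) \<and>
     (\<forall>n. \<forall>i<q n. C n i \<in> sets M) \<and>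
     (\<forall>n. \<forall>i\<le>q n. \<forall>j\<in>{1..\<sigma> n i}. \<Sigma> n i j \<in> sets M) \<and>
     (\<forall>n. \<forall>k<tower_height q \<sigma> n. \<forall>l<tower_height q \<sigma> n. k \<noteq> l \<longrightarrow>
        disjoint_mod_null M ((T ^^ k) ` B n) ((T ^^ l) ` B n)) \<and>
     (\<forall>n. eq_mod_null M (\<Union>i<q n. C n i) (B n)) \<and>
     (\<forall>n. \<forall>i<q n. \<forall>j<q n. i \<noteq> j \<longrightarrow> disjoint_mod_null M (C n i) (C n j)) \<and>
     (\<forall>n. \<forall>i<q n. \<sigma> n (i + 1) > 0 \<longrightarrow>
        eq_mod_null M ((T ^^ tower_height q \<sigma> n) ` C n i) (\<Sigma> n (i + 1) 1)) \<and>
     (\<forall>n. \<forall>i. i + 1 < q n \<and> \<sigma> n (i + 1) = 0 \<longrightarrow>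
        eq_mod_null M ((T ^^ tower_height q \<sigma> n) ` C n i) (C n (i + 1))) \<and>
     (\<forall>n. \<forall>i\<le>q n. \<forall>j. 1 \<le> j \<and> j < \<sigma> n i \<longrightarrow>
        eq_mod_null M (T ` \<Sigma> n i j) (\<Sigma> n i (j + 1))) \<and>
     (\<forall>n. \<forall>i<q n. \<sigma> n i > 0 \<longrightarrow> eq_mod_null M (T ` \<Sigma> n i (\<sigma> n i)) (C n i)) \<and>
     (\<forall>n. eq_mod_null M (B (Suc n)) (if \<sigma> n 0 > 0 then \<Sigma> n 0 1 else C n 0)) \<and>
     (\<forall>A\<in>sets M.
        \<exists>A'\<in>sigma_sets (space M) {(T ^^ k) ` B n |n k. k < tower_height q \<sigma> n}.
          eq_mod_null M A A')"

definition rank_one :: "'a measure \<Rightarrow> ('a \<Rightarrow> 'a) \<Rightarrow> bool" where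
  "rank_one M T \<longleftrightarrow>
     pmp_automorphism M T \<and>
     (\<exists>q \<sigma>. rank_one_parameters q \<sigma> \<and> (\<exists>B C \<Sigma>. rank_one_construction M T q \<sigma> B C \<Sigma>))"

end

theory Submission
  imports Defs
begin

text \<open>
  Choose alternately towers of \<open>T\<close> and of \<open>S\<close> with very rapidly increasing heights \<open>H 0, H 1, \<dots>\<close>.
  Positions in a tower of height \<open>H (i + 1)\<close> of one transformation are cut into consecutive chunks of
  length \<open>H i\<close>, each of which is identified by a bijection with a tower of height \<open>H i\<close> of the other
  one. To pass from \<open>i\<close> to \<open>i + 1\<close>, cut the tower of height \<open>H (i + 2)\<close> into chunks of length
  \<open>H (i + 1)\<close> and these into blocks of length \<open>r * H i\<close>. Most blocks contain at least \<open>r - 1\<close> starts of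
  copies of the tower of height \<open>H i\<close>; there the first \<open>r - 2\<close> copies are sent, in order, onto the first
  \<open>r - 2\<close> chunks of length \<open>H i\<close> of the block, by the inverse of the bijection already chosen, and the
  remaining points are moved monotonically; on the other blocks nothing is moved. So successive
  identifications agree up to summable measure and converge to a measure isomorphism, while a new
  nontrivial value of the cocycle is at most \<open>2 * r * H i\<close> and appears on a set of measure \<open>O(1 / H i)\<close>
  only. Since \<open>H i\<close> is chosen after \<open>r\<close>, sublinearity of \<open>\<omega>\<close> makes the sum of the contributions
  \<open>\<omega> (2 * r * H i) / H i\<close> finite.
\<close>

section \<open>Rearranging positions between two towers\<close>

text \<open>The obstacle is locality. Copies of the tower of height \<open>H i\<close> begin and end
  with frequency of order \<open>1 / H i\<close>, so a rearrangement respecting them jumps about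
  that often. If points could move anywhere in a chunk of length \<open>H (i + 1)\<close>, the jumps
  could be of that size, although \<open>H (i + 1)\<close> is chosen long after \<open>H i\<close>;
  blocks of length \<open>r * H i\<close> cap them. The resulting bound for the \<open>L^1\<close>
  cost of one stage is still of order \<open>r\<close>, hence not summable. This is as it must be:
  by Belinskaya's theorem an orbit equivalence with an integrable cocycle makes the transformations
  flip conjugate. The inverse of the earlier bijection is used so that the triangle formed by three
  consecutive towers commutes on most positions: passing to the other transformation and back gives
  the true position in the earlier tower. One sequence of identifications thus yields both the map
  and its inverse. The price is that a cocycle value can change for two reasons, a break of the
  newest relocation or a break in undoing the one before it.\<close>

definition separated :: "nat \<Rightarrow> nat set \<Rightarrow> bool" where
  "separated h W \<longleftrightarrow> (\<forall>w\<in>W. \<forall>w'\<in>W. w < w' \<longrightarrow> w + h \<le> w')"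

lemma separatedD: "separated h W \<Longrightarrow> w \<in> W \<Longrightarrow> w' \<in> W \<Longrightarrow> w < w' \<Longrightarrow> w + h \<le> w'"
  by (auto simp: separated_def)

lemma separated_unique:
  assumes "separated h W" "w \<in> W" "w' \<in> W" "w \<le> t" "t < w + h" "w' \<le> t" "t < w' + h"
  shows "w = w'"
  using assms(2-) separatedD[OF assms(1), of w w'] separatedD[OF assms(1), of w' w]
  by (cases w w' rule: linorder_cases) auto

lemma separated_subset: "separated h W \<Longrightarrow> V \<subseteq> W \<Longrightarrow> separated h V"
  by (auto simp: separated_def)

lemma card_copies:
  assumes "separated h W" "finite W"
  shows "card (\<Union>w\<in>W. {w..<w+h}) = card W * h"
proof -
  have "card (\<Union>w\<in>W. {w..<w+h}) = (\<Sum>w\<in>W. card {w..<w+h})"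
  proof (rule card_UN_disjoint)
    show "\<forall>i\<in>W. \<forall>j\<in>W. i \<noteq> j \<longrightarrow> {i..<i + h} \<inter> {j..<j + h} = {}"
      using separated_unique[OF assms(1)] by fastforce
  qed (use assms in auto)
  then show ?thesis by simp
qed

lemma card_separated_le:
  assumes "separated h S" "S \<subseteq> {x..y}" "x \<le> y"
  shows "card S * h \<le> y + h - x"
proof -
  have fin: "finite S" using assms finite_subset by blast
  have "card (\<Union>w\<in>S. {w..<w+h}) \<le> card {x..<y+h}"
    by (rule card_mono) (use assms in auto)
  then show ?thesis using card_copies[OF assms(1) fin] by simp
qed

lemma card_eq_sum_fibers:
  assumes "finite S"
  shows "card S = (\<Sum>y\<in>f ` S. card {x\<in>S. f x = y})"
proof -
  have "(\<Sum>y\<in>f ` S. sum (\<lambda>_. 1::nat) {x \<in> S. f x = y}) = sum (\<lambda>_. 1) S"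
    by (rule sum.group) (use assms in auto)
  then show ?thesis by simp
qed

text \<open>Here \<open>\<pi>\<close> maps positions in a tower of height \<open>k\<close> to positions in a tower of height \<open>h\<close>, and \<open>W\<close> is the
  set of starts of the copies of the latter in a third tower, of height \<open>K\<close> below. The new map
  \<open>relocate\<close> goes from the third tower to the one of height \<open>k\<close>.\<close>

locale rearrangement =
  fixes h k r :: nat and W :: "nat set" and \<pi> :: "nat \<Rightarrow> nat"
  assumes h_pos: "0 < h" and r_ge: "3 \<le> r" and k_ge: "r * h \<le> k"
    and sep: "separated h W"
    and chunk_bij: "\<And>c. bij_betw \<pi> {c*h..<c*h+h} {..<h}"
begin

definition "L = r * h"
definition "off t = (t mod k) mod L"
definition "blk t = (t mod k) div L"
definition "base t = (t div k) * k + blk t * L"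
definition "starts t = {w\<in>W. base t \<le> w \<and> w < base t + L}"
text \<open>The first conjunct discards the truncated block at the end of a chunk of length
  \<open>k\<close>. One start more than the \<open>r - 2\<close> copies to be matched is required:
  the last copy may stick out of the block, but its presence forces the earlier ones to end
  inside.\<close>

definition "good t \<longleftrightarrow> blk t * L + L \<le> k \<and> r - 1 \<le> card (starts t)"
definition "seen t = {w\<in>starts t. w \<le> t}"
definition "rnk t = card (seen t)"
definition "start t = Max (seen t)"
definition "matched t \<longleftrightarrow> good t \<and> 1 \<le> rnk t \<and> rnk t \<le> r - 2 \<and> t < start t + h"
definition "chunk t = blk t * r + (rnk t - 1)"
text \<open>The first \<open>r - 2\<close> chunks of length \<open>h\<close> in a good block are
  reserved for matched copies. An unmatched position jumps over those of the matched copies that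
  still lie to its right, so the unmatched positions close up, in order, in the last
  \<open>2 * h\<close> places. Truncated subtraction makes the shift 0 once all matched copies have
  been passed.\<close>

definition "relocate t =
  (if matched t then inv_into {chunk t * h..<chunk t * h + h} \<pi> (t - start t)
   else if good t then t mod k + (r - 2 - rnk t) * h
   else t mod k)"

definition "same_block t t1 \<longleftrightarrow> t div k = t1 div k \<and> blk t = blk t1"

lemma L_pos: "0 < L" using h_pos r_ge by (simp add: L_def)
lemma k_pos: "0 < k" using L_pos k_ge unfolding L_def by linarith
lemma L_le_k: "L \<le> k" using k_ge by (simp add: L_def)

lemma mod_split: "t mod k = blk t * L + off t"
  by (simp add: blk_def off_def mult.commute)

lemma base_off: "t = base t + off t"
  using mod_split[of t] div_mult_mod_eq[of t k] by (simp add: base_def)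

lemma off_less: "off t < L" using L_pos by (simp add: off_def)

lemma base_le: "base t \<le> t" using base_off[of t] by linarith
lemma less_base: "t < base t + L" using base_off[of t] off_less[of t] by linarith

lemma same_block_sym: "same_block t t1 \<Longrightarrow> same_block t1 t" by (simp add: same_block_def)

lemma same_blockD:
  assumes "same_block t t1"
  shows "base t1 = base t" "starts t1 = starts t" "good t1 = good t" "blk t1 = blk t"
  using assms by (simp_all add: same_block_def base_def starts_def good_def)

lemma finite_starts: "finite (starts t)"
  by (rule finite_subset[of _ "{..<base t + L}"]) (auto simp: starts_def)
lemma finite_seen: "finite (seen t)"
  by (rule finite_subset[OF _ finite_starts]) (auto simp: seen_def)

lemma starts_W: "starts t \<subseteq> W" by (auto simp: starts_def)
lemma sep_starts: "separated h (starts t)" by (rule separated_subset[OF sep starts_W])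
lemma seen_starts: "seen t \<subseteq> starts t" by (auto simp: seen_def)

lemma start_in: assumes "1 \<le> rnk t" shows "start t \<in> seen t"
  unfolding start_def by (rule Max_in[OF finite_seen]) (use assms in \<open>auto simp: rnk_def\<close>)

lemma start_props:
  assumes "1 \<le> rnk t"
  shows "start t \<in> W" "start t \<le> t" "base t \<le> start t" "start t < base t + L"
  using start_in[OF assms] by (auto simp: seen_def starts_def)

lemma seen_eq_below_start:
  assumes "1 \<le> rnk t" shows "seen t = {w\<in>starts t. w \<le> start t}"
  using start_props[OF assms] Max_ge[OF finite_seen, of _ t]
  by (auto simp: seen_def start_def)

lemma rnk_mono: "same_block t t1 \<Longrightarrow> t \<le> t1 \<Longrightarrow> rnk t \<le> rnk t1"
  unfolding rnk_def by (rule card_mono[OF finite_seen]) (auto simp: seen_def same_blockD)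

lemma rnk_eq_imp_seen_eq:
  assumes "same_block t t1" "rnk t = rnk t1" shows "seen t = seen t1"
proof -
  have sub: "seen t \<subseteq> seen t1 \<or> seen t1 \<subseteq> seen t"
    using assms(1) by (cases "t \<le> t1") (auto simp: seen_def same_blockD)
  then show ?thesis using card_subset_eq[OF finite_seen] assms(2) unfolding rnk_def by metis
qed

lemma rnk_eq_imp_start_eq:
  assumes "same_block t t1" "rnk t = rnk t1" shows "start t = start t1"
  using rnk_eq_imp_seen_eq[OF assms] by (simp add: start_def)

lemma seen_fill: assumes "1 \<le> rnk t" shows "base t + rnk t * h \<le> start t + h"
proof -
  have "seen t \<subseteq> {base t..start t}"
    unfolding seen_eq_below_start[OF assms] by (auto simp: starts_def)
  then have "card (seen t) * h \<le> start t + h - base t"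
    by (rule card_separated_le[OF separated_subset[OF sep_starts seen_starts]])
      (rule start_props(3)[OF assms])
  then show ?thesis using start_props(3)[OF assms] unfolding rnk_def by linarith
qed

text \<open>Copies already passed push \<open>t\<close> away from the base of the block by
  \<open>h\<close> each, and the shift supplies the copies still missing from
  \<open>r - 2\<close>.\<close>

lemma unmatched_ge:
  assumes "good t" "\<not> matched t" shows "base t + (r - 2) * h \<le> t + (r - 2 - rnk t) * h"
proof (cases "rnk t = 0")
  case True then show ?thesis using base_le[of t] by simp
next
  case False
  then have m: "1 \<le> rnk t" by simp
  note fill = seen_fill[OF m]
  note sp = start_props(2)[OF m]
  show ?thesis
  proof (cases "rnk t \<le> r - 2")
    case True
    then have "start t + h \<le> t" using assms m by (auto simp: matched_def)
    then have "base t + rnk t * h \<le> t" using fill by linarith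
    then show ?thesis using True by (simp add: diff_mult_distrib)
  next
    case False
    \<comment> \<open>The last copy seen may still be running at \<open>t\<close>, so only
      \<open>rnk t - 1\<close> copies are sure to be complete; this suffices because
      \<open>rnk t\<close> is at least \<open>r - 1\<close>.\<close>
    then have "(r - 1) * h \<le> rnk t * h" by (intro mult_le_mono1) linarith
    moreover have "(r - 1) * h = (r - 2) * h + h"
      using r_ge by (cases r; cases "r - 1") auto
    moreover have "r - 2 - rnk t = 0" using False by simp
    ultimately show ?thesis using fill sp by (simp only: mult_0 add_0_right)
  qed
qed

lemma card_seen_between:
  assumes "same_block t t1" "t < t1" "rnk t < rnk t1"
  shows "(rnk t1 - rnk t) * h + t + 1 \<le> start t1 + h"
proof -
  let ?S = "seen t1 - seen t"
  have m: "1 \<le> rnk t1" using assms by simp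
  have sub: "seen t \<subseteq> seen t1" using assms by (auto simp: seen_def same_blockD)
  have c: "card ?S = rnk t1 - rnk t" unfolding rnk_def by (rule card_Diff_subset[OF finite_seen sub])
  have S: "?S \<subseteq> {t+1..start t1}"
    using seen_eq_below_start[OF m] same_blockD(2)[OF assms(1)] by (auto simp: seen_def)
  have "?S \<noteq> {}" using c assms(3) by (metis card.empty zero_less_diff less_irrefl)
  then have le: "t + 1 \<le> start t1" using S by fastforce
  have "card ?S * h \<le> start t1 + h - (t + 1)"
    by (rule card_separated_le[OF separated_subset[OF sep_starts[of t1]] S le]) (auto simp: seen_def)
  then show ?thesis using c le by simp
qed

text \<open>The shift drops by \<open>h\<close> with each matched copy that begins between the two
  positions, but each of these copies occupies \<open>h\<close> positions in between.\<close>

lemma unmatched_strict_mono: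
  assumes "same_block t t1" "t < t1" "good t" "\<not> matched t" "\<not> matched t1"
  shows "t + (r - 2 - rnk t) * h < t1 + (r - 2 - rnk t1) * h"
proof (cases "rnk t < rnk t1 \<and> rnk t < r - 2")
  case False
  then have "r - 2 - rnk t = r - 2 - rnk t1" using rnk_mono[OF assms(1)] assms(2) by auto
  then show ?thesis using assms by simp
next
  case True
  have m: "1 \<le> rnk t1" using True by simp
  have b: "(rnk t1 - rnk t) * h + t + 1 \<le> start t1 + h" using card_seen_between True assms by blast
  have g: "good t1" using assms same_blockD by blast
  note sp = start_props(2)[OF m]
  show ?thesis
  proof (cases "rnk t1 \<le> r - 2")
    case le: True
    then have "start t1 + h \<le> t1" using assms m g by (auto simp: matched_def)
    then have "(rnk t1 - rnk t) * h + t < t1" using b by linarith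
    moreover have "(r - 2 - rnk t) * h = (rnk t1 - rnk t) * h + (r - 2 - rnk t1) * h"
      unfolding add_mult_distrib[symmetric] using le True by (intro arg_cong[where f="\<lambda>x. x * h"]) linarith
    ultimately show ?thesis by linarith
  next
    case gt: False
    \<comment> \<open>Beyond rank \<open>r - 2\<close> there is at least one start more in between
      than the shift drops by, which pays for a copy possibly unfinished at
      \<open>t1\<close>.\<close>
    then have "(Suc (r - 2 - rnk t)) * h \<le> (rnk t1 - rnk t) * h"
      using True gt by (intro mult_le_mono1) linarith
    then have "h + (r - 2 - rnk t) * h \<le> (rnk t1 - rnk t) * h" by simp
    then have "(r - 2 - rnk t) * h + t < t1" using b sp by linarith
    then show ?thesis by linarith
  qed
qed

text \<open>Here the extra start in \<open>good\<close> is spent. At least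
  \<open>r - 1 - rnk t\<close> starts follow \<open>t\<close> in the block, and each of them except
  the last has its \<open>h\<close> positions inside the block, which leaves room for the
  shift.\<close>

lemma unmatched_less:
  assumes "good t" shows "t + (r - 2 - rnk t) * h < base t + L"
proof (cases "rnk t < r - 2")
  case False then show ?thesis using less_base[of t] by simp
next
  case True
  let ?S = "starts t - seen t"
  have c: "card ?S = card (starts t) - rnk t" unfolding rnk_def
    by (rule card_Diff_subset[OF finite_seen seen_starts])
  then have c': "r - 1 - rnk t \<le> card ?S" using assms by (auto simp: good_def)
  then have "0 < card ?S" using True by linarith
  then have "?S \<noteq> {}" by force
  then obtain s where "s \<in> ?S" by blast
  then have le: "t + 1 \<le> base t + L - 1" by (auto simp: seen_def starts_def)
  have "card ?S * h \<le> base t + L - 1 + h - (t + 1)"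
    by (rule card_separated_le[OF separated_subset[OF sep_starts[of t]] _ le]) (auto simp: seen_def starts_def)
  moreover have "(Suc (r - 2 - rnk t)) * h \<le> card ?S * h"
    using c' True by (intro mult_le_mono1) linarith
  ultimately have "(r - 2 - rnk t) * h + h \<le> base t + L - 1 + h - (t + 1)" unfolding mult_Suc by linarith
  then show ?thesis using le by linarith
qed

lemma mod_plus_base: "t = (t div k) * k + t mod k" by simp

lemma chunk_range: "chunk t * h = blk t * L + (rnk t - 1) * h"
  by (simp add: chunk_def L_def algebra_simps)

lemma relocate_matched:
  assumes "matched t"
  shows "chunk t * h \<le> relocate t" "relocate t < chunk t * h + h" "\<pi> (relocate t) = t - start t"
proof -
  let ?I = "{chunk t * h..<chunk t * h + h}"
  have "start t \<le> t" using assms start_props by (auto simp: matched_def)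
  then have "t - start t < h" using assms h_pos by (auto simp: matched_def)
  then have *: "t - start t \<in> \<pi> ` ?I" using chunk_bij[of "chunk t"] by (auto simp: bij_betw_def)
  have n: "relocate t = inv_into ?I \<pi> (t - start t)" using assms by (simp add: relocate_def)
  show "chunk t * h \<le> relocate t" "relocate t < chunk t * h + h" using inv_into_into[OF *] n by auto
  show "\<pi> (relocate t) = t - start t" using f_inv_into_f[OF *] n by simp
qed

lemma chunk_eq: "matched t \<Longrightarrow> relocate t div h = chunk t"
  using relocate_matched[of t] by (intro div_nat_eqI) (auto simp: algebra_simps)

lemma relocate_matched_less:
  assumes "matched t" shows "relocate t < blk t * L + (r - 2) * h" "blk t * L \<le> relocate t"
proof -
  have "(rnk t - 1) * h + h = rnk t * h" using assms by (cases "rnk t") (auto simp: matched_def)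
  moreover have "rnk t * h \<le> (r - 2) * h" using assms by (intro mult_le_mono1) (auto simp: matched_def)
  ultimately show "relocate t < blk t * L + (r - 2) * h"
    using relocate_matched(2)[OF assms] unfolding chunk_range by linarith
  show "blk t * L \<le> relocate t" using relocate_matched(1)[OF assms] unfolding chunk_range by linarith
qed

lemma relocate_unmatched:
  assumes "good t" "\<not> matched t" shows "relocate t = t mod k + (r - 2 - rnk t) * h"
  using assms by (simp add: relocate_def)

lemma relocate_unmatched_ge:
  assumes "good t" "\<not> matched t" shows "blk t * L + (r - 2) * h \<le> relocate t"
  using unmatched_ge[OF assms] relocate_unmatched[OF assms] mod_plus_base[of t]
  unfolding base_def by linarith

lemma relocate_bad: "\<not> good t \<Longrightarrow> relocate t = t mod k"
  by (simp add: relocate_def matched_def)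

lemma r_h_less: "(r - 2) * h < L" using h_pos r_ge by (simp add: L_def)

lemma relocate_block: "blk t * L \<le> relocate t" "relocate t < blk t * L + L"
proof -
  consider "matched t" | "good t" "\<not> matched t" | "\<not> good t" by blast
  then have "blk t * L \<le> relocate t \<and> relocate t < blk t * L + L"
  proof cases
    case 1 then show ?thesis using relocate_matched_less[OF 1] r_h_less by linarith
  next
    case 2
    have "t + (r - 2 - rnk t) * h < base t + L" by (rule unmatched_less[OF 2(1)])
    then show ?thesis using relocate_unmatched_ge[OF 2] relocate_unmatched[OF 2] mod_plus_base[of t]
      unfolding base_def by linarith
  next
    case 3 then show ?thesis using relocate_bad[OF 3] mod_split[of t] off_less[of t] by linarith
  qed
  then show "blk t * L \<le> relocate t" "relocate t < blk t * L + L" by auto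
qed

lemma relocate_less: "relocate t < k"
proof (cases "good t")
  case True then show ?thesis using relocate_block[of t] by (auto simp: good_def)
next
  case False then show ?thesis using relocate_bad[of t] k_pos by simp
qed

lemma relocate_div_L: "relocate t div L = blk t"
  using relocate_block[of t] by (intro div_nat_eqI) (auto simp: algebra_simps)

lemma displacement: "\<bar>int (relocate t) - int (t mod k)\<bar> < int L"
  using relocate_block[of t] mod_split[of t] off_less[of t] by linarith

lemma chunk_same_rnk:
  assumes "matched t" "matched t1" "chunk t = chunk t1"
  shows "blk t = blk t1 \<and> rnk t = rnk t1"
proof -
  have "relocate t div L = blk t \<and> relocate t1 div L = blk t1" by (simp add: relocate_div_L)
  have lt: "rnk t - 1 < r" "rnk t1 - 1 < r" using assms by (auto simp: matched_def)
  have "chunk t div r = blk t" "chunk t1 div r = blk t1"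
    using lt by (auto simp: chunk_def)
  then have b: "blk t = blk t1" using assms by simp
  then have "rnk t - 1 = rnk t1 - 1" using assms(3) by (simp add: chunk_def)
  then show ?thesis using b assms by (auto simp: matched_def)
qed

lemma matched_same_start_iff:
  assumes "matched t" "matched t1" "t div k = t1 div k"
  shows "start t = start t1 \<longleftrightarrow> relocate t div h = relocate t1 div h"
proof
  assume "relocate t div h = relocate t1 div h"
  then have *: "blk t = blk t1 \<and> rnk t = rnk t1" 
    using chunk_same_rnk[OF assms(1,2)] chunk_eq[OF assms(1)] chunk_eq[OF assms(2)] by simp
  then show "start t = start t1" using rnk_eq_imp_start_eq[of t t1] assms(3) by (simp add: same_block_def)
next
  assume eq: "start t = start t1"
  have m: "1 \<le> rnk t" "1 \<le> rnk t1" using assms by (auto simp: matched_def)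
  note p = start_props[OF m(1)] start_props[OF m(2)]
  have "blk t * L < blk t1 * L + L" "blk t1 * L < blk t * L + L"
    using p eq unfolding base_def assms(3)[symmetric] by linarith+
  then have "blk t * L < Suc (blk t1) * L" "blk t1 * L < Suc (blk t) * L" by (simp_all)
  then have b: "blk t = blk t1" using mult_less_cancel2 by (metis less_Suc_eq_le le_antisym)
  then have sb: "same_block t t1" using assms by (simp add: same_block_def)
  have "seen t = seen t1" using seen_eq_below_start[OF m(1)] seen_eq_below_start[OF m(2)] eq same_blockD(2)[OF sb] by simp
  then show "relocate t div h = relocate t1 div h" 
    using b chunk_eq[OF assms(1)] chunk_eq[OF assms(2)] by (simp add: chunk_def rnk_def)
qed

text \<open>Matched positions land in the first \<open>r - 2\<close> chunks of their block and
  unmatched ones behind them, so a collision stays within one class. There the bijections on chunks,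
  respectively strict monotonicity, exclude it.\<close>

lemma relocate_inj:
  assumes "t div k = t1 div k" "relocate t = relocate t1" shows "t = t1"
proof -
  have b: "blk t = blk t1" using relocate_div_L assms by metis
  then have sb: "same_block t t1" using assms by (simp add: same_block_def)
  note sD = same_blockD[OF sb]
  show ?thesis
  proof (cases "good t")
    case False
    then have "t mod k = t1 mod k" using relocate_bad[of t] relocate_bad[of t1] assms sD by simp
    then show ?thesis using assms(1) by (metis div_mult_mod_eq)
  next
    case g: True
    then have g1: "good t1" using sD by simp
    consider "matched t" "matched t1" | "\<not> matched t" "\<not> matched t1" | "matched t \<noteq> matched t1" by blast
    then show ?thesis
    proof cases
      case 1
      then have "start t = start t1" using matched_same_start_iff assms by simp
      moreover have "t - start t = t1 - start t1" using relocate_matched(3) 1 assms by metis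
      moreover have "start t \<le> t" "start t1 \<le> t1" using 1 start_props by (auto simp: matched_def)
      ultimately show ?thesis by linarith
    next
      case 2
      have "t + (r - 2 - rnk t) * h = t1 + (r - 2 - rnk t1) * h"
        using relocate_unmatched[OF g 2(1)] relocate_unmatched[OF g1 2(2)] assms
          mod_plus_base[of t] mod_plus_base[of t1] by (metis add.assoc)
      then show ?thesis
        using unmatched_strict_mono[OF sb _ g 2] unmatched_strict_mono[OF same_block_sym[OF sb] _ g1 2(2,1)]
        by (cases t t1 rule: linorder_cases) auto
    next
      case 3
      then show ?thesis
        using relocate_matched_less[of t] relocate_matched_less[of t1] relocate_unmatched_ge[OF g] relocate_unmatched_ge[OF g1] assms b
        by (metis not_less)
    qed
  qed
qed

lemma div_chunk: "t \<in> {d*k..<d*k+k} \<longleftrightarrow> t div k = d"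
  using k_pos by (metis atLeastLessThan_iff div_nat_eqI div_mult_mod_eq le_add1 mod_less_divisor
      mult.commute mult_Suc nat_add_left_cancel_less add.commute)

lemma relocate_chunk_bij: "bij_betw relocate {d*k..<d*k+k} {..<k}"
proof -
  have inj: "inj_on relocate {d*k..<d*k+k}"
    by (rule inj_onI) (metis div_chunk relocate_inj)
  have "relocate ` {d*k..<d*k+k} = {..<k}"
    by (rule card_subset_eq) (use relocate_less card_image[OF inj] in auto)
  then show ?thesis using inj by (simp add: bij_betw_def)
qed

section \<open>Relocation of consecutive positions, and adjacency of relocated positions\<close>

lemma same_block_Suc:
  assumes "(t + 1) mod k mod L \<noteq> 0" shows "same_block t (t + 1)"
proof -
  have "(t + 1) mod k \<noteq> 0" using assms by (metis mod_0)
  then have m: "(t + 1) mod k = t mod k + 1" "(t + 1) div k = t div k"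
    by (auto simp: mod_Suc div_Suc split: if_splits)
  moreover have "(t mod k + 1) div L = t mod k div L"
    using assms m(1) by (auto simp: div_Suc mod_Suc split: if_splits)
  ultimately show ?thesis by (simp add: same_block_def blk_def)
qed

lemma rnk_Suc:
  assumes "same_block t (t + 1)" "t + 1 \<notin> W" shows "seen (t + 1) = seen t"
proof -
  have "w \<noteq> t + 1" if "w \<in> starts t" for w using that assms(2) by (auto simp: starts_def)
  then show ?thesis using same_blockD(2)[OF assms(1)] by (fastforce simp: seen_def)
qed

lemma step_unmatched:
  assumes "same_block t (t + 1)" "t + 1 \<notin> W" "\<not> matched t"
  shows "\<not> matched (t + 1)" "relocate (t + 1) = relocate t + 1"
proof -
  have rs: "rnk (t + 1) = rnk t" "start (t + 1) = start t"
    using rnk_Suc[OF assms(1,2)] by (simp_all add: rnk_def start_def)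
  note sD = same_blockD[OF assms(1)]
  show nm: "\<not> matched (t + 1)" using assms(3) rs sD by (auto simp: matched_def)
  have "(t + 1) mod k = t mod k + 1"
    using mod_plus_base[of t] mod_plus_base[of "t+1"] assms(1)
    unfolding same_block_def by (metis add.assoc add_left_cancel)
  then show "relocate (t + 1) = relocate t + 1" using nm assms(3) rs sD by (simp add: relocate_def)
qed

lemma step_matched:
  assumes "same_block t (t + 1)" "t + 1 \<notin> W" "matched t" "t + 1 \<noteq> start t + h"
  shows "matched (t + 1)" "start (t + 1) = start t"
proof -
  have rs: "rnk (t + 1) = rnk t" "start (t + 1) = start t"
    using rnk_Suc[OF assms(1,2)] by (simp_all add: rnk_def start_def)
  show "start (t + 1) = start t" by fact
  show "matched (t + 1)" using assms rs same_blockD[OF assms(1)] by (auto simp: matched_def)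
qed

text \<open>Positions after which adjacency may be lost. The condition
  \<open>(t + 1) mod k mod L = 0\<close> catches block boundaries and also the boundaries of chunks
  of length \<open>k\<close>. For the inverse map, in \<open>bwd_breaks\<close>, the end of a copy
  is replaced by the end of a target chunk of length \<open>h\<close>.\<close>

definition "fwd_breaks = {t. t + 1 \<in> W \<or> (\<exists>w\<in>W. t + 1 = w + h) \<or> (t + 1) mod k mod L = 0}"
definition "bwd_breaks = {t. t + 1 \<in> W \<or> (t + 1) mod k mod L = 0 \<or> h dvd relocate t + 1}"

lemma forward_step:
  assumes "t \<notin> fwd_breaks"
  shows "matched t \<and> matched (t + 1) \<and> start t = start (t + 1) \<or> \<not> matched t \<and> relocate (t + 1) = relocate t + 1"
proof -
  have sb: "same_block t (t + 1)" using assms same_block_Suc by (auto simp: fwd_breaks_def)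
  have W: "t + 1 \<notin> W" using assms by (auto simp: fwd_breaks_def)
  show ?thesis
  proof (cases "matched t")
    case True
    then have "start t \<in> W" using start_props by (auto simp: matched_def)
    then have "t + 1 \<noteq> start t + h" using assms by (auto simp: fwd_breaks_def)
    then show ?thesis using step_matched[OF sb W True] True by simp
  qed (use step_unmatched[OF sb W] in auto)
qed

text \<open>If \<open>t\<close> is unmatched, \<open>t + 1\<close> already has the image prescribed
  for \<open>t1\<close>, and injectivity identifies the two. If \<open>t\<close> is matched, a step
  of the image that does not leave its chunk of length \<open>h\<close> stays in the zone reserved
  for matched copies.\<close>

lemma backward_step:
  assumes "t \<notin> bwd_breaks" "t div k = t1 div k" "relocate t1 = relocate t + 1"
  shows "matched t \<and> matched t1 \<and> start t = start t1 \<or> \<not> matched t \<and> t1 = t + 1"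
proof -
  have sbS: "same_block t (t + 1)" using assms same_block_Suc by (auto simp: bwd_breaks_def)
  have W: "t + 1 \<notin> W" using assms by (auto simp: bwd_breaks_def)
  have "(relocate t + 1) mod h \<noteq> 0" using assms by (auto simp: bwd_breaks_def dvd_eq_mod_eq_0)
  then have dh: "relocate t1 div h = relocate t div h" using assms(3) by (auto simp: div_Suc)
  have "relocate t1 div L = relocate t div L" using dh by (simp add: L_def mult.commute[of r] div_mult2_eq)
  then have b: "blk t1 = blk t" by (simp add: relocate_div_L)
  then have sb: "same_block t t1" using assms by (simp add: same_block_def)
  show ?thesis
  proof (cases "matched t")
    case False
    have "relocate (t + 1) = relocate t1" using step_unmatched[OF sbS W False] assms by simp
    moreover have "(t + 1) div k = t1 div k" using sbS assms by (simp add: same_block_def)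
    ultimately show ?thesis using relocate_inj False by blast
  next
    case True
    have "relocate t1 div h = chunk t" using dh chunk_eq True by simp
    then have "relocate t1 < chunk t * h + h"
      using h_pos dividend_less_div_times[of h "relocate t1"] by simp
    moreover have "(rnk t - 1) * h + h \<le> (r - 2) * h"
    proof -
      have "(rnk t - 1) * h + h = rnk t * h" using True by (cases "rnk t") (auto simp: matched_def)
      moreover have "rnk t * h \<le> (r - 2) * h" using True by (intro mult_le_mono1) (auto simp: matched_def)
      ultimately show ?thesis by simp
    qed
    ultimately have "relocate t1 < blk t1 * L + (r - 2) * h" unfolding chunk_range b by linarith
    moreover have "good t1" using True same_blockD[OF sb] by (simp add: matched_def)
    ultimately have "matched t1" using relocate_unmatched_ge by (meson not_less)
    then show ?thesis using matched_same_start_iff True assms dh by simp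
  qed
qed

end

lemma card_le_by_inj:
  assumes "inj_on f S" "f ` S \<subseteq> A \<times> B" "finite A" "finite B"
  shows "card S \<le> card A * card B"
  using card_inj_on_le[OF assms(1,2)] assms(3,4) by (simp add: card_cartesian_product)

section \<open>Counting breaks and unmatched positions in a tower of height \<open>K\<close>\<close>

locale rearrangement_bounded = rearrangement +
  fixes K :: nat
  assumes W_le: "\<And>w. w \<in> W \<Longrightarrow> w + h \<le> K"
    and k_large: "r * r * h \<le> k" and K_large: "r * k \<le> K"
    and W_dense: "r * r * (K - card W * h) \<le> K"
begin

lemma finite_W: "finite W"
  by (rule finite_subset[of _ "{..K}"]) (use W_le in force)+

lemma k_le_K: "k \<le> K" using K_large r_ge by (metis le_trans mult_le_mono1 nat_mult_1 one_le_numeral)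

lemma chunks_le: "(K div k + 1) * k \<le> 2 * K"
  using k_le_K div_times_less_eq_dividend[of K k] unfolding add_mult_distrib by linarith

lemma W_cover: "card W * h \<le> K"
proof -
  have "card (\<Union>w\<in>W. {w..<w+h}) \<le> card {..<K}" by (rule card_mono) (use W_le in force)+
  then show ?thesis using card_copies[OF sep finite_W] by simp
qed

lemma div_le_K: "t \<le> K \<Longrightarrow> t div k \<le> K div k" by (rule div_le_mono)

text \<open>The constant 4 is a factor 2 for the incomplete last chunk of length \<open>k\<close>,
  times a factor 2 for the incomplete last block of each chunk.\<close>

lemma card_block_ends: "L * card {t. t < K \<and> (t + 1) mod k mod L = 0} \<le> 4 * K"
proof -
  let ?S = "{t. t < K \<and> (t + 1) mod k mod L = 0}"
  let ?f = "\<lambda>t. ((t + 1) div k, (t + 1) mod k div L)"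
  have "card ?S \<le> card {..K div k} * card {..k div L}"
  proof (rule card_le_by_inj)
    show "inj_on ?f ?S"
    proof (rule inj_onI)
      fix t u assume *: "t \<in> ?S" "u \<in> ?S" "?f t = ?f u"
      then have "(t + 1) mod k = (u + 1) mod k"
        using div_mult_mod_eq[of "(t+1) mod k" L, symmetric] div_mult_mod_eq[of "(u+1) mod k" L, symmetric]
        by (metis (mono_tags, lifting) mem_Collect_eq prod.inject)
      moreover have "(t + 1) div k = (u + 1) div k" using *(3) by simp
      ultimately have "t + 1 = u + 1" by (metis div_mult_mod_eq)
      then show "t = u" by simp
    qed
    show "?f ` ?S \<subseteq> {..K div k} \<times> {..k div L}"
    proof (rule image_subsetI)
      fix t assume "t \<in> ?S"
      then have "(t + 1) div k \<le> K div k" by (intro div_le_mono) simp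
      moreover have "(t + 1) mod k div L \<le> k div L" using k_pos by (intro div_le_mono) (simp add: less_imp_le)
      ultimately show "?f t \<in> {..K div k} \<times> {..k div L}" by simp
    qed
  qed auto
  then have "card ?S \<le> (K div k + 1) * (k div L + 1)" by simp
  then have "L * card ?S \<le> L * ((K div k + 1) * (k div L + 1))" by (rule mult_le_mono2)
  also have "\<dots> = (K div k + 1) * ((k div L + 1) * L)" by (simp only: ac_simps)
  also have "(k div L + 1) * L \<le> 2 * k"
    using L_le_k div_times_less_eq_dividend[of k L] unfolding add_mult_distrib by linarith
  then have "(K div k + 1) * ((k div L + 1) * L) \<le> (K div k + 1) * (2 * k)"
    by (rule mult_le_mono2)
  also have "\<dots> = 2 * ((K div k + 1) * k)" by (simp only: ac_simps)
  also have "\<dots> \<le> 4 * K" using chunks_le by linarith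
  finally show ?thesis .
qed

lemma h_le_L: "h \<le> L" using r_ge by (simp add: L_def)

lemma card_starts: "card {t. t < K \<and> t + 1 \<in> W} \<le> card W"
  by (rule card_inj_on_le[of "\<lambda>t. t + 1"]) (auto simp: finite_W)

lemma card_ends: "card {t. t < K \<and> (\<exists>w\<in>W. t + 1 = w + h)} \<le> card W"
proof -
  have "{t. t < K \<and> (\<exists>w\<in>W. t + 1 = w + h)} \<subseteq> (\<lambda>w. w + h - 1) ` W" by force
  then show ?thesis by (meson card_image_le card_mono finite_W finite_imageI le_trans)
qed

lemma card_fwd_breaks: "h * card {t. t < K \<and> t \<in> fwd_breaks} \<le> 6 * K"
proof -
  let ?E = "{t. t < K \<and> (t + 1) mod k mod L = 0}"
  have "{t. t < K \<and> t \<in> fwd_breaks} = {t. t < K \<and> t + 1 \<in> W} \<union> {t. t < K \<and> (\<exists>w\<in>W. t + 1 = w + h)} \<union> ?E"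
    by (auto simp: fwd_breaks_def)
  then have "card {t. t < K \<and> t \<in> fwd_breaks} \<le> 2 * card W + card ?E"
    using card_Un_le[of "{t. t < K \<and> t + 1 \<in> W}" "{t. t < K \<and> (\<exists>w\<in>W. t + 1 = w + h)}"]
      card_Un_le[of "{t. t < K \<and> t + 1 \<in> W} \<union> {t. t < K \<and> (\<exists>w\<in>W. t + 1 = w + h)}" ?E] card_starts card_ends
    by (simp del: One_nat_def)
  then have "h * card {t. t < K \<and> t \<in> fwd_breaks} \<le> h * (2 * card W + card ?E)" by (rule mult_le_mono2)
  also have "\<dots> = 2 * (card W * h) + h * card ?E" by (simp add: algebra_simps)
  also have "\<dots> \<le> 2 * K + L * card ?E" using W_cover h_le_L by (intro add_mono mult_mono) auto
  finally show ?thesis using card_block_ends by linarith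
qed

text \<open>By injectivity, one chunk of length \<open>k\<close> contains at most
  \<open>k div h\<close> positions whose image ends a chunk of length \<open>h\<close>, which gives
  \<open>2 * K\<close> in total. Starts of copies add \<open>K\<close> and block boundaries
  \<open>4 * K\<close>.\<close>

lemma card_bwd_breaks: "h * card {t. t < K \<and> t \<in> bwd_breaks} \<le> 7 * K"
proof -
  let ?E = "{t. t < K \<and> (t + 1) mod k mod L = 0}"
  let ?D = "{t. t < K \<and> h dvd relocate t + 1}"
  let ?f = "\<lambda>t. (t div k, (relocate t + 1) div h)"
  have "card ?D \<le> card {..K div k} * card {1..k div h}"
  proof (rule card_le_by_inj)
    show "inj_on ?f ?D"
    proof (rule inj_onI)
      fix t u assume *: "t \<in> ?D" "u \<in> ?D" "?f t = ?f u"
      then have "h dvd relocate t + 1" "h dvd relocate u + 1" "(relocate t + 1) div h = (relocate u + 1) div h" by simp_all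
      then have "relocate t + 1 = relocate u + 1" using dvd_div_mult_self by metis
      then show "t = u" using relocate_inj[of t u] *(3) by simp
    qed
    have "1 \<le> (relocate t + 1) div h" if "h dvd relocate t + 1" for t
      using dvd_imp_le[OF that] h_pos by (simp add: Suc_le_eq div_greater_zero_iff)
    moreover have "(relocate t + 1) div h \<le> k div h" for t
      using relocate_less[of t] by (intro div_le_mono) simp
    ultimately show "?f ` ?D \<subseteq> {..K div k} \<times> {1..k div h}"
      by (intro image_subsetI) (simp add: div_le_K del: One_nat_def)
  qed auto
  then have "card ?D \<le> (K div k + 1) * (k div h)" by simp
  then have "h * card ?D \<le> h * ((K div k + 1) * (k div h))" by (rule mult_le_mono2)
  also have "\<dots> = (K div k + 1) * (k div h * h)" by (simp only: ac_simps)
  also have "\<dots> \<le> (K div k + 1) * k" by (intro mult_le_mono2) simp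
  finally have D: "h * card ?D \<le> 2 * K" using chunks_le by linarith
  have "{t. t < K \<and> t \<in> bwd_breaks} = {t. t < K \<and> t + 1 \<in> W} \<union> ?D \<union> ?E"
    by (auto simp: bwd_breaks_def)
  then have "card {t. t < K \<and> t \<in> bwd_breaks} \<le> card W + card ?D + card ?E"
    using card_Un_le[of "{t. t < K \<and> t + 1 \<in> W}" ?D]
      card_Un_le[of "{t. t < K \<and> t + 1 \<in> W} \<union> ?D" ?E] card_starts
    by (simp del: One_nat_def)
  then have "h * card {t. t < K \<and> t \<in> bwd_breaks} \<le> h * (card W + card ?D + card ?E)" by (rule mult_le_mono2)
  also have "\<dots> = card W * h + h * card ?D + h * card ?E" by (simp add: algebra_simps)
  also have "\<dots> \<le> K + 2 * K + L * card ?E" using W_cover D mult_le_mono1[OF h_le_L, of "card ?E"] by linarith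
  finally show ?thesis using card_block_ends by linarith
qed

text \<open>Each chunk of length \<open>k\<close> has at most one truncated block, shorter than
  \<open>L = r * h\<close>; \<open>k_large\<close> makes its share of the chunk at most
  \<open>1 / r\<close>.\<close>

lemma card_partial_blocks: "r * card {t. t < K \<and> k < blk t * L + L} \<le> 2 * K"
proof -
  let ?S = "{t. t < K \<and> k < blk t * L + L}"
  have b: "blk t = k div L" if "k < blk t * L + L" for t
  proof -
    have "blk t * L \<le> t mod k" using mod_split[of t] by simp
    then have "blk t * L \<le> k" using mod_less_divisor[OF k_pos, of t] by linarith
    then show ?thesis using that by (intro div_nat_eqI[symmetric]) (auto simp: algebra_simps)
  qed
  have "card ?S \<le> card {..K div k} * card {..<L}"
  proof (rule card_le_by_inj[of "\<lambda>t. (t div k, off t)"])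
    show "inj_on (\<lambda>t. (t div k, off t)) ?S"
    proof (rule inj_onI)
      fix t u assume *: "t \<in> ?S" "u \<in> ?S" "(t div k, off t) = (u div k, off u)"
      then have "t mod k = u mod k" using mod_split[of t] mod_split[of u] b[of t] b[of u] by simp
      then show "t = u" using *(3) by (metis div_mult_mod_eq prod.inject)
    qed
  qed (use div_le_K off_less in auto)
  then have "r * card ?S \<le> r * ((K div k + 1) * L)" by (intro mult_le_mono2) simp
  also have "\<dots> = (K div k + 1) * (r * r * h)" by (simp add: L_def algebra_simps)
  also have "\<dots> \<le> (K div k + 1) * k" using k_large by (rule mult_le_mono2)
  finally show ?thesis using chunks_le by linarith
qed

text \<open>The range extends to \<open>K + L\<close> because a block that meets the tower may reach
  beyond its top, where there are no copies.\<close>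

definition "uncovered = {t. t < K + L \<and> (\<forall>w\<in>W. \<not> (w \<le> t \<and> t < w + h))}"

lemma finite_uncovered: "finite uncovered" by (simp add: uncovered_def)

lemma card_uncovered: "r * (r * card uncovered) \<le> 2 * K"
proof -
  let ?C = "\<Union>w\<in>W. {w..<w+h}"
  have "uncovered = {..<K+L} - ?C" by (auto simp: uncovered_def)
  moreover have sub: "?C \<subseteq> {..<K+L}" using W_le by force
  ultimately have "card uncovered = K + L - card W * h"
    using card_Diff_subset[of ?C "{..<K+L}"] finite_subset[OF sub] card_copies[OF sep finite_W] by simp
  then have "card uncovered = K - card W * h + L" using W_cover by simp
  then have "r * (r * card uncovered) = r * r * (K - card W * h) + r * (r * r * h)"
    by (simp add: L_def algebra_simps)
  also have "\<dots> \<le> K + r * k" using W_dense k_large by (intro add_mono mult_le_mono2)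
  finally show ?thesis using K_large by linarith
qed

text \<open>At most \<open>r - 1\<close> copies meet a bad block: those starting in it, and one entering from the left.\<close>
lemma bad_block_uncovered:
  assumes "t < K" "blk t * L + L \<le> k" "\<not> good t"
  shows "h \<le> card {u\<in>uncovered. same_block t u}"
proof -
  let ?B = "{base t..<base t + L}"
  define V where "V = {w\<in>W. w < base t + L \<and> base t < w + h}"
  have finV: "finite V" using finite_W by (simp add: V_def)
  have "card (V - starts t) \<le> 1"
  proof -
    have "w = w'" if "w \<in> V - starts t" "w' \<in> V - starts t" for w w'
      by (rule separated_unique[OF sep, of _ _ "base t"]) (use that in \<open>auto simp: V_def starts_def\<close>)
    then show ?thesis by (metis One_nat_def card_le_Suc0_iff_eq finV finite_Diff)
  qed
  moreover have "card (starts t) \<le> r - 2" using assms by (simp add: good_def)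
  moreover have "card V \<le> card (V - starts t) + card (starts t)"
    by (metis Un_Diff_cancel2 card_Un_le card_mono finV finite_Un finite_starts le_trans sup_ge1)
  ultimately have cV: "card V \<le> r - 1" using r_ge by linarith
  have "?B - (\<Union>w\<in>V. {w..<w+h}) \<subseteq> {u\<in>uncovered. same_block t u}"
  proof
    fix u assume u: "u \<in> ?B - (\<Union>w\<in>V. {w..<w+h})"
    have bk: "base t = t div k * k + blk t * L" by (simp add: base_def)
    have 1: "u div k = t div k"
      using u assms(2) unfolding bk by (intro div_nat_eqI) (auto simp: algebra_simps)
    have "u mod k = u - t div k * k" using 1 by (metis minus_div_mult_eq_mod)
    then have "blk u = blk t"
      unfolding blk_def[of u] using u unfolding bk by (intro div_nat_eqI) (auto simp: algebra_simps)
    then have "same_block t u" using 1 by (simp add: same_block_def)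
    moreover have "u \<in> uncovered" using u base_le[of t] assms(1) by (auto simp: uncovered_def V_def)
    ultimately show "u \<in> {u\<in>uncovered. same_block t u}" by simp
  qed
  then have "card (?B - (\<Union>w\<in>V. {w..<w+h})) \<le> card {u\<in>uncovered. same_block t u}"
    by (intro card_mono) (auto simp: finite_uncovered)
  moreover have "card ?B - card (\<Union>w\<in>V. {w..<w+h}) \<le> card (?B - (\<Union>w\<in>V. {w..<w+h}))"
    by (rule diff_card_le_card_Diff) (use finV in auto)
  moreover have "card (\<Union>w\<in>V. {w..<w+h}) \<le> (r - 1) * h"
    using card_copies[OF separated_subset[OF sep] finV] cV by (simp add: V_def)
  moreover have "L = (r - 1) * h + h" unfolding L_def using r_ge by (cases r) auto
  ultimately show ?thesis by simp
qed

lemma good_block_unmatched: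
  assumes "good t"
  shows "card {u. u < K \<and> \<not> matched u \<and> same_block t u} \<le> 2 * h"
proof -
  have "card {u. u < K \<and> \<not> matched u \<and> same_block t u} \<le> card {blk t * L + (r - 2) * h..<blk t * L + L}"
  proof (rule card_inj_on_le[of "relocate"])
    show "inj_on relocate {u. u < K \<and> \<not> matched u \<and> same_block t u}"
      by (rule inj_onI) (auto simp: same_block_def intro: relocate_inj)
    show "relocate ` {u. u < K \<and> \<not> matched u \<and> same_block t u} \<subseteq> {blk t * L + (r - 2) * h..<blk t * L + L}"
    proof (rule image_subsetI)
      fix u assume "u \<in> {u. u < K \<and> \<not> matched u \<and> same_block t u}"
      then have u: "\<not> matched u" "same_block t u" by auto
      then have "good u" "blk u = blk t" using same_blockD[OF u(2)] assms by auto
      then show "relocate u \<in> {blk t * L + (r - 2) * h..<blk t * L + L}"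
        using relocate_unmatched_ge[OF _ u(1)] relocate_block[of u] by simp
    qed
  qed simp
  moreover have "L = (r - 2) * h + 2 * h"
    unfolding L_def add_mult_distrib[symmetric] using r_ge by (intro arg_cong[where f="\<lambda>x. x * h"]) simp
  ultimately show ?thesis by simp
qed

text \<open>In a good block the unmatched positions fit into two chunks of length \<open>h\<close>.
  A bad block loses all its \<open>r * h\<close> positions, but contains at least \<open>h\<close>
  uncovered ones, so each uncovered position pays for \<open>r\<close> lost ones. This factor is the
  reason for \<open>r * r\<close> in \<open>W_dense\<close>.\<close>

lemma block_unmatched:
  assumes "t < K" "blk t * L + L \<le> k"
  shows "card {u. u < K \<and> \<not> matched u \<and> same_block t u} \<le> 2 * h + r * card {u\<in>uncovered. same_block t u}"
proof (cases "good t")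
  case True then show ?thesis using good_block_unmatched by (meson le_add1 le_trans)
next
  case False
  have "card {u. u < K \<and> \<not> matched u \<and> same_block t u} \<le> card {base t..<base t + L}"
  proof (rule card_mono)
    show "{u. u < K \<and> \<not> matched u \<and> same_block t u} \<subseteq> {base t..<base t + L}"
    proof
      fix u assume "u \<in> {u. u < K \<and> \<not> matched u \<and> same_block t u}"
      then have "base u = base t" using same_blockD(1) by blast
      then show "u \<in> {base t..<base t + L}" using base_le[of u] less_base[of u] by simp
    qed
  qed simp
  also have "\<dots> = r * h" by (simp add: L_def)
  also have "\<dots> \<le> r * card {u\<in>uncovered. same_block t u}"
    using bad_block_uncovered[OF assms False] by (rule mult_le_mono2)
  finally show ?thesis by simp
qed

text \<open>The bound of \<open>block_unmatched\<close> is summed over the complete blocks: the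
  terms \<open>2 * h\<close> give \<open>4 * K\<close> and the uncovered positions
  \<open>2 * K\<close>. Truncated blocks add another \<open>2 * K\<close>.\<close>

lemma card_unmatched: "r * card {t. t < K \<and> \<not> matched t} \<le> 8 * K"
proof -
  let ?S = "{t. t < K \<and> \<not> matched t \<and> blk t * L + L \<le> k}"
  let ?f = "\<lambda>t. (t div k, blk t)"
  let ?n = "\<lambda>y. card {u\<in>uncovered. ?f u = y}"
  have sb: "?f u = ?f t \<longleftrightarrow> same_block t u" for t u unfolding same_block_def by auto
  have "card ?S = (\<Sum>y\<in>?f ` ?S. card {x\<in>?S. ?f x = y})" by (rule card_eq_sum_fibers) simp
  also have "\<dots> \<le> (\<Sum>y\<in>?f ` ?S. 2 * h + r * ?n y)"
  proof (rule sum_mono)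
    fix y assume "y \<in> ?f ` ?S"
    then obtain t where t: "t \<in> ?S" "y = ?f t" by blast
    have "card {x\<in>?S. ?f x = y} \<le> card {u. u < K \<and> \<not> matched u \<and> same_block t u}"
      unfolding t(2) sb by (intro card_mono) auto
    also have "\<dots> \<le> 2 * h + r * card {u\<in>uncovered. same_block t u}" using block_unmatched[of t] t(1) by simp
    finally show "card {x\<in>?S. ?f x = y} \<le> 2 * h + r * ?n y" unfolding t(2) sb .
  qed
  also have "\<dots> = 2 * h * card (?f ` ?S) + r * (\<Sum>y\<in>?f ` ?S. ?n y)"
    by (simp add: sum.distrib sum_distrib_left)
  also have "(\<Sum>y\<in>?f ` ?S. ?n y) \<le> card uncovered"
  proof -
    have "(\<Sum>y\<in>?f ` ?S. ?n y) = card (\<Union>y\<in>?f ` ?S. {u\<in>uncovered. ?f u = y})"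
      by (rule card_UN_disjoint[symmetric]) (auto simp: finite_uncovered)
    also have "\<dots> \<le> card uncovered" by (rule card_mono[OF finite_uncovered]) auto
    finally show ?thesis .
  qed
  also have "card (?f ` ?S) \<le> (K div k + 1) * (k div L)"
  proof -
    have "?f ` ?S \<subseteq> {..K div k} \<times> {..<k div L}"
    proof (rule image_subsetI)
      fix t assume t: "t \<in> ?S"
      then have "Suc (blk t) * L \<le> k" by simp
      then have "Suc (blk t) \<le> k div L" using L_pos by (metis less_eq_div_iff_mult_less_eq)
      then show "?f t \<in> {..K div k} \<times> {..<k div L}" using div_le_K t by auto
    qed
    then have "card (?f ` ?S) \<le> card ({..K div k} \<times> {..<k div L})" by (intro card_mono) auto
    then show ?thesis by simp
  qed
  finally have "card ?S \<le> 2 * h * ((K div k + 1) * (k div L)) + r * card uncovered" by simp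
  then have "r * card ?S \<le> r * (2 * h * ((K div k + 1) * (k div L)) + r * card uncovered)" by (rule mult_le_mono2)
  also have "\<dots> = 2 * ((K div k + 1) * (k div L * L)) + r * (r * card uncovered)"
    by (simp add: L_def algebra_simps)
  also have "\<dots> \<le> 2 * ((K div k + 1) * k) + 2 * K"
    using card_uncovered by (intro add_mono mult_le_mono2) auto
  finally have 1: "r * card ?S \<le> 6 * K" using chunks_le by linarith
  have "{t. t < K \<and> \<not> matched t} \<subseteq> ?S \<union> {t. t < K \<and> k < blk t * L + L}" by auto
  then have "card {t. t < K \<and> \<not> matched t} \<le> card (?S \<union> {t. t < K \<and> k < blk t * L + L})"
    by (intro card_mono) auto
  also have "\<dots> \<le> card ?S + card {t. t < K \<and> k < blk t * L + L}" by (rule card_Un_le)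
  finally have "r * card {t. t < K \<and> \<not> matched t} \<le> r * (card ?S + card {t. t < K \<and> k < blk t * L + L})"
    by (rule mult_le_mono2)
  then show ?thesis using 1 card_partial_blocks by (simp add: algebra_simps)
qed

end

section \<open>Coding a Lebesgue space by integer sequences\<close>

abbreviation code_space :: "(nat \<Rightarrow> nat) measure" where
  "code_space \<equiv> PiM UNIV (\<lambda>_. count_space UNIV)"

lemma space_code_space [simp]: "space code_space = UNIV"
  by (simp add: space_PiM)

lemma complete_measure_completion: "complete_measure (completion P)"
  by (rule completion.complete_measure_axioms)

lemma measurable_distr_completion:
  assumes "complete_measure M" and h: "h \<in> measurable M P" and d: "distr M P h = P"
  shows "h \<in> measurable M (completion P)" "distr M (completion P) h = completion P"
proof -
  interpret complete_measure M by fact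
  show m: "h \<in> measurable M (completion P)"
    by (rule measurable_completion2[OF h]) (simp add: d)
  show "distr M (completion P) h = completion P"
  proof (rule measure_eqI)
    fix A assume "A \<in> sets (distr M (completion P) h)"
    then have A: "A \<in> sets (completion P)" by simp
    have "AE x in distr M P h. x \<in> main_part P A \<longleftrightarrow> x \<in> A"
      unfolding d by (rule AE_in_main_part[OF A])
    then have "AE x in M. h x \<in> main_part P A \<longleftrightarrow> h x \<in> A" by (rule AE_distrD[OF h])
    then have "emeasure M (h -` A \<inter> space M) = emeasure M (h -` main_part P A \<inter> space M)"
      by (intro emeasure_eq_AE) (use measurable_sets[OF m] measurable_sets[OF h] A in auto)
    also have "\<dots> = emeasure (distr M P h) (main_part P A)"
      using h A by (simp add: emeasure_distr)
    finally show "emeasure (distr M (completion P) h) A = emeasure (completion P) A"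
      using m A by (simp add: emeasure_distr d)
  qed simp
qed

text \<open>Recovers a real number from its rational upper cuts by a countable infimum, hence
  measurably; \<open>\<infinity>\<close> is neutral for the cuts that fail.\<close>

lemma ereal_INF_rat:
  fixes a :: real
  shows "(INF r::rat. if a < of_rat r then ereal (of_rat r) else \<infinity>) = ereal a"
proof (rule antisym)
  show "(INF r::rat. if a < of_rat r then ereal (of_rat r) else \<infinity>) \<le> ereal a"
  proof (rule ereal_le_epsilon2)
    fix e :: real assume "0 < e"
    then obtain q :: rat where q: "a < of_rat q" "of_rat q < a + e"
      using of_rat_dense[of a "a + e"] by auto
    have "(INF r::rat. if a < of_rat r then ereal (of_rat r) else \<infinity>) \<le> ereal (of_rat q)"
      by (rule INF_lower2[of q]) (use q in auto)
    also have "\<dots> \<le> ereal a + ereal e" using q by simp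
    finally show "(INF r::rat. if a < of_rat r then ereal (of_rat r) else \<infinity>) \<le> ereal a + ereal e" .
  qed
next
  show "ereal a \<le> (INF r::rat. if a < of_rat r then ereal (of_rat r) else \<infinity>)"
    by (rule INF_greatest) (simp add: less_imp_le)
qed

text \<open>A Lebesgue space has a real coordinate \<open>f\<close> with almost everywhere inverse
  \<open>g\<close>. By \<open>gen\<close> the rational cuts of \<open>f\<close> are visible in the
  code, so \<open>f\<close> factors almost everywhere as \<open>F\<close> after
  \<open>\<Theta>\<close>, and \<open>g \<circ> F\<close> inverts the code.\<close>

theorem coding_isomorphism:
  fixes \<Theta> :: "'a \<Rightarrow> nat \<Rightarrow> nat"
  assumes leb: "lebesgue_prob_space M"
    and \<Theta>: "\<Theta> \<in> measurable M code_space"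
    and gen: "\<And>A. A \<in> sets M \<Longrightarrow> \<exists>D\<in>sets code_space. AE x in M. x \<in> A \<longleftrightarrow> \<Theta> x \<in> D"
  shows "\<exists>G. measure_iso M (completion (distr M code_space \<Theta>)) \<Theta> G"
proof -
  define P where "P = distr M code_space \<Theta>"
  obtain L :: "real measure" and f g where L: "real_distribution L" and iso: "measure_iso M (completion L) f g"
    and cM: "complete_measure M"
    using leb by (auto simp: lebesgue_prob_space_def)
  interpret L: real_distribution L by fact
  have f: "f \<in> measurable M (completion L)" and df: "distr M (completion L) f = completion L"
    and g: "g \<in> measurable (completion L) M" and dg: "distr (completion L) M g = M"
    and gf: "AE x in M. g (f x) = x"
    using iso by (auto simp: measure_iso_def)
  have f': "f \<in> borel_measurable M"
  proof (rule measurableI)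
    fix A :: "real set" assume "A \<in> sets borel"
    then have "A \<in> sets (completion L)" by simp
    then show "f -` A \<inter> space M \<in> sets M" by (rule measurable_sets[OF f])
  qed simp
  have df': "distr M borel f = L"
  proof (rule measure_eqI)
    fix A assume "A \<in> sets (distr M borel f)"
    then have A: "A \<in> sets borel" by simp
    then have "emeasure (distr M (completion L) f) A = emeasure (completion L) A" by (simp add: df)
    then show "emeasure (distr M borel f) A = emeasure L A"
      using A f f' by (simp add: emeasure_distr)
  qed simp
  have "\<forall>r::rat. \<exists>D\<in>sets code_space. AE x in M. x \<in> {x\<in>space M. f x < of_rat r} \<longleftrightarrow> \<Theta> x \<in> D"
    using f' by (intro allI gen) simp
  then have "\<forall>r::rat. \<exists>D. D \<in> sets code_space \<and> (AE x in M. x \<in> {x\<in>space M. f x < of_rat r} \<longleftrightarrow> \<Theta> x \<in> D)"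
    by blast
  from choice[OF this] obtain D where D: "\<And>r::rat. D r \<in> sets code_space"
    "\<And>r. AE x in M. x \<in> {x\<in>space M. f x < of_rat r} \<longleftrightarrow> \<Theta> x \<in> D r" by blast
  define F where "F z = real_of_ereal (INF r::rat. if z \<in> D r then ereal (of_rat r) else \<infinity>)" for z
  have F: "F \<in> borel_measurable code_space"
    unfolding F_def
    by (intro borel_measurable_real_of_ereal borel_measurable_INF measurable_If_set) (use D in auto)
  have F': "F \<in> borel_measurable P" using F by (simp add: P_def measurable_distr_eq1)
  have "AE x in M. \<forall>r. x \<in> {x\<in>space M. f x < of_rat r} \<longleftrightarrow> \<Theta> x \<in> D r"
    using D(2) by (simp add: AE_all_countable)
  then have F\<Theta>: "AE x in M. F (\<Theta> x) = f x"
  proof (rule AE_mp, intro AE_I2 impI)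
    fix x assume x: "x \<in> space M" "\<forall>r. x \<in> {x\<in>space M. f x < of_rat r} \<longleftrightarrow> \<Theta> x \<in> D r"
    then have "\<And>r. \<Theta> x \<in> D r \<longleftrightarrow> f x < of_rat r" by simp
    then show "F (\<Theta> x) = f x" unfolding F_def by (simp only: ereal_INF_rat real_of_ereal.simps)
  qed
  have "distr P borel F = distr M borel (F \<circ> \<Theta>)"
    unfolding P_def by (rule distr_distr[OF F \<Theta>])
  also have "\<dots> = distr M borel f"
    by (rule distr_cong_AE) (use F\<Theta> F \<Theta> f' in \<open>auto intro: measurable_comp\<close>)
  finally have dF: "distr P borel F = L" using df' by simp
  have "distr P L F = distr P borel F" by (rule distr_cong) auto
  then have dF': "distr (completion P) L F = L"
    using dF F' by (subst distr_completion) (auto cong: measurable_cong_sets)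
  have FL: "F \<in> measurable (completion P) L"
    by (rule measurable_completion) (use F' in \<open>auto cong: measurable_cong_sets\<close>)
  note F2 = measurable_distr_completion[OF complete_measure_completion FL dF']
  define G where "G = g \<circ> F"
  have G: "G \<in> measurable (completion P) M" unfolding G_def by (rule measurable_comp[OF F2(1) g])
  have dG: "distr (completion P) M G = M"
    unfolding G_def using distr_distr[OF g F2(1)] F2(2) dg by simp
  have \<Theta>P: "\<Theta> \<in> measurable M P" and d\<Theta>P: "distr M P \<Theta> = P"
    using \<Theta> by (auto simp: P_def cong: measurable_cong_sets distr_cong)
  note \<Theta>2 = measurable_distr_completion[OF cM \<Theta>P d\<Theta>P]
  have G\<Theta>: "AE x in M. G (\<Theta> x) = x"
    using F\<Theta> gf by eventually_elim (simp add: G_def)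
  \<comment> \<open>Almost every code is the image of a point, so the identity may be tested after
    pulling back along \<open>\<Theta>\<close>; one coordinate at a time, the set in question is
    measurable.\<close>
  have "AE z in completion P. \<forall>i. \<Theta> (G z) i = z i"
  proof (subst AE_all_countable, intro allI)
    fix i
    have "(\<lambda>z. z i) \<in> measurable code_space (count_space UNIV)"
      by (rule measurable_component_singleton) simp
    then have 1: "(\<lambda>z. z i) \<in> measurable (completion P) (count_space UNIV)"
      by (intro measurable_completion) (simp add: P_def)
    have 2: "(\<lambda>z. \<Theta> (G z) i) \<in> measurable (completion P) (count_space UNIV)"
      using measurable_compose[OF measurable_compose[OF G \<Theta>] measurable_component_singleton[of i]] by simp
    have "{z \<in> space (completion P). \<Theta> (G z) i = z i} \<in> sets (completion P)"
      using 1 2 by measurable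
    then have "(AE z in distr M (completion P) \<Theta>. \<Theta> (G z) i = z i) \<longleftrightarrow> (AE x in M. \<Theta> (G (\<Theta> x)) i = \<Theta> x i)"
      by (rule AE_distr_iff[OF \<Theta>2(1)])
    moreover have "AE x in M. \<Theta> (G (\<Theta> x)) i = \<Theta> x i" using G\<Theta> by eventually_elim simp
    ultimately show "AE z in completion P. \<Theta> (G z) i = z i" unfolding \<Theta>2(2) by blast
  qed
  then have "AE z in completion P. \<Theta> (G z) = z" by eventually_elim (rule ext, simp)
  then have "measure_iso M (completion P) \<Theta> G"
    using \<Theta>2 G dG G\<Theta> by (simp add: measure_iso_def)
  then show ?thesis unfolding P_def by blast
qed

section \<open>Towers of rank-one transformations\<close>

definition copy_offset :: "nat \<Rightarrow> nat set \<Rightarrow> nat \<Rightarrow> nat" where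
  "copy_offset h W t =
     (if \<exists>w\<in>W. w \<le> t \<and> t < w + h then t - (THE w. w \<in> W \<and> w \<le> t \<and> t < w + h) else h)"

lemma copy_offset_in:
  assumes "separated h W" "w \<in> W" "w \<le> t" "t < w + h"
  shows "copy_offset h W t = t - w"
proof -
  have "(THE w. w \<in> W \<and> w \<le> t \<and> t < w + h) = w"
    by (rule the_equality) (use assms separated_unique[OF assms(1)] in blast)+
  then show ?thesis using assms by (auto simp: copy_offset_def)
qed

lemma copy_offset_out: "\<not> (\<exists>w\<in>W. w \<le> t \<and> t < w + h) \<Longrightarrow> copy_offset h W t = h"
  by (auto simp: copy_offset_def)

lemma copy_offset_lessD:
  assumes "separated h W" "copy_offset h W t < h"
  shows "\<exists>w\<in>W. w \<le> t \<and> t < w + h \<and> copy_offset h W t = t - w"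
proof -
  obtain w where "w \<in> W" "w \<le> t" "t < w + h" using assms(2) copy_offset_out[of W t h] by fastforce
  then show ?thesis using copy_offset_in[OF assms(1)] by blast
qed

text \<open>The value \<open>pos j x = H j\<close> encodes that \<open>x\<close> lies outside the \<open>j\<close>-th tower; likewise for \<open>copy_offset\<close>.\<close>

locale coded_system =
  fixes M :: "'a measure" and T :: "'a \<Rightarrow> 'a" and H :: "nat \<Rightarrow> nat" and W :: "nat \<Rightarrow> nat set"
    and pos :: "nat \<Rightarrow> 'a \<Rightarrow> nat" and b :: "nat \<Rightarrow> real"
  assumes prob: "prob_space M" and complete: "complete_measure M" and pmp: "pmp_automorphism M T"
    and H_pos: "\<And>j. 0 < H j"
    and pos_measurable: "\<And>j. pos j \<in> measurable M (count_space UNIV)"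
    and pos_le: "\<And>j x. pos j x \<le> H j"
    and pos_uniform: "\<And>j t. t < H j \<Longrightarrow> measure M {x\<in>space M. pos j x = t} = b j"
    and W_sep: "\<And>j. separated (H j) (W j)"
    and W_le: "\<And>j w. w \<in> W j \<Longrightarrow> w + H j \<le> H (Suc j)"
    and coherent: "AE x in M. \<forall>j. pos j x = copy_offset (H j) (W j) (pos (Suc j) x)"
    and orbit: "AE x in M. \<forall>c j. pos j x < H j \<longrightarrow> 0 \<le> int (pos j x) + c \<longrightarrow> int (pos j x) + c < int (H j) \<longrightarrow>
      int (pos j (iterate_int M T c x)) = int (pos j x) + c"
    and iso: "\<exists>G. measure_iso M (completion (distr M code_space (\<lambda>x j. pos j x))) (\<lambda>x j. pos j x) G"

lemma eq_mod_null_trans: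
  assumes "eq_mod_null M A C" "eq_mod_null M C D" shows "eq_mod_null M A D"
  using assms unfolding eq_mod_null_def by eventually_elim simp

lemma eq_mod_null_sym: "eq_mod_null M A C \<Longrightarrow> eq_mod_null M C A"
  unfolding eq_mod_null_def by (simp only: eq_commute)

locale pmp_system = prob_space M for M :: "'a measure" +
  fixes T :: "'a \<Rightarrow> 'a"
  assumes pmp: "pmp_automorphism M T"
begin

abbreviation "T' \<equiv> inv_into (space M) T"

lemma bij: "bij_betw T (space M) (space M)" and T_meas: "T \<in> measurable M M"
  and T'_meas: "T' \<in> measurable M M" and distr_T: "distr M M T = M"
  using pmp by (auto simp: pmp_automorphism_def)

lemma T'_T: "x \<in> space M \<Longrightarrow> T' (T x) = x"
  using bij by (simp add: bij_betw_def)
lemma T_T': "x \<in> space M \<Longrightarrow> T (T' x) = x"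
  using bij by (simp add: bij_betw_def f_inv_into_f)
lemma T_space: "x \<in> space M \<Longrightarrow> T x \<in> space M" using T_meas by (rule measurable_space)
lemma T'_space: "x \<in> space M \<Longrightarrow> T' x \<in> space M" using T'_meas by (rule measurable_space)

lemma funpow_T_space: "x \<in> space M \<Longrightarrow> (T ^^ k) x \<in> space M"
  by (induction k) (auto simp: T_space)
lemma funpow_T'_space: "x \<in> space M \<Longrightarrow> (T' ^^ k) x \<in> space M"
  by (induction k) (auto simp: T'_space)

lemma funpow_T'_T: "x \<in> space M \<Longrightarrow> (T' ^^ k) ((T ^^ k) x) = x"
proof (induction k)
  case (Suc k)
  have "(T' ^^ Suc k) ((T ^^ Suc k) x) = (T' ^^ k) (T' (T ((T ^^ k) x)))"
    by (simp only: funpow_Suc_right[of k T'] funpow.simps(2)[of k T] comp_apply)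
  then show ?case using Suc by (simp only: T'_T funpow_T_space)
qed simp

lemma funpow_T_T': "x \<in> space M \<Longrightarrow> (T ^^ k) ((T' ^^ k) x) = x"
proof (induction k)
  case (Suc k)
  have "(T ^^ Suc k) ((T' ^^ Suc k) x) = (T ^^ k) (T (T' ((T' ^^ k) x)))"
    by (simp only: funpow_Suc_right[of k T] funpow.simps(2)[of k T'] comp_apply)
  then show ?case using Suc by (simp only: T_T' funpow_T'_space)
qed simp

lemma distr_T': "distr M M T' = M"
proof -
  have "distr M M T' = distr (distr M M T) M T'" by (simp add: distr_T)
  also have "\<dots> = distr M M (T' \<circ> T)" by (rule distr_distr[OF T'_meas T_meas])
  also have "\<dots> = distr M M (\<lambda>x. x)" by (rule distr_cong) (auto simp: T'_T)
  finally show ?thesis by simp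
qed

lemma AE_T: "AE x in M. P x \<Longrightarrow> AE x in M. P (T x)"
  by (rule AE_distrD[OF T_meas]) (simp only: distr_T)
lemma AE_T': "AE x in M. P x \<Longrightarrow> AE x in M. P (T' x)"
  by (rule AE_distrD[OF T'_meas]) (simp only: distr_T')
lemma AE_funpow_T': "AE x in M. P x \<Longrightarrow> AE x in M. P ((T' ^^ k) x)"
proof (induction k arbitrary: P)
  case (Suc k)
  from Suc.IH[OF AE_T'[OF Suc.prems]] show ?case by simp
qed simp
lemma AE_funpow_T: "AE x in M. P x \<Longrightarrow> AE x in M. P ((T ^^ k) x)"
proof (induction k arbitrary: P)
  case (Suc k)
  from Suc.IH[OF AE_T[OF Suc.prems]] show ?case by simp
qed simp

lemma AE_iterate_int:
  assumes "AE x in M. P x" shows "AE x in M. P (iterate_int M T c x)"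
  using AE_funpow_T[OF assms, of "nat c"] AE_funpow_T'[OF assms, of "nat (- c)"]
  unfolding iterate_int_def by (cases "0 \<le> c") simp_all

lemma mem_image:
  assumes "A \<subseteq> space M" "x \<in> space M"
  shows "x \<in> (T ^^ k) ` A \<longleftrightarrow> (T' ^^ k) x \<in> A"
proof
  assume "x \<in> (T ^^ k) ` A"
  then show "(T' ^^ k) x \<in> A" using assms funpow_T'_T by auto
next
  assume "(T' ^^ k) x \<in> A"
  then show "x \<in> (T ^^ k) ` A" using funpow_T_T'[OF assms(2), of k] by (metis imageI)
qed

lemma image_space: "A \<subseteq> space M \<Longrightarrow> (T ^^ k) ` A \<subseteq> space M"
  using funpow_T_space by auto

lemma image_eq_vimage: "A \<subseteq> space M \<Longrightarrow> (T ^^ k) ` A = (T' ^^ k) -` A \<inter> space M"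
  by (rule set_eqI) (metis Int_iff image_space mem_image subsetD vimage_eq)

lemma funpow_T'_meas: "(T' ^^ k) \<in> measurable M M"
  by (induction k) (auto simp: o_def intro: measurable_compose T'_meas)

lemma distr_funpow_T': "distr M M (T' ^^ k) = M"
proof (induction k)
  case 0 show ?case using distr_id by (simp add: id_def)
next
  case (Suc k)
  have "distr M M (T' ^^ Suc k) = distr (distr M M (T' ^^ k)) M T'"
    unfolding distr_distr[OF T'_meas funpow_T'_meas] funpow.simps ..
  then show ?case using Suc distr_T' by (simp only:)
qed

lemma image_sets: "A \<in> sets M \<Longrightarrow> (T ^^ k) ` A \<in> sets M"
  using image_eq_vimage[OF sets.sets_into_space, of A k] measurable_sets[OF funpow_T'_meas, of A k] by simp

lemma measure_image: assumes "A \<in> sets M" shows "measure M ((T ^^ k) ` A) = measure M A"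
proof -
  have "measure M A = measure (distr M M (T' ^^ k)) A" by (simp add: distr_funpow_T')
  also have "\<dots> = measure M ((T' ^^ k) -` A \<inter> space M)"
    using assms by (rule measure_distr[OF funpow_T'_meas])
  finally show ?thesis using image_eq_vimage[OF sets.sets_into_space[OF assms]] by simp
qed

lemma image_image_funpow: "(T ^^ k) ` (T ^^ l) ` A = (T ^^ (k + l)) ` A"
  by (simp add: image_comp funpow_add)

lemma eq_mod_null_image:
  assumes "eq_mod_null M A C" "A \<subseteq> space M" "C \<subseteq> space M"
  shows "eq_mod_null M ((T ^^ k) ` A) ((T ^^ k) ` C)"
  unfolding eq_mod_null_def
proof (rule AE_mp[OF AE_funpow_T'[of _ k]])
  show "AE x in M. x \<in> A \<longleftrightarrow> x \<in> C" using assms by (simp add: eq_mod_null_def)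
  show "AE x in M. ((T' ^^ k) x \<in> A \<longleftrightarrow> (T' ^^ k) x \<in> C) \<longrightarrow> (x \<in> (T ^^ k) ` A \<longleftrightarrow> x \<in> (T ^^ k) ` C)"
    by (rule AE_I2) (simp add: mem_image assms)
qed

lemma iterate_int_image:
  assumes A: "A \<subseteq> space M" and y: "y \<in> (T ^^ t) ` A" and c: "0 \<le> int t + c"
  shows "iterate_int M T c y \<in> (T ^^ nat (int t + c)) ` A"
proof (cases "0 \<le> c")
  case True
  then have "nat (int t + c) = nat c + t" by simp
  then show ?thesis using True y by (auto simp: iterate_int_def funpow_add)
next
  case False
  obtain z where z: "z \<in> A" "y = (T ^^ t) z" using y by blast
  define d where "d = nat (- c)"
  have d: "t = d + (t - d)" "nat (int t + c) = t - d" using c False by (auto simp: d_def)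
  have "y = (T ^^ d) ((T ^^ (t - d)) z)" using z(2) d(1) by (metis comp_apply funpow_add)
  then have "(T' ^^ d) y = (T ^^ (t - d)) z" using funpow_T'_T funpow_T_space z A by auto
  then show ?thesis using False z d(2) by (simp add: iterate_int_def d_def)
qed

end

section \<open>Nested Rokhlin towers: they exhaust the space and their heights tend to
  infinity\<close>

locale tower_sequence = pmp_system +
  fixes k :: "nat \<Rightarrow> nat" and B :: "nat \<Rightarrow> 'a set"
  assumes B_sets: "\<And>n. B n \<in> sets M"
    and B_disj: "\<And>n s t. s < k n \<Longrightarrow> t < k n \<Longrightarrow> s \<noteq> t \<Longrightarrow> disjoint_mod_null M ((T ^^ s) ` B n) ((T ^^ t) ` B n)"
    and B_cover: "\<And>n. \<exists>W. finite W \<and> (\<forall>w\<in>W. w + k n \<le> k (Suc n)) \<and>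
      eq_mod_null M (B n) (\<Union>w\<in>W. (T ^^ w) ` B (Suc n))"
    and B_gen: "\<And>A. A \<in> sets M \<Longrightarrow>
      \<exists>A'\<in>sigma_sets (space M) {(T ^^ t) ` B n |n t. t < k n}. eq_mod_null M A A'"
    and nonatomic: "non_atomic M"
    and k_pos: "\<And>n. 0 < k n" and k_mono: "\<And>n. k n \<le> k (Suc n)"
begin

definition "lev n t = (T ^^ t) ` B n"

lemma lev_sets: "lev n t \<in> sets M" unfolding lev_def by (rule image_sets[OF B_sets])
lemma B_space: "B n \<subseteq> space M" by (rule sets.sets_into_space[OF B_sets])
lemma measure_lev: "measure M (lev n t) = measure M (B n)" unfolding lev_def by (rule measure_image[OF B_sets])
lemma lev_0: "lev n 0 = B n" by (simp add: lev_def)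

lemma k_mono_le: "n \<le> m \<Longrightarrow> k n \<le> k m" by (rule lift_Suc_mono_le[of k, OF k_mono])

lemma AE_lev_unique: "AE x in M. \<forall>n s t. s < k n \<longrightarrow> t < k n \<longrightarrow> x \<in> lev n s \<longrightarrow> x \<in> lev n t \<longrightarrow> s = t"
proof -
  have "AE x in M. s < k n \<longrightarrow> t < k n \<longrightarrow> x \<in> lev n s \<longrightarrow> x \<in> lev n t \<longrightarrow> s = t" for n s t
  proof (cases "s < k n \<and> t < k n \<and> s \<noteq> t")
    case True
    then have "AE x in M. \<not> (x \<in> lev n s \<and> x \<in> lev n t)"
      using B_disj[of s n t] by (simp add: disjoint_mod_null_def lev_def)
    then show ?thesis by eventually_elim blast
  qed auto
  then show ?thesis by (simp only: AE_all_countable) blast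
qed

definition "is_cover n m W \<longleftrightarrow> finite W \<and> (\<forall>w\<in>W. w + k n \<le> k m) \<and>
  (AE x in M. \<forall>t. x \<in> lev n t \<longleftrightarrow> (\<exists>w\<in>W. x \<in> lev m (t + w)))"

lemma is_cover_Suc: "\<exists>W. is_cover n (Suc n) W"
proof -
  obtain W where W: "finite W" "\<forall>w\<in>W. w + k n \<le> k (Suc n)"
    and e: "eq_mod_null M (B n) (\<Union>w\<in>W. (T ^^ w) ` B (Suc n))" using B_cover by blast
  have "AE x in M. x \<in> lev n t \<longleftrightarrow> (\<exists>w\<in>W. x \<in> lev (Suc n) (t + w))" for t
  proof -
    have "eq_mod_null M ((T ^^ t) ` B n) ((T ^^ t) ` (\<Union>w\<in>W. (T ^^ w) ` B (Suc n)))"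
      by (rule eq_mod_null_image[OF e B_space]) (use image_space B_space in blast)
    also have "(T ^^ t) ` (\<Union>w\<in>W. (T ^^ w) ` B (Suc n)) = (\<Union>w\<in>W. lev (Suc n) (t + w))"
      unfolding image_UN image_image_funpow lev_def ..
    finally show ?thesis by (simp add: eq_mod_null_def lev_def)
  qed
  then show ?thesis using W unfolding is_cover_def AE_all_countable by blast
qed

text \<open>Starts add: a copy at \<open>w\<close> inside a copy at \<open>v\<close> starts at
  \<open>w + v\<close>.\<close>

lemma is_cover_exists: "n \<le> m \<Longrightarrow> \<exists>W. is_cover n m W"
proof (induction m rule: dec_induct)
  case base
  have "is_cover n n {0}" by (simp add: is_cover_def)
  then show ?case by blast
next
  case (step m)
  obtain W V where W: "is_cover n m W" and V: "is_cover m (Suc m) V"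
    using step is_cover_Suc by blast
  have "is_cover n (Suc m) ((\<lambda>(w, v). w + v) ` (W \<times> V))"
    unfolding is_cover_def
  proof (intro conjI)
    show "finite ((\<lambda>(w, v). w + v) ` (W \<times> V))" using W V by (simp add: is_cover_def)
    show "\<forall>w\<in>(\<lambda>(w, v). w + v) ` (W \<times> V). w + k n \<le> k (Suc m)"
      using W V by (fastforce simp: is_cover_def)
    have "AE x in M. \<forall>t. x \<in> lev n t \<longleftrightarrow> (\<exists>w\<in>W. x \<in> lev m (t + w))"
      "AE x in M. \<forall>t. x \<in> lev m t \<longleftrightarrow> (\<exists>v\<in>V. x \<in> lev (Suc m) (t + v))"
      using W V by (auto simp: is_cover_def)
    then show "AE x in M. \<forall>t. x \<in> lev n t \<longleftrightarrow> (\<exists>w\<in>(\<lambda>(w, v). w + v) ` (W \<times> V). x \<in> lev (Suc m) (t + w))"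
      by eventually_elim (simp add: add.assoc)
  qed
  then show ?case by blast
qed

definition "R n = (\<Union>t<k n. lev n t)"

lemma R_sets: "R n \<in> sets M" unfolding R_def using lev_sets by blast

lemma measure_R: "measure M (R n) = k n * measure M (B n)"
proof -
  have "measure M (R n) = (\<Sum>t<k n. measure M (lev n t))" unfolding R_def
  proof (rule measure_UNION_AE)
    show "pairwise (\<lambda>s t. AE x in M. x \<notin> lev n s \<or> x \<notin> lev n t) {..<k n}"
    proof (rule pairwiseI)
      fix s t assume *: "s \<in> {..<k n}" "t \<in> {..<k n}" "s \<noteq> t"
      show "AE x in M. x \<notin> lev n s \<or> x \<notin> lev n t"
        using AE_lev_unique by eventually_elim (use * in auto)
    qed
  qed (use lev_sets in \<open>auto simp: fmeasurable_eq_sets\<close>)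
  then show ?thesis by (simp add: measure_lev)
qed

lemma AE_R_mono: assumes "n \<le> m" shows "AE x in M. x \<in> R n \<longrightarrow> x \<in> R m"
proof -
  obtain W where W: "is_cover n m W" using is_cover_exists assms by blast
  then have "AE x in M. \<forall>t. x \<in> lev n t \<longleftrightarrow> (\<exists>w\<in>W. x \<in> lev m (t + w))" by (simp add: is_cover_def)
  then show ?thesis
  proof eventually_elim
    case (elim x)
    show ?case
    proof
      assume "x \<in> R n"
      then obtain t where t: "t < k n" "x \<in> lev n t" by (auto simp: R_def)
      then obtain w where w: "w \<in> W" "x \<in> lev m (t + w)" using elim by blast
      then have "t + w < k m" using W t by (fastforce simp: is_cover_def)
      then show "x \<in> R m" using w by (auto simp: R_def)
    qed
  qed
qed

text \<open>A set on which every tower level is trivial would be an atom of the generated \<open>\<sigma>\<close>-algebra.\<close>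
lemma trivial_trace_null:
  assumes Z: "Z \<in> sets M"
    and triv: "\<And>n t. t < k n \<Longrightarrow> (AE x in M. x \<in> Z \<longrightarrow> x \<notin> lev n t) \<or> (AE x in M. x \<in> Z \<longrightarrow> x \<in> lev n t)"
  shows "emeasure M Z = 0"
proof (rule ccontr)
  assume "emeasure M Z \<noteq> 0"
  then have "emeasure M Z > 0" by (simp add: zero_less_iff_neq_zero)
  then obtain A where A: "A \<in> sets M" "A \<subseteq> Z" "0 < emeasure M A" "emeasure M A < emeasure M Z"
    using nonatomic Z unfolding non_atomic_def by blast
  let ?triv = "\<lambda>A. (AE x in M. x \<in> Z \<longrightarrow> x \<notin> A) \<or> (AE x in M. x \<in> Z \<longrightarrow> x \<in> A)"
  have gen: "?triv A'" if "A' \<in> sigma_sets (space M) {(T ^^ t) ` B n |n t. t < k n}" for A'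
    using that
  proof induction
    case (Basic a) then show ?case using triv by (auto simp: lev_def)
  next
    case Empty then show ?case by simp
  next
    case (Compl a)
    have "AE x in M. x \<in> space M" by simp
    moreover from Compl.IH have "(AE x in M. x \<in> Z \<longrightarrow> x \<notin> a) \<or> (AE x in M. x \<in> Z \<longrightarrow> x \<in> a)" .
    ultimately show ?case
    proof (elim disjE)
      assume "AE x in M. x \<in> Z \<longrightarrow> x \<notin> a" "AE x in M. x \<in> space M"
      then have "AE x in M. x \<in> Z \<longrightarrow> x \<in> space M - a" by eventually_elim simp
      then show ?case by blast
    next
      assume "AE x in M. x \<in> Z \<longrightarrow> x \<in> a"
      then have "AE x in M. x \<in> Z \<longrightarrow> x \<notin> space M - a" by eventually_elim simp
      then show ?case by blast
    qed
  next
    case (Union a)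
    show ?case
    proof (cases "\<exists>i. AE x in M. x \<in> Z \<longrightarrow> x \<in> a i")
      case True
      then obtain i where "AE x in M. x \<in> Z \<longrightarrow> x \<in> a i" by blast
      then have "AE x in M. x \<in> Z \<longrightarrow> x \<in> (\<Union>i. a i)" by eventually_elim blast
      then show ?thesis by blast
    next
      case False
      then have "\<forall>i. AE x in M. x \<in> Z \<longrightarrow> x \<notin> a i" using Union.IH by blast
      then have "AE x in M. \<forall>i. x \<in> Z \<longrightarrow> x \<notin> a i" unfolding AE_all_countable .
      then have "AE x in M. x \<in> Z \<longrightarrow> x \<notin> (\<Union>i. a i)" by eventually_elim blast
      then show ?thesis by blast
    qed
  qed
  obtain A' where A': "A' \<in> sigma_sets (space M) {(T ^^ t) ` B n |n t. t < k n}" "eq_mod_null M A A'"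
    using B_gen[OF A(1)] by blast
  have eq: "AE x in M. x \<in> A \<longleftrightarrow> x \<in> A'" using A'(2) by (simp add: eq_mod_null_def)
  from gen[OF A'(1)] show False
  proof
    assume "AE x in M. x \<in> Z \<longrightarrow> x \<notin> A'"
    with eq have "AE x in M. x \<notin> A" by eventually_elim (use A(2) in blast)
    then have "emeasure M A = 0" using A(1) by (simp add: AE_iff_measurable[OF _ refl] AE_iff_null_sets null_setsD1)
    then show False using A(3) by simp
  next
    assume "AE x in M. x \<in> Z \<longrightarrow> x \<in> A'"
    with eq have "AE x in M. x \<in> Z \<longleftrightarrow> x \<in> A" by eventually_elim (use A(2) in blast)
    then have "emeasure M Z = emeasure M A" by (rule emeasure_eq_AE[OF _ Z A(1)])
    then show False using A(4) by simp
  qed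
qed

text \<open>The complement of the union of all towers meets no level, so
  \<open>trivial_trace_null\<close> makes it null. The towers increase only modulo null sets, hence
  the detour through the unions \<open>U n\<close>.\<close>

lemma R_limit: "(\<lambda>n. measure M (R n)) \<longlonglongrightarrow> 1"
proof -
  define U where "U n = (\<Union>m\<le>n. R m)" for n
  have U_sets: "U n \<in> sets M" for n unfolding U_def using R_sets by blast
  have eq: "measure M (U n) = measure M (R n)" for n
  proof (rule finite_measure_eq_AE)
    have "AE x in M. \<forall>m\<in>{..n}. x \<in> R m \<longrightarrow> x \<in> R n" by (rule AE_finite_allI) (auto intro: AE_R_mono)
    then show "AE x in M. x \<in> U n \<longleftrightarrow> x \<in> R n" by eventually_elim (auto simp: U_def)
  qed (use U_sets R_sets in auto)
  have Rall: "(\<Union>n. R n) \<in> sets M" using R_sets by blast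
  have "emeasure M (space M - (\<Union>n. R n)) = 0"
  proof (rule trivial_trace_null)
    show "space M - (\<Union>n. R n) \<in> sets M" using Rall by blast
    fix n t assume "t < k n"
    then have "x \<in> lev n t \<Longrightarrow> x \<in> R n" for x by (auto simp: R_def)
    then show "(AE x in M. x \<in> space M - (\<Union>n. R n) \<longrightarrow> x \<notin> lev n t) \<or>
        (AE x in M. x \<in> space M - (\<Union>n. R n) \<longrightarrow> x \<in> lev n t)" by auto
  qed
  then have "prob (\<Union>n. R n) = 1" using prob_compl[OF Rall] by (simp add: measure_def)
  moreover have "(\<Union>n. R n) = (\<Union>n. U n)" by (auto simp: U_def)
  moreover have "(\<lambda>n. measure M (U n)) \<longlonglongrightarrow> measure M (\<Union>n. U n)"
    by (rule finite_Lim_measure_incseq) (use U_sets in \<open>auto simp: incseq_def U_def intro: order_trans\<close>)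
  ultimately show ?thesis by (simp add: eq)
qed

text \<open>Bounded heights would be constant from some stage on. A tower then has room for one copy
  of an earlier tower of the same height, at position 0, so every level of every tower contains or
  avoids the base \<open>B n\<close>, up to null sets. Such bases are null by
  \<open>trivial_trace_null\<close>, contradicting \<open>R_limit\<close>.\<close>

lemma k_unbounded: "\<exists>n. c < k n"
proof (rule ccontr)
  assume "\<not> (\<exists>n. c < k n)"
  then have bdd: "k n \<le> c" for n by (meson not_less)
  have fin: "finite (range k)" by (rule finite_subset[of _ "{..c}"]) (use bdd in auto)
  have "Max (range k) \<in> range k" by (rule Max_in[OF fin]) simp
  then obtain n0 where n0: "k n0 = Max (range k)" by (metis imageE)
  have const: "k n = k n0" if "n0 \<le> n" for n
    using k_mono_le[OF that] n0 Max_ge[OF fin, of "k n"] by (metis le_antisym rangeI)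
  have null: "emeasure M (B n) = 0" if n: "n0 \<le> n" for n
  proof (rule trivial_trace_null[OF B_sets])
    fix m t assume t: "t < k m"
    show "(AE x in M. x \<in> B n \<longrightarrow> x \<notin> lev m t) \<or> (AE x in M. x \<in> B n \<longrightarrow> x \<in> lev m t)"
    proof (cases "n \<le> m")
      case True
      then obtain W where W: "is_cover n m W" using is_cover_exists by blast
      have W0: "W \<subseteq> {0}" using W const[OF n] const[of m] n True by (force simp: is_cover_def)
      have "AE x in M. \<forall>t. x \<in> lev n t \<longleftrightarrow> (\<exists>w\<in>W. x \<in> lev m (t + w))" using W by (simp add: is_cover_def)
      then have "AE x in M. x \<in> B n \<longrightarrow> x \<in> lev m 0"
        by eventually_elim (use W0 in \<open>auto simp: lev_0 dest!: spec[of _ 0]\<close>)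
      moreover note AE_lev_unique
      ultimately have "AE x in M. x \<in> B n \<longrightarrow> x \<in> lev m t \<longleftrightarrow> t = 0"
        by eventually_elim (use t k_pos[of m] in auto)
      then show ?thesis by (cases "t = 0") auto
    next
      case False
      then obtain W where W: "is_cover m n W" using is_cover_exists by (meson nat_le_linear)
      have "AE x in M. \<forall>t. x \<in> lev m t \<longleftrightarrow> (\<exists>w\<in>W. x \<in> lev n (t + w))" using W by (simp add: is_cover_def)
      moreover note AE_lev_unique
      ultimately have "AE x in M. x \<in> B n \<longrightarrow> x \<in> lev m t \<longleftrightarrow> t = 0 \<and> 0 \<in> W"
      proof eventually_elim
        case (elim x)
        show ?case
        proof (intro impI)
          assume x: "x \<in> B n"
          have lt: "t + w < k n" if "w \<in> W" for w using W t that by (fastforce simp: is_cover_def)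
          have "t + w = 0" if "w \<in> W" "x \<in> lev n (t + w)" for w
            using elim(2) lt[OF that(1)] that(2) x k_pos[of n] lev_0[of n] by blast
          then show "x \<in> lev m t \<longleftrightarrow> t = 0 \<and> 0 \<in> W"
            using elim(1) x lev_0[of n] by (metis add_is_0 add_0)
        qed
      qed
      then show ?thesis by (cases "t = 0 \<and> 0 \<in> W") auto
    qed
  qed
  have "measure M (R n) = 0" if "n0 \<le> n" for n using null[OF that] measure_R[of n] by (simp add: measure_def)
  then have "eventually (\<lambda>n. measure M (R n) = 0) sequentially" by (auto simp: eventually_sequentially)
  then have "(\<lambda>n. measure M (R n)) \<longlonglongrightarrow> 0" by (rule tendsto_eventually)
  then show False using R_limit LIMSEQ_unique by fastforce
qed

lemma k_at_top: "filterlim k at_top sequentially"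
  unfolding filterlim_at_top_ge[where c=0] eventually_sequentially
proof (intro allI impI)
  fix c :: nat
  obtain n where "c < k n" using k_unbounded by blast
  then show "\<exists>N. \<forall>n\<ge>N. c \<le> k n" using k_mono_le by (meson le_trans less_imp_le)
qed

end

section \<open>Positions in the towers as a code for points\<close>

context tower_sequence
begin

definition "pos n x = (LEAST t. x \<in> lev n t \<or> t = k n)"

lemma pos_cases: "x \<in> lev n (pos n x) \<or> pos n x = k n"
  unfolding pos_def by (rule LeastI[of _ "k n"]) simp

lemma pos_le: "pos n x \<le> k n"
  unfolding pos_def by (rule Least_le) simp

lemma pos_measurable: "pos n \<in> measurable M (count_space UNIV)"
proof -
  have "(\<lambda>x. LEAST t. x \<in> lev n t \<or> t = k n) \<in> measurable M (count_space UNIV)"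
    by (rule measurable_Least) (use lev_sets in measurable)
  then show ?thesis unfolding pos_def[abs_def] .
qed

lemma AE_pos: "AE x in M. \<forall>n t. t < k n \<longrightarrow> (x \<in> lev n t \<longleftrightarrow> pos n x = t)"
  using AE_lev_unique
proof eventually_elim
  case (elim x)
  have "pos n x = t" if t: "t < k n" "x \<in> lev n t" for n t
  proof -
    have "pos n x \<le> t" unfolding pos_def by (rule Least_le) (use t in simp)
    then have "x \<in> lev n (pos n x)" "pos n x < k n" using pos_cases[of x n] t by auto
    then show ?thesis using elim t by blast
  qed
  moreover have "x \<in> lev n t" if "t < k n" "pos n x = t" for n t using pos_cases[of x n] that by auto
  ultimately show ?case by blast
qed

lemma measure_pos:
  assumes "t < k n" shows "measure M {x\<in>space M. pos n x = t} = measure M (B n)"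
proof -
  have "measure M {x\<in>space M. pos n x = t} = measure M (lev n t)"
  proof (rule finite_measure_eq_AE)
    show "AE x in M. x \<in> {x\<in>space M. pos n x = t} \<longleftrightarrow> x \<in> lev n t"
      using AE_pos AE_space by eventually_elim (use assms in auto)
    show "{x\<in>space M. pos n x = t} \<in> sets M"
      using measurable_sets[OF pos_measurable, of "{t}" n] by (simp add: vimage_def Int_def conj_commute)
  qed (rule lev_sets)
  then show ?thesis by (simp add: measure_lev)
qed

text \<open>Overlapping copies would put the level \<open>lev m w'\<close> into two different levels
  of tower \<open>n\<close>. Only a null level can do that, whence the assumption of positive
  measure.\<close>

lemma is_cover_separated:
  assumes W: "is_cover n m W" and b: "0 < measure M (B m)"
  shows "separated (k n) W"
  unfolding separated_def
proof (intro ballI impI, rule ccontr)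
  fix w w' assume w: "w \<in> W" "w' \<in> W" "w < w'" "\<not> w + k n \<le> w'"
  have "AE x in M. \<forall>t. x \<in> lev n t \<longleftrightarrow> (\<exists>w\<in>W. x \<in> lev m (t + w))" using W by (simp add: is_cover_def)
  moreover note AE_lev_unique
  ultimately have "AE x in M. x \<notin> lev m w'"
  proof eventually_elim
    case (elim x)
    show ?case
    proof
      assume x: "x \<in> lev m w'"
      have "x \<in> lev n 0" using elim(1) x w(2) by (auto dest!: spec[of _ 0])
      moreover have "x \<in> lev m ((w' - w) + w)" using x w(3) by simp
      then have "x \<in> lev n (w' - w)" using elim(1) w(1) by blast
      ultimately have "0 = w' - w" using elim(2) k_pos[of n] w(3,4)
        by (metis add.commute less_diff_conv2 less_imp_le not_le)
      then show False using w(3) by simp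
    qed
  qed
  then have "measure M (lev m w') = 0"
    using lev_sets[of m w'] by (simp add: AE_iff_null_sets measure_eq_0_null_sets)
  then show False using b by (simp add: measure_lev)
qed

lemma AE_coherent:
  assumes W: "is_cover n m W" and sep: "separated (k n) W"
  shows "AE x in M. pos n x = copy_offset (k n) W (pos m x)"
proof -
  have "AE x in M. \<forall>t. x \<in> lev n t \<longleftrightarrow> (\<exists>w\<in>W. x \<in> lev m (t + w))" using W by (simp add: is_cover_def)
  then show ?thesis using AE_pos
  proof eventually_elim
    case (elim x)
    have lt: "t + w < k m" if "w \<in> W" "t < k n" for w t using W that by (fastforce simp: is_cover_def)
    have key: "pos n x = t \<longleftrightarrow> (\<exists>w\<in>W. pos m x = t + w)" if "t < k n" for t
    proof -
      have "pos n x = t \<longleftrightarrow> x \<in> lev n t" using elim(2) that by blast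
      also have "\<dots> \<longleftrightarrow> (\<exists>w\<in>W. x \<in> lev m (t + w))" using elim(1) by blast
      also have "\<dots> \<longleftrightarrow> (\<exists>w\<in>W. pos m x = t + w)" using elim(2) lt[OF _ that] by blast
      finally show ?thesis .
    qed
    show ?case
    proof (cases "\<exists>w\<in>W. w \<le> pos m x \<and> pos m x < w + k n")
      case True
      then obtain w where w: "w \<in> W" "w \<le> pos m x" "pos m x < w + k n" by blast
      then have "pos n x = pos m x - w" using key[of "pos m x - w"] by force
      then show ?thesis using copy_offset_in[OF sep w] by simp
    next
      case False
      have "\<not> pos n x < k n" using key[of "pos n x"] False by force
      then show ?thesis using copy_offset_out[OF False] pos_le[of n x] by simp
    qed
  qed
qed

lemma AE_orbit:
  "AE x in M. \<forall>c n. pos n x < k n \<longrightarrow> 0 \<le> int (pos n x) + c \<longrightarrow> int (pos n x) + c < int (k n) \<longrightarrow>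
      int (pos n (iterate_int M T c x)) = int (pos n x) + c"
proof -
  have "\<forall>c. AE x in M. \<forall>n t. t < k n \<longrightarrow> (iterate_int M T c x \<in> lev n t \<longleftrightarrow> pos n (iterate_int M T c x) = t)"
    by (intro allI AE_iterate_int[OF AE_pos])
  then have "AE x in M. \<forall>c n t. t < k n \<longrightarrow> (iterate_int M T c x \<in> lev n t \<longleftrightarrow> pos n (iterate_int M T c x) = t)"
    unfolding AE_all_countable .
  then show ?thesis using AE_pos
  proof eventually_elim
    case (elim x)
    show ?case
    proof (intro allI impI)
      fix c n assume *: "pos n x < k n" "0 \<le> int (pos n x) + c" "int (pos n x) + c < int (k n)"
      have "x \<in> lev n (pos n x)" using elim(2) *(1) by blast
      then have "iterate_int M T c x \<in> lev n (nat (int (pos n x) + c))"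
        unfolding lev_def using iterate_int_image[OF B_space _ *(2)] by blast
      then have "pos n (iterate_int M T c x) = nat (int (pos n x) + c)" using elim(1) *(2,3) by (simp add: nat_less_iff)
      then show "int (pos n (iterate_int M T c x)) = int (pos n x) + c" using *(2) by simp
    qed
  qed
qed

lemma coded_generates:
  assumes n: "strict_mono n" and A: "A \<in> sets M"
  shows "\<exists>D\<in>sets code_space. AE x in M. x \<in> A \<longleftrightarrow> (\<lambda>j. pos (n j) x) \<in> D"
proof -
  let ?\<Theta> = "\<lambda>x j. pos (n j) x"
  have gen: "\<exists>D\<in>sets code_space. AE x in M. x \<in> A' \<longleftrightarrow> ?\<Theta> x \<in> D"
    if "A' \<in> sigma_sets (space M) {(T ^^ t) ` B n |n t. t < k n}" for A'
    using that
  proof induction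
    case (Basic a)
    then obtain m t where a: "a = lev m t" "t < k m" by (auto simp: lev_def)
    \<comment> \<open>Coordinate \<open>m\<close> of the code thus refers to a tower no earlier than
      tower \<open>m\<close>, so it decides membership in every level of tower
      \<open>m\<close>.\<close>
    have "m \<le> n m" using seq_suble[OF n] .
    then obtain W where W: "is_cover m (n m) W" using is_cover_exists by blast
    let ?D = "(\<lambda>z. z m) -` ((\<lambda>w. t + w) ` W)"
    have "?D \<in> sets code_space"
      using measurable_sets[OF measurable_component_singleton[of m UNIV "\<lambda>_. count_space UNIV"], of "(\<lambda>w. t + w) ` W"]
      by simp
    moreover have "AE x in M. \<forall>t. x \<in> lev m t \<longleftrightarrow> (\<exists>w\<in>W. x \<in> lev (n m) (t + w))" using W by (simp add: is_cover_def)
    then have "AE x in M. x \<in> a \<longleftrightarrow> ?\<Theta> x \<in> ?D" using AE_pos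
    proof eventually_elim
      case (elim x)
      have lt: "t + w < k (n m)" if "w \<in> W" for w using W that a(2) by (fastforce simp: is_cover_def)
      have "x \<in> a \<longleftrightarrow> (\<exists>w\<in>W. x \<in> lev (n m) (t + w))" using elim(1) a(1) by blast
      also have "\<dots> \<longleftrightarrow> (\<exists>w\<in>W. pos (n m) x = t + w)" using elim(2) lt by blast
      finally show ?case by auto
    qed
    ultimately show ?case by blast
  next
    case Empty
    show ?case by (rule bexI[of _ "{}"]) auto
  next
    case (Compl a)
    then obtain D where D: "D \<in> sets code_space" "AE x in M. x \<in> a \<longleftrightarrow> ?\<Theta> x \<in> D" by blast
    have "AE x in M. x \<in> space M - a \<longleftrightarrow> ?\<Theta> x \<in> space code_space - D"
      using D(2) AE_space by eventually_elim simp
    then show ?case using sets.compl_sets[OF D(1)] by blast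
  next
    case (Union a)
    then have "\<forall>i. \<exists>D. D \<in> sets code_space \<and> (AE x in M. x \<in> a i \<longleftrightarrow> ?\<Theta> x \<in> D)" by blast
    from choice[OF this] obtain D where D: "\<And>i. D i \<in> sets code_space"
      "\<forall>i. AE x in M. x \<in> a i \<longleftrightarrow> ?\<Theta> x \<in> D i" by blast
    from D(2) have "AE x in M. \<forall>i. x \<in> a i \<longleftrightarrow> ?\<Theta> x \<in> D i" unfolding AE_all_countable .
    then have "AE x in M. x \<in> (\<Union>i. a i) \<longleftrightarrow> ?\<Theta> x \<in> (\<Union>i. D i)" by eventually_elim blast
    moreover have "(\<Union>i. D i) \<in> sets code_space" using D(1) by blast
    ultimately show ?case by blast
  qed
  obtain A' where A': "A' \<in> sigma_sets (space M) {(T ^^ t) ` B n |n t. t < k n}" "eq_mod_null M A A'"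
    using B_gen[OF A] by blast
  obtain D where D: "D \<in> sets code_space" "AE x in M. x \<in> A' \<longleftrightarrow> ?\<Theta> x \<in> D" using gen[OF A'(1)] by blast
  have "AE x in M. x \<in> A \<longleftrightarrow> x \<in> A'" using A'(2) by (simp add: eq_mod_null_def)
  with D(2) have "AE x in M. x \<in> A \<longleftrightarrow> ?\<Theta> x \<in> D" by eventually_elim simp
  then show ?thesis using D(1) by blast
qed

definition "cover n m = (SOME W. is_cover n m W)"

lemma is_cover_cover: "n \<le> m \<Longrightarrow> is_cover n m (cover n m)"
  unfolding cover_def by (rule someI_ex[OF is_cover_exists])

theorem coded_subsystem:
  assumes leb: "lebesgue_prob_space M" and n: "strict_mono n" and b: "\<And>j. 0 < measure M (B (n j))"
  shows "coded_system M T (\<lambda>j. k (n j)) (\<lambda>j. cover (n j) (n (Suc j))) (\<lambda>j. pos (n j)) (\<lambda>j. measure M (B (n j)))"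
proof -
  define W where "W j = cover (n j) (n (Suc j))" for j
  have W: "is_cover (n j) (n (Suc j)) (W j)" for j
    unfolding W_def by (rule is_cover_cover) (use n in \<open>simp add: strict_mono_less_eq\<close>)
  have sep: "separated (k (n j)) (W j)" for j by (rule is_cover_separated[OF W b])
  have m\<Theta>: "(\<lambda>x j. pos (n j) x) \<in> measurable M code_space"
    by (rule measurable_PiM_single') (use pos_measurable in auto)
  have "coded_system M T (\<lambda>j. k (n j)) W (\<lambda>j. pos (n j)) (\<lambda>j. measure M (B (n j)))"
  proof (rule coded_system.intro)
    show "prob_space M" by (rule prob_space_axioms)
    show "complete_measure M" using leb by (simp add: lebesgue_prob_space_def)
    show "w + k (n j) \<le> k (n (Suc j))" if "w \<in> W j" for j w using W that by (auto simp: is_cover_def)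
    show "AE x in M. \<forall>j. pos (n j) x = copy_offset (k (n j)) (W j) (pos (n (Suc j)) x)"
      unfolding AE_all_countable using AE_coherent[OF W sep] by blast
    show "AE x in M. \<forall>c j. pos (n j) x < k (n j) \<longrightarrow> 0 \<le> int (pos (n j) x) + c \<longrightarrow> int (pos (n j) x) + c < int (k (n j)) \<longrightarrow>
      int (pos (n j) (iterate_int M T c x)) = int (pos (n j) x) + c"
      using AE_orbit by eventually_elim blast
    show "\<exists>G. measure_iso M (completion (distr M code_space (\<lambda>x j. pos (n j) x))) (\<lambda>x j. pos (n j) x) G"
      by (rule coding_isomorphism[OF leb m\<Theta> coded_generates[OF n]])
  qed (use pmp k_pos pos_measurable pos_le measure_pos sep in auto)
  then show ?thesis unfolding W_def[abs_def] .
qed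

end

section \<open>From cutting and spacing parameters to nested towers\<close>

context pmp_system
begin

lemma eq_chain_image:
  assumes "eq_mod_null M A ((T ^^ l) ` D)" "eq_mod_null M ((T ^^ i) ` A) C"
    and "A \<subseteq> space M" "D \<subseteq> space M"
  shows "eq_mod_null M C ((T ^^ (i + l)) ` D)"
proof -
  have "eq_mod_null M ((T ^^ i) ` A) ((T ^^ i) ` (T ^^ l) ` D)"
    by (rule eq_mod_null_image[OF assms(1,3) image_space[OF assms(4)]])
  then show ?thesis using eq_mod_null_trans[OF eq_mod_null_sym[OF assms(2)]] by (simp only: image_image_funpow)
qed

end

lemma rank_one_tower_sequence:
  assumes ps: "prob_space M" and na: "non_atomic M" and r1: "rank_one M T"
  shows "\<exists>k B. tower_sequence M T k B"
proof -
  obtain q \<sigma> B C \<Sigma> where par: "rank_one_parameters q \<sigma>" and con: "rank_one_construction M T q \<sigma> B C \<Sigma>"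
    and pmp: "pmp_automorphism M T" using r1 by (auto simp: rank_one_def)
  interpret pmp_system M T by (simp add: pmp_system_def ps pmp pmp_system_axioms_def)
  let ?k = "tower_height q \<sigma>"
  have q_pos: "0 < q n" for n using par by (simp add: rank_one_parameters_def)
  have Bs: "B n \<in> sets M" for n using con by (auto simp: rank_one_construction_def)
  have Cs: "i < q n \<Longrightarrow> C n i \<in> sets M" for n i using con by (auto simp: rank_one_construction_def)
  have \<Sigma>s: "i \<le> q n \<Longrightarrow> 1 \<le> j \<Longrightarrow> j \<le> \<sigma> n i \<Longrightarrow> \<Sigma> n i j \<in> sets M" for n i j
    using con by (auto simp: rank_one_construction_def)
  note Bsp = sets.sets_into_space[OF Bs] and Csp = sets.sets_into_space[OF Cs] and \<Sigma>sp = sets.sets_into_space[OF \<Sigma>s]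
  have disj: "s < ?k n \<Longrightarrow> t < ?k n \<Longrightarrow> s \<noteq> t \<Longrightarrow> disjoint_mod_null M ((T ^^ s) ` B n) ((T ^^ t) ` B n)" for n s t
    using con by (auto simp: rank_one_construction_def)
  have part: "eq_mod_null M (\<Union>i<q n. C n i) (B n)" for n using con by (auto simp: rank_one_construction_def)
  have c1: "i < q n \<Longrightarrow> \<sigma> n (i + 1) > 0 \<Longrightarrow> eq_mod_null M ((T ^^ ?k n) ` C n i) (\<Sigma> n (i + 1) 1)" for n i
    using con unfolding rank_one_construction_def by blast
  have c2: "i + 1 < q n \<Longrightarrow> \<sigma> n (i + 1) = 0 \<Longrightarrow> eq_mod_null M ((T ^^ ?k n) ` C n i) (C n (i + 1))" for n i
    using con unfolding rank_one_construction_def by blast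
  have d1: "i \<le> q n \<Longrightarrow> 1 \<le> j \<Longrightarrow> j < \<sigma> n i \<Longrightarrow> eq_mod_null M (T ` \<Sigma> n i j) (\<Sigma> n i (j + 1))" for n i j
    using con unfolding rank_one_construction_def by blast
  have d2: "i < q n \<Longrightarrow> \<sigma> n i > 0 \<Longrightarrow> eq_mod_null M (T ` \<Sigma> n i (\<sigma> n i)) (C n i)" for n i
    using con unfolding rank_one_construction_def by blast
  have e: "eq_mod_null M (B (Suc n)) (if \<sigma> n 0 > 0 then \<Sigma> n 0 1 else C n 0)" for n
    using con unfolding rank_one_construction_def by blast
  have gen: "\<exists>A'\<in>sigma_sets (space M) {(T ^^ t) ` B n |n t. t < ?k n}. eq_mod_null M A A'" if "A \<in> sets M" for A
    using con that unfolding rank_one_construction_def by blast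
  have spacers: "eq_mod_null M (\<Sigma> n i (Suc j)) ((T ^^ (j + l)) ` D)"
    if "eq_mod_null M (\<Sigma> n i 1) ((T ^^ l) ` D)" "D \<subseteq> space M" "i \<le> q n" "Suc j \<le> \<sigma> n i" for n i j l D
    using that(4)
  proof (induction j)
    case 0 then show ?case using that(1) by simp
  next
    case (Suc j)
    have "eq_mod_null M ((T ^^ 1) ` \<Sigma> n i (Suc j)) (\<Sigma> n i (Suc (Suc j)))"
      using d1[OF that(3), of "Suc j"] Suc.prems by simp
    from eq_chain_image[OF Suc.IH this \<Sigma>sp that(2)] that(3) Suc.prems
    have "eq_mod_null M (\<Sigma> n i (Suc (Suc j))) ((T ^^ (1 + (j + l))) ` D)" by simp
    moreover have "1 + (j + l) = Suc j + l" by simp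
    ultimately show ?case by (simp only:)
  qed
  have spacer_run: "eq_mod_null M (C n i) ((T ^^ (\<sigma> n i + l)) ` D)"
    if "eq_mod_null M (\<Sigma> n i 1) ((T ^^ l) ` D)" "D \<subseteq> space M" "i < q n" "0 < \<sigma> n i" for n i l D
  proof -
    have S: "eq_mod_null M (\<Sigma> n i (\<sigma> n i)) ((T ^^ (\<sigma> n i - 1 + l)) ` D)"
      using spacers[OF that(1,2), of "\<sigma> n i - 1"] that(3,4) by simp
    have "eq_mod_null M (C n i) ((T ^^ (1 + (\<sigma> n i - 1 + l))) ` D)"
      by (rule eq_chain_image[OF S _ \<Sigma>sp that(2)]) (use d2 that in auto)
    then show ?thesis using that(4) by simp
  qed
  \<comment> \<open>The start of the copy over \<open>C n i\<close> in the next tower: below it lie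
    \<open>i\<close> copies of the present tower and the spacers of index at most
    \<open>i\<close>.\<close>
  define w where "w n i = i * ?k n + (\<Sum>l\<le>i. \<sigma> n l)" for n i
  have chain: "eq_mod_null M (C n i) ((T ^^ w n i) ` B (Suc n))" if "i < q n" for n i
    using that
  proof (induction i)
    case 0
    show ?case
    proof (cases "\<sigma> n 0 > 0")
      case True
      then have "eq_mod_null M (\<Sigma> n 0 1) ((T ^^ 0) ` B (Suc n))" using eq_mod_null_sym[OF e[of n]] by simp
      from spacer_run[OF this Bsp 0 True] show ?thesis by (simp add: w_def)
    next
      case False
      then show ?thesis using eq_mod_null_sym[OF e[of n]] by (simp add: w_def)
    qed
  next
    case (Suc i)
    then have IH: "eq_mod_null M (C n i) ((T ^^ w n i) ` B (Suc n))" by simp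
    have i: "i < q n" using Suc.prems by simp
    show ?case
    proof (cases "\<sigma> n (i + 1) > 0")
      case True
      have "eq_mod_null M (\<Sigma> n (i + 1) 1) ((T ^^ (?k n + w n i)) ` B (Suc n))"
        by (rule eq_chain_image[OF IH c1[OF i True] Csp[OF i] Bsp])
      from spacer_run[OF this Bsp _ True] Suc.prems
      show ?thesis by (simp add: w_def algebra_simps)
    next
      case False
      have "eq_mod_null M (C n (i + 1)) ((T ^^ (?k n + w n i)) ` B (Suc n))"
        by (rule eq_chain_image[OF IH c2 Csp[OF i] Bsp]) (use False Suc.prems in auto)
      then show ?thesis using False by (simp add: w_def algebra_simps)
    qed
  qed
  have w_le: "w n i + ?k n \<le> ?k (Suc n)" if "i < q n" for n i
  proof -
    have "(\<Sum>l\<le>i. \<sigma> n l) \<le> total_spacing q \<sigma> n"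
      unfolding total_spacing_def by (rule sum_mono2) (use that in auto)
    moreover have "Suc i * ?k n \<le> q n * ?k n" by (rule mult_le_mono1) (use that in simp)
    ultimately show ?thesis by (simp add: w_def)
  qed
  have k_mono: "?k n \<le> ?k (Suc n)" for n using w_le[OF q_pos[of n]] by linarith
  have k_pos: "0 < ?k n" for n by (induction n) (use q_pos in auto)
  have cover: "\<exists>W. finite W \<and> (\<forall>v\<in>W. v + ?k n \<le> ?k (Suc n)) \<and>
      eq_mod_null M (B n) (\<Union>v\<in>W. (T ^^ v) ` B (Suc n))" for n
  proof (intro exI[of _ "w n ` {..<q n}"] conjI)
    show "\<forall>v\<in>w n ` {..<q n}. v + ?k n \<le> ?k (Suc n)" using w_le by blast
    have "AE x in M. \<forall>i\<in>{..<q n}. x \<in> C n i \<longleftrightarrow> x \<in> (T ^^ w n i) ` B (Suc n)"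
      by (rule AE_finite_allI) (use chain in \<open>auto simp: eq_mod_null_def\<close>)
    moreover have "AE x in M. x \<in> (\<Union>i<q n. C n i) \<longleftrightarrow> x \<in> B n" using part by (simp add: eq_mod_null_def)
    ultimately show "eq_mod_null M (B n) (\<Union>v\<in>w n ` {..<q n}. (T ^^ v) ` B (Suc n))"
      unfolding eq_mod_null_def by eventually_elim blast
  qed simp
  have "tower_sequence M T ?k B"
    by unfold_locales (fact Bs disj cover gen na k_pos k_mono)+
  then show ?thesis by blast
qed

section \<open>Interleaved towers\<close>

lemma bij_betw_mod: "bij_betw (\<lambda>t. t mod h) {c*h..<c*h+h} {..<(h::nat)}"
proof (rule bij_betw_byWitness[where f'="\<lambda>t. c * h + t"])
  have "t div h = c" if "t \<in> {c*h..<c*h+h}" for t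
    using that by (intro div_nat_eqI) (auto simp: algebra_simps)
  then show "\<forall>t\<in>{c*h..<c*h+h}. c * h + t mod h = t" by (metis div_mult_mod_eq)
qed (auto simp: less_imp_le intro!: mod_less_divisor dest: order.strict_trans1)

context rearrangement_bounded
begin

text \<open>Each chunk of length \<open>k\<close> contains a given value at most once. The factor 2
  accounts for the incomplete last chunk.\<close>

lemma card_pullback: "k * card {t. t < K \<and> relocate t \<in> D} \<le> 2 * K * card {s. s < k \<and> s \<in> D}"
proof -
  have "card {t. t < K \<and> relocate t \<in> D} \<le> card {..K div k} * card {s. s < k \<and> s \<in> D}"
  proof (rule card_le_by_inj)
    show "inj_on (\<lambda>t. (t div k, relocate t)) {t. t < K \<and> relocate t \<in> D}"
      by (rule inj_onI) (auto intro: relocate_inj)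
    show "(\<lambda>t. (t div k, relocate t)) ` {t. t < K \<and> relocate t \<in> D} \<subseteq> {..K div k} \<times> {s. s < k \<and> s \<in> D}"
      using relocate_less div_le_K by auto
  qed auto
  then have "k * card {t. t < K \<and> relocate t \<in> D} \<le> k * ((K div k + 1) * card {s. s < k \<and> s \<in> D})"
    by (intro mult_le_mono2) simp
  also have "\<dots> = (K div k + 1) * k * card {s. s < k \<and> s \<in> D}" by (simp only: ac_simps)
  also have "\<dots> \<le> 2 * K * card {s. s < k \<and> s \<in> D}" by (rule mult_le_mono1[OF chunks_le])
  finally show ?thesis .
qed

text \<open>Every complete chunk takes each value. This lower bound is what makes virtual positions
  nearly uniform.\<close>

lemma card_pullback_ge: "(K div k) * card {s. s < k \<and> s \<in> D} \<le> card {t. t < K \<and> relocate t \<in> D}"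
proof -
  let ?S = "{s. s < k \<and> s \<in> D}"
  let ?g = "\<lambda>(d, s). inv_into {d*k..<d*k+k} relocate s"
  have g: "?g (d, s) \<in> {d*k..<d*k+k}" "relocate (?g (d, s)) = s" if "s < k" for d s
    using bij_betw_imp_surj_on[OF relocate_chunk_bij[of d]] that
    by (auto intro: inv_into_into f_inv_into_f simp del: atLeastLessThan_iff)
  have "card ({..<K div k} \<times> ?S) \<le> card {t. t < K \<and> relocate t \<in> D}"
  proof (rule card_inj_on_le[of ?g])
    show "inj_on ?g ({..<K div k} \<times> ?S)"
    proof (rule inj_onI)
      fix x y assume *: "x \<in> {..<K div k} \<times> ?S" "y \<in> {..<K div k} \<times> ?S" "?g x = ?g y"
      obtain d s e u where xy: "x = (d, s)" "y = (e, u)" by (cases x; cases y)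
      have s: "s < k" "u < k" using * xy by auto
      have "?g (d, s) div k = d" "?g (e, u) div k = e" using g(1)[OF s(1)] g(1)[OF s(2)] div_chunk by blast+
      moreover have "relocate (?g (d, s)) = s" "relocate (?g (e, u)) = u" using g(2) s by blast+
      ultimately show "x = y" using *(3) xy by metis
    qed
    show "?g ` ({..<K div k} \<times> ?S) \<subseteq> {t. t < K \<and> relocate t \<in> D}"
    proof (rule image_subsetI)
      fix x assume "x \<in> {..<K div k} \<times> ?S"
      then obtain d s where x: "x = (d, s)" "d < K div k" "s < k" "s \<in> D" by (cases x) auto
      have "?g (d, s) < Suc d * k" using g(1)[OF x(3), of d] by simp
      also have "\<dots> \<le> K div k * k" using x(2) by (intro mult_le_mono1) simp
      also have "\<dots> \<le> K" by simp
      finally show "?g x \<in> {t. t < K \<and> relocate t \<in> D}" using g(2)[OF x(3), of d] x by simp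
    qed
  qed simp
  then show ?thesis by simp
qed

lemma block_step: "(t + 1) mod k \<noteq> 0 \<Longrightarrow> (t + 1) div k = t div k \<and> (t + 1) mod k = t mod k + 1"
  by (auto simp: mod_Suc div_Suc split: if_splits)

text \<open>Two displacements below \<open>L\<close> are added to a step of length 1. This bound and
  the next are the source of the estimate \<open>2 * len i\<close> for cocycle values.\<close>

lemma forward_bound:
  assumes "(t + 1) mod k \<noteq> 0" shows "\<bar>int (relocate (t + 1)) - int (relocate t)\<bar> \<le> 2 * int L"
  using displacement[of t] displacement[of "t + 1"] block_step[OF assms] by linarith

lemma backward_bound:
  assumes "t div k = t1 div k" "relocate t1 = relocate t + 1" shows "\<bar>int t1 - int t\<bar> \<le> 2 * int L"
proof -
  have "t div k * k = t1 div k * k" by (simp only: assms(1))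
  then have "int t1 - int t = int (t1 mod k) - int (t mod k)"
    using mod_plus_base[of t] mod_plus_base[of t1] by linarith
  then show ?thesis using displacement[of t] displacement[of t1] assms(2) by linarith
qed

lemma matched_offset:
  assumes "matched t" shows "copy_offset h W t = \<pi> (relocate t)" "\<pi> (relocate t) = t - start t" "start t \<le> t"
    "start t \<in> W" "t < start t + h"
proof -
  have m: "1 \<le> rnk t" "t < start t + h" using assms by (auto simp: matched_def)
  show 1: "\<pi> (relocate t) = t - start t" by (rule relocate_matched(3)[OF assms])
  show "start t \<le> t" "start t \<in> W" "t < start t + h" using start_props[OF m(1)] m(2) by auto
  then show "copy_offset h W t = \<pi> (relocate t)" using copy_offset_in[OF sep] 1 by simp
qed

end

text \<open>Towers \<open>i\<close> and \<open>i + 2\<close> belong to the same transformation, and \<open>W i\<close> is the set of starts of the copies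
  of the former in the latter.\<close>

locale interleaving =
  fixes H r :: "nat \<Rightarrow> nat" and W :: "nat \<Rightarrow> nat set"
  assumes H_pos: "\<And>i. 0 < H i" and r_ge: "\<And>i. 3 \<le> r i"
    and W_sep: "\<And>i. separated (H i) (W i)"
    and W_le: "\<And>i w. w \<in> W i \<Longrightarrow> w + H i \<le> H (Suc (Suc i))"
    and H_growth: "\<And>i. r i * r i * H i \<le> H (Suc i)" "\<And>i. r i * H (Suc i) \<le> H (Suc (Suc i))"
    and W_dense: "\<And>i. r i * r i * (H (Suc (Suc i)) - card (W i) * H i) \<le> H (Suc (Suc i))"
begin

text \<open>\<open>virt i\<close> leads from tower \<open>i + 1\<close> to tower \<open>i\<close>,
  hence to the other transformation. The recursion only asks of its initial map that it be bijective
  on chunks of length \<open>H 0\<close>.\<close>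

primrec virt :: "nat \<Rightarrow> nat \<Rightarrow> nat" where
  "virt 0 = (\<lambda>t. t mod H 0)"
| "virt (Suc i) = rearrangement.relocate (H i) (H (Suc i)) (r i) (W i) (virt i)"

lemma rearr_step:
  assumes "\<And>c. bij_betw \<pi> {c * H i..<c * H i + H i} {..<H i}"
  shows "rearrangement_bounded (H i) (H (Suc i)) (r i) (W i) \<pi> (H (Suc (Suc i)))"
proof -
  have "1 * (r i * H i) \<le> r i * (r i * H i)" by (rule mult_le_mono1) (use r_ge[of i] in linarith)
  then have g: "r i * H i \<le> H (Suc i)" using H_growth(1)[of i] by (simp only: mult.assoc mult_1)
  show ?thesis
    by unfold_locales (fact H_pos r_ge g W_sep assms W_le H_growth W_dense)+
qed

lemma rearr: "rearrangement_bounded (H i) (H (Suc i)) (r i) (W i) (virt i) (H (Suc (Suc i)))"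
proof (induction i)
  case 0
  show ?case by (rule rearr_step) (simp add: bij_betw_mod)
next
  case (Suc i)
  interpret R: rearrangement_bounded "H i" "H (Suc i)" "r i" "W i" "virt i" "H (Suc (Suc i))" by fact
  show ?case by (rule rearr_step) (simp add: R.relocate_chunk_bij)
qed

definition "len i = rearrangement.L (H i) (r i)"
definition "mtch i = rearrangement.matched (H i) (H (Suc i)) (r i) (W i)"
definition "fwd i = rearrangement.fwd_breaks (H i) (H (Suc i)) (r i) (W i)"
definition "bwd i = rearrangement.bwd_breaks (H i) (H (Suc i)) (r i) (W i) (virt i)"

lemma len_eq: "len i = r i * H i"
proof -
  interpret rearrangement_bounded "H i" "H (Suc i)" "r i" "W i" "virt i" "H (Suc (Suc i))" by (rule rearr)
  show ?thesis by (simp add: len_def L_def)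
qed

lemma virt_less: "virt i t < H i"
proof (cases i)
  case 0 then show ?thesis using H_pos by simp
next
  case (Suc j)
  interpret rearrangement_bounded "H j" "H (Suc j)" "r j" "W j" "virt j" "H (Suc (Suc j))" by (rule rearr)
  show ?thesis using relocate_less Suc by simp
qed

text \<open>The commuting triangle of the towers \<open>i\<close>, \<open>i + 1\<close>,
  \<open>i + 2\<close>. It is used once to make the virtual positions cohere and once to make the
  two limit maps inverse to each other.\<close>

lemma mtch_offset: "mtch i t \<Longrightarrow> copy_offset (H i) (W i) t = virt i (virt (Suc i) t)"
proof -
  interpret rearrangement_bounded "H i" "H (Suc i)" "r i" "W i" "virt i" "H (Suc (Suc i))" by (rule rearr)
  show "mtch i t \<Longrightarrow> copy_offset (H i) (W i) t = virt i (virt (Suc i) t)"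
    using matched_offset(1) by (simp add: mtch_def)
qed

lemma card_not_mtch: "r i * card {t. t < H (Suc (Suc i)) \<and> \<not> mtch i t} \<le> 8 * H (Suc (Suc i))"
proof -
  interpret rearrangement_bounded "H i" "H (Suc i)" "r i" "W i" "virt i" "H (Suc (Suc i))" by (rule rearr)
  show ?thesis using card_unmatched by (simp add: mtch_def)
qed

lemma card_fwd: "H i * card {t. t < H (Suc (Suc i)) \<and> t \<in> fwd i} \<le> 6 * H (Suc (Suc i))"
proof -
  interpret rearrangement_bounded "H i" "H (Suc i)" "r i" "W i" "virt i" "H (Suc (Suc i))" by (rule rearr)
  show ?thesis using card_fwd_breaks by (simp add: fwd_def)
qed

lemma card_bwd: "H i * card {t. t < H (Suc (Suc i)) \<and> t \<in> bwd i} \<le> 7 * H (Suc (Suc i))"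
proof -
  interpret rearrangement_bounded "H i" "H (Suc i)" "r i" "W i" "virt i" "H (Suc (Suc i))" by (rule rearr)
  show ?thesis using card_bwd_breaks by (simp add: bwd_def)
qed

lemma card_virt_pullback:
  "H (Suc i) * card {t. t < H (Suc (Suc i)) \<and> virt (Suc i) t \<in> D} \<le> 2 * H (Suc (Suc i)) * card {s. s < H (Suc i) \<and> s \<in> D}"
proof -
  interpret rearrangement_bounded "H i" "H (Suc i)" "r i" "W i" "virt i" "H (Suc (Suc i))" by (rule rearr)
  show ?thesis using card_pullback by simp
qed

lemma card_virt_pullback_ge:
  "(H (Suc (Suc i)) div H (Suc i)) * card {s. s < H (Suc i) \<and> s \<in> D} \<le> card {t. t < H (Suc (Suc i)) \<and> virt (Suc i) t \<in> D}"
proof -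
  interpret rearrangement_bounded "H i" "H (Suc i)" "r i" "W i" "virt i" "H (Suc (Suc i))" by (rule rearr)
  show ?thesis using card_pullback_ge by simp
qed

lemma not_fwd: "t \<notin> fwd i \<Longrightarrow> (t + 1) mod H (Suc i) \<noteq> 0"
proof -
  interpret rearrangement_bounded "H i" "H (Suc i)" "r i" "W i" "virt i" "H (Suc (Suc i))" by (rule rearr)
  assume "t \<notin> fwd i"
  then have "(t + 1) mod H (Suc i) mod L \<noteq> 0" by (simp add: fwd_def fwd_breaks_def)
  then show "(t + 1) mod H (Suc i) \<noteq> 0" by (metis mod_0)
qed

definition "incr i t = int (virt i (t + 1)) - int (virt i t)"

lemma incr_le: "\<bar>incr i t\<bar> \<le> int (H i)"
  using virt_less[of i t] virt_less[of i "t + 1"] by (simp add: incr_def)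

lemma incr_forward_bound: "(t + 1) mod H (Suc i) \<noteq> 0 \<Longrightarrow> \<bar>incr (Suc i) t\<bar> \<le> 2 * int (len i)"
proof -
  interpret rearrangement_bounded "H i" "H (Suc i)" "r i" "W i" "virt i" "H (Suc (Suc i))" by (rule rearr)
  show "(t + 1) mod H (Suc i) \<noteq> 0 \<Longrightarrow> \<bar>incr (Suc i) t\<bar> \<le> 2 * int (len i)"
    using forward_bound by (simp add: incr_def len_def)
qed

text \<open>The increments of \<open>virt i\<close> and \<open>virt (i + 2)\<close> are the cocycle of the same transformation at
  consecutive stages.\<close>

lemma incr_two_step:
  fixes i t
  defines "s \<equiv> copy_offset (H (Suc i)) (W (Suc i)) t" and "u \<equiv> virt (Suc (Suc i)) t"
  assumes t: "t \<notin> fwd (Suc i)"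
  shows "\<bar>incr (Suc (Suc i)) t\<bar> \<le> 2 * int (len i)"
    and "u \<notin> bwd i \<Longrightarrow> incr (Suc (Suc i)) t = 1 \<and> \<not> (mtch (Suc i) t \<and> mtch i u) \<or>
      (s + 1 < H (Suc i) \<and> (s + 1) mod H i \<noteq> 0 \<and> incr (Suc (Suc i)) t = incr i s)"
proof -
  interpret A: rearrangement_bounded "H i" "H (Suc i)" "r i" "W i" "virt i" "H (Suc (Suc i))" by (rule rearr)
  interpret B: rearrangement_bounded "H (Suc i)" "H (Suc (Suc i))" "r (Suc i)" "W (Suc i)" "virt (Suc i)" "H (Suc (Suc (Suc i)))" by (rule rearr)
  have nA: "A.relocate = virt (Suc i)" and nB: "B.relocate = virt (Suc (Suc i))" by simp_all
  define u1 where "u1 = virt (Suc (Suc i)) (t + 1)"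
  have inc: "incr (Suc (Suc i)) t = int u1 - int u" by (simp add: incr_def u_def u1_def)
  have L1: "1 \<le> 2 * int (len i)" using A.L_pos by (simp add: len_def)
  have step: "B.matched t \<and> B.matched (t + 1) \<and> B.start t = B.start (t + 1) \<or> \<not> B.matched t \<and> u1 = u + 1"
    using B.forward_step[of t] t unfolding fwd_def nB u_def u1_def by simp
  have "\<bar>incr (Suc (Suc i)) t\<bar> \<le> 2 * int (len i) \<and>
    (u \<notin> bwd i \<longrightarrow> incr (Suc (Suc i)) t = 1 \<and> \<not> (mtch (Suc i) t \<and> mtch i u) \<or>
      (s + 1 < H (Suc i) \<and> (s + 1) mod H i \<noteq> 0 \<and> incr (Suc (Suc i)) t = incr i s))"
    using step
  proof
    assume "\<not> B.matched t \<and> u1 = u + 1"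
    then show ?thesis using inc L1 by (simp add: mtch_def)
  next
    assume m: "B.matched t \<and> B.matched (t + 1) \<and> B.start t = B.start (t + 1)"
    then have m0: "B.matched t" and m1: "B.matched (t + 1)" by auto
    note o = B.matched_offset[OF m0] B.matched_offset[OF m1]
    \<comment> \<open>Matched positions descend to their true offsets, so \<open>u\<close> and
      \<open>u1\<close> are two positions whose next relocations are the neighbours \<open>s\<close>
      and \<open>s + 1\<close>.\<close>
    have s: "virt (Suc i) u = s" using o(1) unfolding nB s_def u_def by simp
    have s1: "virt (Suc i) u1 = s + 1" using o m s unfolding nB u_def u1_def by simp
    have sH: "s + 1 < H (Suc i)" using virt_less[of "Suc i" u1] s1 by simp
    have "(t + 1) mod H (Suc (Suc i)) \<noteq> 0" by (rule not_fwd[OF t])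
    then have "t div H (Suc (Suc i)) = (t + 1) div H (Suc (Suc i))" using B.block_step by simp
    then have uk: "u div H (Suc i) = u1 div H (Suc i)"
      using B.matched_same_start_iff[OF m0 m1] m unfolding nB u_def u1_def by simp
    have sn: "A.relocate u1 = A.relocate u + 1" using s s1 unfolding nA by simp
    have 1: "\<bar>incr (Suc (Suc i)) t\<bar> \<le> 2 * int (len i)"
      using A.backward_bound[OF uk sn] unfolding inc len_def .
    have "incr (Suc (Suc i)) t = 1 \<and> \<not> (mtch (Suc i) t \<and> mtch i u) \<or>
      (s + 1 < H (Suc i) \<and> (s + 1) mod H i \<noteq> 0 \<and> incr (Suc (Suc i)) t = incr i s)" if "u \<notin> bwd i"
      using A.backward_step[OF that[unfolded bwd_def] uk sn]
    proof
      assume "\<not> A.matched u \<and> u1 = u + 1"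
      then show ?thesis using inc by (simp add: mtch_def)
    next
      assume a: "A.matched u \<and> A.matched u1 \<and> A.start u = A.start u1"
      then have a0: "A.matched u" and a1: "A.matched u1" by auto
      note p = A.matched_offset[OF a0] A.matched_offset[OF a1]
      \<comment> \<open>As \<open>u\<close> and \<open>u1\<close> lie in one copy of tower
        \<open>i\<close>, their offsets are taken from the same start, and the difference
        \<open>u1 - u\<close> is already the increment at \<open>s\<close>.\<close>
      have v: "virt i s = u - A.start u" "virt i (s + 1) = u1 - A.start u"
        using p(2) p(7) a s s1 unfolding nA by simp_all
      have "s div H i = (s + 1) div H i"
        using A.matched_same_start_iff[OF a0 a1 uk] a s s1 unfolding nA by simp
      then have "(s + 1) mod H i \<noteq> 0" by (auto simp: div_Suc split: if_splits)
      moreover have "incr (Suc (Suc i)) t = incr i s"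
        unfolding inc unfolding incr_def[of i] v using p(3) p(8) a by simp
      ultimately show ?thesis using sH by simp
    qed
    then show ?thesis using 1 by blast
  qed
  then show "\<bar>incr (Suc (Suc i)) t\<bar> \<le> 2 * int (len i)"
    and "u \<notin> bwd i \<Longrightarrow> incr (Suc (Suc i)) t = 1 \<and> \<not> (mtch (Suc i) t \<and> mtch i u) \<or>
      (s + 1 < H (Suc i) \<and> (s + 1) mod H i \<noteq> 0 \<and> incr (Suc (Suc i)) t = incr i s)" by blast+
qed

end

section \<open>The matching of two coded systems\<close>

text \<open>The eventual value of a sequence; arbitrary if the sequence is not eventually constant.\<close>

definition ev :: "(nat \<Rightarrow> 'a::countable) \<Rightarrow> 'a" where
  "ev f = from_nat (LEAST n. eventually (\<lambda>l. to_nat (f l) = n) sequentially)"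

lemma ev_eq: assumes "eventually (\<lambda>l. f l = v) sequentially" shows "ev f = v"
proof -
  have e: "eventually (\<lambda>l. to_nat (f l) = to_nat v) sequentially" using assms by eventually_elim simp
  have "(LEAST n. eventually (\<lambda>l. to_nat (f l) = n) sequentially) = to_nat v"
  proof (rule Least_equality)
    show "eventually (\<lambda>l. to_nat (f l) = to_nat v) sequentially" by (rule e)
    fix n assume "eventually (\<lambda>l. to_nat (f l) = n) sequentially"
    with e have "eventually (\<lambda>l. to_nat v = n) sequentially" by eventually_elim simp
    then show "to_nat v \<le> n" by simp
  qed
  then show ?thesis by (simp add: ev_def)
qed

lemma measurable_ev:
  fixes f :: "nat \<Rightarrow> 'a \<Rightarrow> 'b::countable"
  assumes "\<And>l. f l \<in> measurable M (count_space UNIV)"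
  shows "(\<lambda>x. ev (\<lambda>l. f l x)) \<in> measurable M (count_space UNIV)"
proof -
  have [measurable]: "(\<lambda>x. to_nat (f l x)) \<in> measurable M (count_space UNIV)" for l
    by (rule measurable_compose[OF assms]) simp
  have "(\<lambda>x. LEAST n. eventually (\<lambda>l. to_nat (f l x) = n) sequentially) \<in> measurable M (count_space UNIV)"
    unfolding eventually_sequentially by measurable
  then show ?thesis unfolding ev_def by (rule measurable_compose) simp
qed

lemma (in prob_space) prob_tendsto_eventually:
  assumes A: "\<And>j. A j \<in> sets M" "B \<in> sets M"
    and ae: "AE x in M. eventually (\<lambda>j. x \<in> A j \<longleftrightarrow> x \<in> B) sequentially"
  shows "(\<lambda>j. prob (A j)) \<longlonglongrightarrow> prob B"
proof -
  have "(\<lambda>j. integral\<^sup>L M (indicat_real (A j))) \<longlonglongrightarrow> integral\<^sup>L M (indicat_real B)"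
  proof (rule integral_dominated_convergence[where w="\<lambda>_. 1"])
    show "AE x in M. (\<lambda>j. indicat_real (A j) x) \<longlonglongrightarrow> indicat_real B x"
      using ae
    proof eventually_elim
      case (elim x)
      then have "eventually (\<lambda>j. indicat_real (A j) x = indicat_real B x) sequentially"
        by eventually_elim (simp add: indicator_def)
      then show ?case by (rule tendsto_eventually)
    qed
  qed (use A in \<open>auto simp: indicator_def\<close>)
  then show ?thesis using A by simp
qed

section \<open>Measure estimates and separation of points in a coded system\<close>

sublocale coded_system \<subseteq> pmp_system M T
  by (simp add: pmp_system_def prob pmp pmp_system_axioms_def)

context coded_system
begin

lemma pos_sets: "{x\<in>space M. pos j x \<in> D} \<in> sets M"
  using measurable_sets[OF pos_measurable, of D j] by (simp add: vimage_def Int_def conj_commute)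

lemma pos_less_sets: "{x\<in>space M. pos j x < H j \<and> pos j x \<in> D} \<in> sets M"
  using pos_sets[of j "{..<H j} \<inter> D"] by simp

lemma measure_pos_in: "measure M {x\<in>space M. pos j x < H j \<and> pos j x \<in> D} = card {t. t < H j \<and> t \<in> D} * b j"
proof -
  let ?S = "{t. t < H j \<and> t \<in> D}"
  have "{x\<in>space M. pos j x < H j \<and> pos j x \<in> D} = (\<Union>t\<in>?S. {x\<in>space M. pos j x = t})" by auto
  moreover have "measure M (\<Union>t\<in>?S. {x\<in>space M. pos j x = t}) = (\<Sum>t\<in>?S. measure M {x\<in>space M. pos j x = t})"
    by (rule finite_measure_finite_Union) (use pos_sets[of j "{_}"] in \<open>auto simp: disjoint_family_on_def\<close>)
  moreover have "\<dots> = (\<Sum>t\<in>?S. b j)" by (rule sum.cong) (use pos_uniform in auto)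
  ultimately show ?thesis by simp
qed

lemma b_nonneg: "0 \<le> b j" using pos_uniform[OF H_pos, of j] measure_nonneg[of M] by metis

lemma measure_outside: "measure M {x\<in>space M. \<not> pos j x < H j} = 1 - H j * b j"
proof -
  have "measure M {x\<in>space M. pos j x < H j} = H j * b j"
    using measure_pos_in[of j UNIV] by (simp add: lessThan_def[symmetric])
  moreover have "{x\<in>space M. \<not> pos j x < H j} = space M - {x\<in>space M. pos j x < H j}" by auto
  ultimately show ?thesis using prob_compl[OF pos_less_sets[of j UNIV]] by simp
qed

lemma H_b_le: "H j * b j \<le> 1" using measure_outside[of j] measure_nonneg[of M "{x\<in>space M. \<not> pos j x < H j}"] by linarith

lemma measure_pos_in_le:
  assumes "card {t. t < H j \<and> t \<in> D} \<le> f * real (H j)"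
  shows "measure M {x\<in>space M. pos j x < H j \<and> pos j x \<in> D} \<le> f"
proof -
  have f: "0 \<le> f * H j" using assms by (meson le_less_trans not_less of_nat_0_le_iff)
  then have f0: "0 \<le> f" using H_pos[of j] by (simp add: zero_le_mult_iff)
  have "card {t. t < H j \<and> t \<in> D} * b j \<le> f * H j * b j" by (rule mult_right_mono[OF assms b_nonneg])
  also have "\<dots> \<le> f * 1" unfolding mult.assoc by (rule mult_left_mono[OF H_b_le f0])
  finally show ?thesis by (simp add: measure_pos_in)
qed

text \<open>Borel-Cantelli: the measure outside the towers and the share of the exceptional
  positions are both summable.\<close>

lemma AE_eventually_pos:
  assumes out: "summable (\<lambda>j. 1 - H (g j) * b (g j))" and f: "summable f"
    and card: "\<And>j. card {t. t < H (g j) \<and> t \<in> D j} \<le> f j * real (H (g j))"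
  shows "AE x in M. eventually (\<lambda>j. pos (g j) x < H (g j) \<and> pos (g j) x \<notin> D j) sequentially"
proof -
  let ?A = "\<lambda>j. {x\<in>space M. \<not> pos (g j) x < H (g j)}"
  let ?B = "\<lambda>j. {x\<in>space M. pos (g j) x < H (g j) \<and> pos (g j) x \<in> D j}"
  have A: "?A j \<in> sets M" for j 
    using pos_sets[of "g j" "- {..<H (g j)}"] unfolding Compl_iff lessThan_iff .
  have B: "?B j \<in> sets M" for j by (rule pos_less_sets)
  have "AE x in M. eventually (\<lambda>j. x \<in> space M - (?A j \<union> ?B j)) sequentially"
  proof (rule borel_cantelli_AE1)
    show "summable (\<lambda>j. measure M (?A j \<union> ?B j))"
    proof (rule summable_comparison_test)
      have "measure M (?A j \<union> ?B j) \<le> (1 - H (g j) * b (g j)) + f j" for j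
        using measure_Un_le[OF A[of j] B[of j]] measure_outside[of "g j"] measure_pos_in_le[OF card, of j] by linarith
      then show "\<exists>N. \<forall>n\<ge>N. norm (measure M (?A n \<union> ?B n)) \<le> (1 - H (g n) * b (g n)) + f n" by simp
      show "summable (\<lambda>n. (1 - H (g n) * b (g n)) + f n)" by (rule summable_add[OF out f])
    qed
  qed (use A B in \<open>auto simp: less_top[symmetric]\<close>)
  then show ?thesis
  proof eventually_elim
    case (elim x)
    then show ?case by eventually_elim auto
  qed
qed

lemma copy_offset_0: "copy_offset (H j) (W j) t = 0 \<longleftrightarrow> t \<in> W j"
proof
  assume "copy_offset (H j) (W j) t = 0"
  then show "t \<in> W j" using copy_offset_lessD[OF W_sep, of j t] H_pos[of j] by force
next
  assume "t \<in> W j"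
  then show "copy_offset (H j) (W j) t = 0" using copy_offset_in[OF W_sep, of t j t] H_pos[of j] by simp
qed

text \<open>Coherence gives \<open>b j = card (W j) * b (Suc j)\<close>. Since the larger tower has
  measure at most 1, its copies of the smaller tower fill at least the share
  \<open>H j * b j\<close> of it.\<close>

lemma W_density: "real (H (Suc j)) - card (W j) * H j \<le> (1 - H j * b j) * H (Suc j)"
proof -
  have W: "W j = {t. t < H (Suc j) \<and> t \<in> W j}" using W_le[of _ j] H_pos[of j] by force
  have "b j = measure M {x\<in>space M. pos j x = 0}" using pos_uniform[OF H_pos] by simp
  also have "\<dots> = measure M {x\<in>space M. pos (Suc j) x < H (Suc j) \<and> pos (Suc j) x \<in> W j}"
  proof (rule finite_measure_eq_AE)
    show "AE x in M. x \<in> {x\<in>space M. pos j x = 0} \<longleftrightarrow> x \<in> {x\<in>space M. pos (Suc j) x < H (Suc j) \<and> pos (Suc j) x \<in> W j}"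
      using coherent
    proof eventually_elim
      case (elim x)
      have "pos j x = 0 \<longleftrightarrow> pos (Suc j) x \<in> W j" using elim copy_offset_0 by metis
      then show ?case using W by auto
    qed
    show "{x\<in>space M. pos j x = 0} \<in> sets M" using pos_sets[of j "{0}"] by simp
  qed (rule pos_less_sets)
  also have "\<dots> = card (W j) * b (Suc j)" using measure_pos_in W by simp
  finally have "H j * b j * H (Suc j) = card (W j) * H j * (H (Suc j) * b (Suc j))" by simp
  also have "\<dots> \<le> real (card (W j) * H j) * 1" by (rule mult_left_mono[OF H_b_le]) simp
  finally show ?thesis by (simp add: algebra_simps)
qed

text \<open>Coherence carries equality of positions from late towers down to all earlier ones, and
  the whole code determines the point. The predicate \<open>Q\<close> collects the points off the
  exceptional null set, since both points have to avoid it.\<close>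

lemma separating_positions:
  "\<exists>Q. (AE x in M. Q x) \<and> (\<forall>x x'. Q x \<longrightarrow> Q x' \<longrightarrow> eventually (\<lambda>j. pos j x = pos j x') sequentially \<longrightarrow> x = x')"
proof -
  obtain G where "measure_iso M (completion (distr M code_space (\<lambda>x j. pos j x))) (\<lambda>x j. pos j x) G"
    using iso by blast
  then have G: "AE x in M. G (\<lambda>j. pos j x) = x" by (simp add: measure_iso_def)
  let ?Q = "\<lambda>x. G (\<lambda>j. pos j x) = x \<and> (\<forall>j. pos j x = copy_offset (H j) (W j) (pos (Suc j) x))"
  have 1: "x = x'" if Q: "?Q x" "?Q x'" and e: "eventually (\<lambda>j. pos j x = pos j x') sequentially" for x x'
  proof -
    obtain J where J: "\<And>j. J \<le> j \<Longrightarrow> pos j x = pos j x'" using e by (auto simp: eventually_sequentially)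
    have "pos j x = pos j x'" for j
    proof (cases "j \<le> J")
      case True
      then show ?thesis
      proof (induction rule: inc_induct)
        case base then show ?case using J by simp
      next
        case (step n)
        have "pos n x = copy_offset (H n) (W n) (pos (Suc n) x)" by (rule Q(1)[THEN conjunct2, THEN spec])
        also have "\<dots> = copy_offset (H n) (W n) (pos (Suc n) x')" by (simp only: step.IH)
        also have "\<dots> = pos n x'" by (rule Q(2)[THEN conjunct2, THEN spec, symmetric])
        finally show ?case .
      qed
    qed (use J in simp)
    then have eq: "(\<lambda>j. pos j x) = (\<lambda>j. pos j x')" by (rule ext)
    have "x = G (\<lambda>j. pos j x)" by (rule Q(1)[THEN conjunct1, symmetric])
    also have "\<dots> = G (\<lambda>j. pos j x')" by (rule arg_cong[OF eq])
    also have "\<dots> = x'" by (rule Q(2)[THEN conjunct1])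
    finally show ?thesis .
  qed
  have 2: "AE x in M. ?Q x" by (rule AE_conjI[OF G coherent])
  show ?thesis by (rule exI[of _ ?Q], intro conjI allI impI 2) (rule 1)
qed

end

primrec down :: "(nat \<Rightarrow> nat \<Rightarrow> nat) \<Rightarrow> nat \<Rightarrow> nat \<Rightarrow> nat \<Rightarrow> nat" where
  "down \<rho> i 0 s = s"
| "down \<rho> i (Suc l) s = (if i \<le> l then down \<rho> i l (\<rho> l s) else s)"

lemma down_self [simp]: "down \<rho> i i s = s"
  by (cases i) auto

lemma down_Suc_left: "Suc i \<le> l \<Longrightarrow> down \<rho> i l s = \<rho> i (down \<rho> (Suc i) l s)"
proof (induction l arbitrary: s)
  case (Suc l)
  then show ?case by (cases "Suc i \<le> l") (auto simp: le_Suc_eq not_less_eq_eq)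
qed simp

lemma down_coherent:
  assumes "\<And>j. z j = \<rho> j (z (Suc j))" "i \<le> l" shows "down \<rho> i l (z l) = z i"
  using assms(2)
proof (induction l)
  case (Suc l)
  then show ?case using assms(1)[of l] by (cases "i \<le> l") (auto simp: le_Suc_eq)
qed simp

lemma real_card_le:
  assumes "c * n \<le> C * K" "2 ^ j \<le> c" shows "real n \<le> real C / 2 ^ j * real K"
proof -
  have "2 ^ j * n \<le> c * n" using assms(2) by (rule mult_le_mono1)
  then have "2 ^ j * n \<le> C * K" using assms(1) by (rule le_trans)
  then have "real (2 ^ j * n) \<le> real (C * K)" by (simp only: of_nat_le_iff)
  then show ?thesis by (simp add: field_simps)
qed

lemma summable_pow2: "summable (\<lambda>j. C / 2 ^ j :: real)"
  using summable_mult[OF summable_geometric[of "1/2::real"], of C] by (simp add: power_divide)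

lemma (in interleaving) H_ge_pow2: "2 ^ i \<le> H i"
proof (induction i)
  case 0 then show ?case using H_pos[of 0] by simp
next
  case (Suc i)
  have "3 * 3 \<le> r i * r i" by (rule mult_le_mono) (rule r_ge)+
  then have "2 * 2 ^ i \<le> r i * r i * H i" using Suc by (intro mult_le_mono) auto
  then show ?case using H_growth(1)[of i] by simp
qed

lemma (in interleaving) card_pullback_frac:
  assumes "c * card {s. s < H (Suc i) \<and> s \<in> D} \<le> C * H (Suc i)"
  shows "c * card {t. t < H (Suc (Suc i)) \<and> virt (Suc i) t \<in> D} \<le> (2 * C) * H (Suc (Suc i))"
proof -
  have "H (Suc i) * (c * card {t. t < H (Suc (Suc i)) \<and> virt (Suc i) t \<in> D})
      = c * (H (Suc i) * card {t. t < H (Suc (Suc i)) \<and> virt (Suc i) t \<in> D})" by (simp only: ac_simps)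
  also have "\<dots> \<le> c * (2 * H (Suc (Suc i)) * card {s. s < H (Suc i) \<and> s \<in> D})"
    by (rule mult_le_mono2[OF card_virt_pullback])
  also have "\<dots> = 2 * H (Suc (Suc i)) * (c * card {s. s < H (Suc i) \<and> s \<in> D})" by (simp only: ac_simps)
  also have "\<dots> \<le> 2 * H (Suc (Suc i)) * (C * H (Suc i))" using assms by (rule mult_le_mono2)
  also have "\<dots> = H (Suc i) * ((2 * C) * H (Suc (Suc i)))" by (simp only: ac_simps)
  finally show ?thesis using H_pos[of "Suc i"] by (simp only: mult_le_cancel1)
qed

section \<open>The point map defined by virtual positions\<close>

locale orbit_matching = interleaving H r W
  + X: coded_system M T "\<lambda>j. H (a j)" "\<lambda>j. W (a j)" posX bX
  + Y: coded_system N S "\<lambda>j. H (Suc (a j))" "\<lambda>j. W (Suc (a j))" posY bY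
  for H r W and a :: "nat \<Rightarrow> nat" and M :: "'a measure" and T posX
    and bX :: "nat \<Rightarrow> real" and N :: "'b measure" and S posY and bY :: "nat \<Rightarrow> real" +
  assumes a_Suc: "\<And>j. a (Suc j) = Suc (Suc (a j))"
    and r_large: "\<And>i. 2 ^ i \<le> r i"
    and outX: "\<And>j. 1 - H (a j) * bX j \<le> 1 / 2 ^ j"
    and outY: "\<And>j. 1 - H (Suc (a j)) * bY j \<le> 1 / 2 ^ j"
begin

lemma a_ge: "j \<le> a j" by (induction j) (auto simp: a_Suc)

lemma pow2_mono: "j \<le> i \<Longrightarrow> (2::nat) ^ j \<le> 2 ^ i" by (rule power_increasing) auto

lemma r_pow: "j \<le> i \<Longrightarrow> 2 ^ j \<le> r i" using pow2_mono r_large le_trans by blast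
lemma H_pow: "j \<le> i \<Longrightarrow> 2 ^ j \<le> H i" using pow2_mono H_ge_pow2 le_trans by blast

lemma summable_outX: "summable (\<lambda>j. 1 - H (a j) * bX j)"
  by (rule summable_comparison_test[OF _ summable_pow2[of 1]]) (use outX X.H_b_le in auto)

lemma summable_outX_Suc: "summable (\<lambda>j. 1 - H (a (Suc j)) * bX (Suc j))"
  using summable_outX by (subst summable_Suc_iff)

lemma summable_outX_Suc2: "summable (\<lambda>j. 1 - H (a (Suc (Suc j))) * bX (Suc (Suc j)))"
  using summable_outX_Suc by (subst summable_Suc_iff[of "\<lambda>j. 1 - H (a (Suc j)) * bX (Suc j)"])

text \<open>The position in the intermediate tower of \<open>S\<close> intended for the image of
  \<open>x\<close>. As \<open>virt\<close> is total and bounded, \<open>p j x\<close> is always a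
  level of that tower, even if \<open>x\<close> is outside its own.\<close>

definition "p j x = virt (Suc (a j)) (posX (Suc j) x)"

lemma p_less: "p j x < H (Suc (a j))" unfolding p_def by (rule virt_less)

lemma p_measurable: "p j \<in> measurable M (count_space UNIV)"
  unfolding p_def[abs_def] by (rule measurable_compose[OF X.pos_measurable]) simp

lemma eventually_regular:
  "AE x in M. eventually (\<lambda>j. posX (Suc j) x + 1 < H (a (Suc j)) \<and> mtch (a j) (posX (Suc j) x)
      \<and> posX (Suc j) x \<notin> fwd (a j)) sequentially"
proof -
  let ?D = "\<lambda>j. {t. \<not> mtch (a j) t} \<union> {t. t \<in> fwd (a j)} \<union> {t. t + 1 = H (a (Suc j))}"
  have "AE x in M. eventually (\<lambda>j. posX (Suc j) x < H (a (Suc j)) \<and> posX (Suc j) x \<notin> ?D j) sequentially"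
  \<comment> \<open>The constant is 8 + 6 + 1: unmatched positions, forward breaks, and the top
    level, from which the next step would leave the tower.\<close>
  proof (rule X.AE_eventually_pos[OF summable_outX_Suc summable_pow2[of 15]])
    fix j
    let ?K = "H (a (Suc j))"
    have 1: "real (card {t. t < ?K \<and> \<not> mtch (a j) t}) \<le> real 8 / 2 ^ j * ?K"
      unfolding a_Suc by (rule real_card_le[OF card_not_mtch r_pow[OF a_ge]])
    have 2: "real (card {t. t < ?K \<and> t \<in> fwd (a j)}) \<le> real 6 / 2 ^ j * ?K"
      unfolding a_Suc by (rule real_card_le[OF card_fwd H_pow[OF a_ge]])
    have "card {t. t < ?K \<and> t + 1 = ?K} \<le> card {?K - 1}" by (rule card_mono) auto
    moreover have "2 ^ j \<le> ?K" using H_pow[of j "a (Suc j)"] a_ge[of "Suc j"] by simp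
    ultimately have "2 ^ j * card {t. t < ?K \<and> t + 1 = ?K} \<le> 1 * ?K" by (simp add: le_trans[OF mult_le_mono2[of _ 1]])
    then have 3: "real (card {t. t < ?K \<and> t + 1 = ?K}) \<le> real 1 / 2 ^ j * ?K" by (rule real_card_le) simp
    have "{t. t < ?K \<and> t \<in> ?D j} = {t. t < ?K \<and> \<not> mtch (a j) t} \<union> {t. t < ?K \<and> t \<in> fwd (a j)} \<union> {t. t < ?K \<and> t + 1 = ?K}"
      by auto
    then have "card {t. t < ?K \<and> t \<in> ?D j} \<le> card {t. t < ?K \<and> \<not> mtch (a j) t} + card {t. t < ?K \<and> t \<in> fwd (a j)} + card {t. t < ?K \<and> t + 1 = ?K}"
      by (metis (no_types, lifting) card_Un_le add_le_mono1 le_trans)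
    then have "real (card {t. t < ?K \<and> t \<in> ?D j}) \<le> real 8 / 2 ^ j * ?K + real 6 / 2 ^ j * ?K + real 1 / 2 ^ j * ?K"
      using 1 2 3 by linarith
    then show "real (card {t. t < ?K \<and> t \<in> ?D j}) \<le> 15 / 2 ^ j * ?K" by (simp add: field_simps)
  qed
  then show ?thesis
  proof eventually_elim
    case (elim x)
    then show ?case by eventually_elim auto
  qed
qed

lemma eventually_regular_p:
  "AE x in M. eventually (\<lambda>j. mtch (Suc (a j)) (p (Suc j) x) \<and> p (Suc j) x \<notin> bwd (Suc (a j))) sequentially"
proof -
  let ?i = "\<lambda>j. Suc (a j)"
  let ?v = "\<lambda>j. virt (Suc (Suc (?i j)))"
  let ?D = "\<lambda>j. {t. \<not> mtch (?i j) (?v j t)} \<union> {t. ?v j t \<in> bwd (?i j)}"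
  have "AE x in M. eventually (\<lambda>j. posX (Suc (Suc j)) x < H (a (Suc (Suc j))) \<and> posX (Suc (Suc j)) x \<notin> ?D j) sequentially"
  \<comment> \<open>The constant is 2 * (8 + 7): unmatched positions and backward breaks, doubled by
    the pullback along \<open>virt\<close>.\<close>
  proof (rule X.AE_eventually_pos[OF summable_outX_Suc2 summable_pow2[of 30]])
    fix j
    let ?K = "H (a (Suc (Suc j)))"
    have K: "?K = H (Suc (Suc (Suc (?i j))))" by (simp add: a_Suc)
    have ij: "j \<le> ?i j" using a_ge[of j] by simp
    have "r (?i j) * card {t. t < ?K \<and> ?v j t \<in> {t. \<not> mtch (?i j) t}} \<le> (2 * 8) * ?K"
      unfolding K by (rule card_pullback_frac) (use card_not_mtch in simp)
    then have 1: "real (card {t. t < ?K \<and> \<not> mtch (?i j) (?v j t)}) \<le> real (2 * 8) / 2 ^ j * ?K"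
      by (intro real_card_le[OF _ r_pow[OF ij]]) simp
    have "H (?i j) * card {t. t < ?K \<and> ?v j t \<in> bwd (?i j)} \<le> (2 * 7) * ?K"
      unfolding K by (rule card_pullback_frac[OF card_bwd])
    then have 2: "real (card {t. t < ?K \<and> ?v j t \<in> bwd (?i j)}) \<le> real (2 * 7) / 2 ^ j * ?K"
      by (rule real_card_le[OF _ H_pow[OF ij]])
    have "{t. t < ?K \<and> t \<in> ?D j} = {t. t < ?K \<and> \<not> mtch (?i j) (?v j t)} \<union> {t. t < ?K \<and> ?v j t \<in> bwd (?i j)}"
      by auto
    then have "card {t. t < ?K \<and> t \<in> ?D j} \<le> card {t. t < ?K \<and> \<not> mtch (?i j) (?v j t)} + card {t. t < ?K \<and> ?v j t \<in> bwd (?i j)}"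
      by (simp only: card_Un_le)
    then have "real (card {t. t < ?K \<and> t \<in> ?D j}) \<le> real (2 * 8) / 2 ^ j * ?K + real (2 * 7) / 2 ^ j * ?K"
      using 1 2 by linarith
    then show "real (card {t. t < ?K \<and> t \<in> ?D j}) \<le> 30 / 2 ^ j * ?K" by (simp add: field_simps)
  qed
  then show ?thesis
  proof eventually_elim
    case (elim x)
    then show ?case by eventually_elim (simp add: p_def a_Suc)
  qed
qed

lemma eventually_virt_p: "AE x in M. eventually (\<lambda>j. virt (a j) (p j x) = posX j x) sequentially"
  using eventually_regular X.coherent
proof eventually_elim
  case (elim x)
  from elim(1) show ?case
  proof eventually_elim
    case (elim j)
    have "virt (a j) (p j x) = copy_offset (H (a j)) (W (a j)) (posX (Suc j) x)"
      unfolding p_def using mtch_offset elim by simp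
    also have "\<dots> = posX j x" using \<open>\<forall>j. posX j x = _\<close> by metis
    finally show ?case .
  qed
qed

abbreviation "\<rho>Y j \<equiv> copy_offset (H (Suc (a j))) (W (Suc (a j)))"

text \<open>On matched positions the descent from \<open>p (Suc j) x\<close> to the earlier tower of
  \<open>S\<close> factors through the tower \<open>a (Suc j)\<close> of \<open>T\<close>. There it
  meets \<open>posX (Suc j) x\<close>, whose virtual position is \<open>p j x\<close> by
  definition.\<close>

lemma eventually_p_coherent: "AE x in M. eventually (\<lambda>j. p j x = \<rho>Y j (p (Suc j) x)) sequentially"
  using eventually_regular_p eventually_virt_p
proof eventually_elim
  case (elim x)
  have "eventually (\<lambda>j. virt (a (Suc j)) (p (Suc j) x) = posX (Suc j) x) sequentially"
    using elim(2) by (subst eventually_sequentially_Suc)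
  with elim(1) show ?case
  proof eventually_elim
    case (elim j)
    have "\<rho>Y j (p (Suc j) x) = virt (Suc (a j)) (virt (a (Suc j)) (p (Suc j) x))"
      using mtch_offset elim(1) by (simp only: a_Suc)
    also have "\<dots> = p j x" unfolding elim(2) p_def[of j x] ..
    finally show ?case by simp
  qed
qed

text \<open>The sequence \<open>p\<close> is coherent only from some stage on, depending on
  \<open>x\<close>. Pushing it down from late stages gives, almost everywhere, an exactly coherent
  sequence with the same tail.\<close>

definition "code x i = ev (\<lambda>l. down \<rho>Y i l (p l x))"

lemma eventually_down_const:
  assumes "eventually (\<lambda>j. p j x = \<rho>Y j (p (Suc j) x)) sequentially"
  shows "\<exists>J. \<forall>i l. i \<le> l \<longrightarrow> J \<le> l \<longrightarrow> down \<rho>Y i l (p l x) = code x i"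
proof -
  obtain J where J: "\<And>j. J \<le> j \<Longrightarrow> p j x = \<rho>Y j (p (Suc j) x)" using assms by (auto simp: eventually_sequentially)
  have "down \<rho>Y i l (p l x) = code x i" if "i \<le> l" "J \<le> l" for i l
  proof -
    have const: "down \<rho>Y i m (p m x) = down \<rho>Y i l (p l x)" if "l \<le> m" for m
      using that
    proof (induction m rule: dec_induct)
      case (step m)
      then have "J \<le> m" "i \<le> m" using \<open>i \<le> l\<close> \<open>J \<le> l\<close> by auto
      then show ?case using step.IH J[of m] by simp
    qed simp
    have "eventually (\<lambda>m. down \<rho>Y i m (p m x) = down \<rho>Y i l (p l x)) sequentially"
      unfolding eventually_sequentially by (intro exI[of _ l] allI impI) (rule const)
    from ev_eq[OF this] show ?thesis by (simp add: code_def)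
  qed
  then show ?thesis by blast
qed

lemma AE_code:
  "AE x in M. (\<forall>i. code x i = \<rho>Y i (code x (Suc i))) \<and> eventually (\<lambda>j. code x j = p j x) sequentially \<and>
    (\<forall>i. eventually (\<lambda>l. down \<rho>Y i l (p l x) = code x i) sequentially)"
  using eventually_p_coherent
proof eventually_elim
  case (elim x)
  obtain J where J: "\<And>i l. i \<le> l \<Longrightarrow> J \<le> l \<Longrightarrow> down \<rho>Y i l (p l x) = code x i"
    using eventually_down_const[OF elim] by blast
  have "code x i = \<rho>Y i (code x (Suc i))" for i
    using J[of i "max J (Suc i)"] J[of "Suc i" "max J (Suc i)"] down_Suc_left[of i "max J (Suc i)"] by simp
  moreover have "eventually (\<lambda>j. code x j = p j x) sequentially"
    unfolding eventually_sequentially using J[of j j for j] by (intro exI[of _ J]) simp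
  moreover have "eventually (\<lambda>l. down \<rho>Y i l (p l x) = code x i) sequentially" for i
    unfolding eventually_sequentially using J by (intro exI[of _ "max i J"]) simp
  ultimately show ?case by blast
qed

lemma code_measurable: "(\<lambda>x. code x i) \<in> measurable M (count_space UNIV)"
  unfolding code_def
  by (rule measurable_ev) (rule measurable_compose[OF p_measurable], simp)

lemma code_sets: "{x\<in>space M. code x m \<in> D} \<in> sets M"
  using measurable_sets[OF code_measurable, of D m] by (simp add: vimage_def Int_def conj_commute)

lemma p_sets: "{x\<in>space M. p m x \<in> D} \<in> sets M"
  using measurable_sets[OF p_measurable, of D m] by (simp add: vimage_def Int_def conj_commute)

text \<open>Since \<open>virt\<close> is bijective on chunks, the virtual position is almost uniformly distributed.\<close>
lemma measure_p_ge:
  assumes "1 \<le> l"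
  shows "(1 - 2 / 2 ^ l) * (measure N {y\<in>space N. posY l y \<in> D} - 1 / 2 ^ l) \<le> measure M {x\<in>space M. p l x \<in> D}"
proof -
  let ?h = "H (Suc (a l))" and ?K = "H (a (Suc l))"
  let ?c = "card {s. s < ?h \<and> s \<in> D}"
  have "measure N {y\<in>space N. posY l y \<in> D} \<le> measure N ({y\<in>space N. posY l y < ?h \<and> posY l y \<in> D} \<union> {y\<in>space N. \<not> posY l y < ?h})"
    by (rule Y.finite_measure_mono)
      (use Y.pos_less_sets[of l D] Y.pos_sets[of l "- {..<?h}"] in \<open>auto simp: not_less\<close>)
  also have "\<dots> \<le> measure N {y\<in>space N. posY l y < ?h \<and> posY l y \<in> D} + measure N {y\<in>space N. \<not> posY l y < ?h}"
    by (rule measure_Un_le) (use Y.pos_less_sets[of l D] Y.pos_sets[of l "- {..<?h}"] in \<open>auto simp: not_less\<close>)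
  also have "\<dots> \<le> ?c * bY l + 1 / 2 ^ l"
    unfolding Y.measure_pos_in Y.measure_outside using outY[of l] by simp
  finally have 1: "measure N {y\<in>space N. posY l y \<in> D} - 1 / 2 ^ l \<le> ?c * bY l" by simp
  have "2 ^ l * ?h \<le> r (a l) * ?h" by (rule mult_le_mono1[OF r_pow[OF a_ge]])
  also have "\<dots> \<le> ?K" using H_growth(2)[of "a l"] by (simp only: a_Suc)
  finally have hK: "?h * 2 ^ l \<le> ?K" by (simp only: mult.commute)
  have b0: "0 \<le> bX (Suc l)" and Kb: "?K * bX (Suc l) \<le> 1" by (rule X.b_nonneg) (rule X.H_b_le)
  have "?h * bX (Suc l) * 2 ^ l \<le> ?K * bX (Suc l)"
    using mult_right_mono[OF of_nat_mono[OF hK, where 'a=real] b0] by (simp add: ac_simps)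
  then have hb: "?h * bX (Suc l) \<le> 1 / 2 ^ l" using Kb by (simp add: field_simps)
  \<comment> \<open>Complete chunks miss less than \<open>?h\<close> levels, of mass at most
    \<open>1 / 2 ^ l\<close>; the part outside the tower has mass at most
    \<open>1 / 2 ^ Suc l\<close>. Together they stay below \<open>2 / 2 ^ l\<close>.\<close>
  have "?K \<le> (?K div ?h) * ?h + ?h" using div_mult_mod_eq[of ?K ?h] mod_less_divisor[OF H_pos, of ?K "Suc (a l)"] by linarith
  then have "?K * bX (Suc l) \<le> real ((?K div ?h) * ?h + ?h) * bX (Suc l)" by (intro mult_right_mono b0) (simp only: of_nat_le_iff)
  also have "real ((?K div ?h) * ?h + ?h) * bX (Suc l) = real (?K div ?h) * ?h * bX (Suc l) + ?h * bX (Suc l)"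
    by (simp add: algebra_simps)
  finally have "1 - 1 / 2 ^ Suc l \<le> real (?K div ?h) * ?h * bX (Suc l) + 1 / 2 ^ l"
    using hb outX[of "Suc l"] by linarith
  moreover have "(1::real) / 2 ^ Suc l \<le> 1 / 2 ^ l" by (simp add: field_simps)
  moreover have "(2::real) / 2 ^ l = 1 / 2 ^ l + 1 / 2 ^ l" by simp
  ultimately have q: "1 - 2 / 2 ^ l \<le> real (?K div ?h) * ?h * bX (Suc l)" by linarith
  have "(1 - 2 / 2 ^ l) * (?c * bY l) \<le> real (?K div ?h) * ?h * bX (Suc l) * (?c * bY l)"
    by (rule mult_right_mono[OF q]) (simp add: Y.b_nonneg)
  also have "\<dots> = real (?K div ?h) * ?c * bX (Suc l) * (?h * bY l)" by simp
  also have "\<dots> \<le> real (?K div ?h) * ?c * bX (Suc l) * 1"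
    by (rule mult_left_mono[OF Y.H_b_le]) (simp add: b0)
  also have "\<dots> \<le> real (card {t. t < ?K \<and> virt (Suc (a l)) t \<in> D}) * bX (Suc l)"
    using mult_right_mono[OF of_nat_mono[OF card_virt_pullback_ge[of "a l" D], where 'a=real] b0] by (simp add: a_Suc)
  also have "\<dots> = measure M {x\<in>space M. posX (Suc l) x < ?K \<and> posX (Suc l) x \<in> {t. virt (Suc (a l)) t \<in> D}}"
    unfolding X.measure_pos_in by simp
  also have "\<dots> \<le> measure M {x\<in>space M. p l x \<in> D}"
    by (rule X.finite_measure_mono) (use p_sets in \<open>auto simp: p_def\<close>)
  finally have 2: "(1 - 2 / 2 ^ l) * (?c * bY l) \<le> measure M {x\<in>space M. p l x \<in> D}" .
  have "(2::real) ^ 1 \<le> 2 ^ l" by (rule power_increasing[OF assms]) simp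
  then have "(0::real) \<le> 1 - 2 / 2 ^ l" by (simp add: field_simps)
  from mult_left_mono[OF 1 this] 2 show ?thesis by linarith
qed

lemma eventually_posY_down:
  assumes "m \<le> l" shows "AE y in N. down \<rho>Y m l (posY l y) = posY m y"
  using Y.coherent
proof eventually_elim
  case (elim y)
  show ?case by (rule down_coherent[of "\<lambda>j. posY j y" "\<rho>Y" m l]) (use elim assms in blast)+
qed

lemma measure_code_ge: "measure N {y\<in>space N. posY m y \<in> D} \<le> measure M {x\<in>space M. code x m \<in> D}"
proof -
  let ?D = "\<lambda>l. {s. down \<rho>Y m l s \<in> D}"
  have lim: "(\<lambda>l. measure M {x\<in>space M. p l x \<in> ?D l}) \<longlonglongrightarrow> measure M {x\<in>space M. code x m \<in> D}"
  proof (rule X.prob_tendsto_eventually)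
    show "AE x in M. eventually (\<lambda>l. x \<in> {x\<in>space M. p l x \<in> ?D l} \<longleftrightarrow> x \<in> {x\<in>space M. code x m \<in> D}) sequentially"
      using AE_code
    proof eventually_elim
      case (elim x)
      then have "eventually (\<lambda>l. down \<rho>Y m l (p l x) = code x m) sequentially" by blast
      then show ?case by eventually_elim simp
    qed
  qed (rule p_sets code_sets)+
  let ?v = "measure N {y\<in>space N. posY m y \<in> D}"
  have "(\<lambda>l. (1 - 2 / 2 ^ l) * (?v - 1 / 2 ^ l)) \<longlonglongrightarrow> (1 - 0) * (?v - 0)"
    by (intro tendsto_mult tendsto_diff tendsto_const summable_LIMSEQ_zero[OF summable_pow2])
  moreover have "\<exists>L. \<forall>l\<ge>L. (1 - 2 / 2 ^ l) * (?v - 1 / 2 ^ l) \<le> measure M {x\<in>space M. p l x \<in> ?D l}"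
  proof (intro exI[of _ "max 1 m"] allI impI)
    fix l assume "max 1 m \<le> l"
    then have l: "m \<le> l" "1 \<le> l" by auto
    have "?v = measure N {y\<in>space N. posY l y \<in> ?D l}"
    proof (rule Y.finite_measure_eq_AE)
      show "AE y in N. y \<in> {y\<in>space N. posY m y \<in> D} \<longleftrightarrow> y \<in> {y\<in>space N. posY l y \<in> ?D l}"
        using eventually_posY_down[OF l(1)] by eventually_elim simp
    qed (rule Y.pos_sets)+
    then show "(1 - 2 / 2 ^ l) * (?v - 1 / 2 ^ l) \<le> measure M {x\<in>space M. p l x \<in> ?D l}"
      using measure_p_ge[OF l(2), of "?D l"] by simp
  qed
  ultimately have "(1 - 0) * (?v - 0) \<le> measure M {x\<in>space M. code x m \<in> D}"
    by (rule LIMSEQ_le[OF _ lim])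
  then show ?thesis by simp
qed

text \<open>Both sides are probabilities, so the inequality for all sets, applied to the complement
  of \<open>D\<close>, turns into its reverse.\<close>

lemma measure_code: "measure M {x\<in>space M. code x m \<in> D} = measure N {y\<in>space N. posY m y \<in> D}"
proof (rule antisym[OF _ measure_code_ge])
  have "{y\<in>space N. posY m y \<in> - D} = space N - {y\<in>space N. posY m y \<in> D}"
    "{x\<in>space M. code x m \<in> - D} = space M - {x\<in>space M. code x m \<in> D}" by auto
  then show "measure M {x\<in>space M. code x m \<in> D} \<le> measure N {y\<in>space N. posY m y \<in> D}"
    using measure_code_ge[of m "- D"] X.prob_compl[OF code_sets, of m D] Y.prob_compl[OF Y.pos_sets, of m D] by simp
qed

lemma code_space_measurable: "code \<in> measurable M code_space"
  by (rule measurable_PiM_single') (use code_measurable in auto)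

lemma posY_measurable: "(\<lambda>y j. posY j y) \<in> measurable N code_space"
  by (rule measurable_PiM_single') (use Y.pos_measurable in auto)

lemma distr_code: "distr M code_space code = distr N code_space (\<lambda>y j. posY j y)"
proof (rule measure_eqI_PiM_infinite[where I=UNIV and M="\<lambda>_. count_space UNIV"])
  fix A :: "nat \<Rightarrow> nat set" and J :: "nat set" assume J: "finite J"
  \<comment> \<open>By coherence the coordinates in \<open>J\<close> are functions of the single
    coordinate \<open>m\<close>; the inserted 0 takes care of empty \<open>J\<close>.\<close>
  define m where "m = Max (insert 0 J)"
  have Jm: "i \<le> m" if "i \<in> J" for i unfolding m_def using that J by (intro Max_ge) auto
  let ?D = "{s. \<forall>i\<in>J. down \<rho>Y i m s \<in> A i}"
  let ?E = "prod_emb UNIV (\<lambda>_. count_space UNIV) J (Pi\<^sub>E J A)"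
  have E: "z \<in> ?E \<longleftrightarrow> (\<forall>i\<in>J. z i \<in> A i)" for z by (auto simp: prod_emb_def)
  have Es: "?E \<in> sets code_space" by (rule sets_PiM_I) (use J in auto)
  have "emeasure (distr M code_space code) ?E = emeasure M (code -` ?E \<inter> space M)"
    by (rule emeasure_distr[OF code_space_measurable Es])
  also have "\<dots> = emeasure M {x\<in>space M. code x m \<in> ?D}"
  proof (rule emeasure_eq_AE)
    show "AE x in M. x \<in> code -` ?E \<inter> space M \<longleftrightarrow> x \<in> {x\<in>space M. code x m \<in> ?D}"
      using AE_code
    proof eventually_elim
      case (elim x)
      then have "down \<rho>Y i m (code x m) = code x i" if "i \<in> J" for i
        by (intro down_coherent Jm that) blast
      then show ?case by (auto simp: E)
    qed
  qed (rule measurable_sets[OF code_space_measurable Es] code_sets)+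
  also have "\<dots> = emeasure N {y\<in>space N. posY m y \<in> ?D}"
    unfolding X.emeasure_eq_measure Y.emeasure_eq_measure measure_code ..
  also have "\<dots> = emeasure N ((\<lambda>y j. posY j y) -` ?E \<inter> space N)"
  proof (rule emeasure_eq_AE)
    have "AE y in N. \<forall>i\<in>J. down \<rho>Y i m (posY m y) = posY i y"
      by (rule AE_finite_allI[OF J]) (rule eventually_posY_down[OF Jm])
    then show "AE y in N. y \<in> {y\<in>space N. posY m y \<in> ?D} \<longleftrightarrow> y \<in> (\<lambda>y j. posY j y) -` ?E \<inter> space N"
      by eventually_elim (auto simp: E)
  qed (rule measurable_sets[OF posY_measurable Es] Y.pos_sets)+
  also have "\<dots> = emeasure (distr N code_space (\<lambda>y j. posY j y)) ?E"
    by (rule emeasure_distr[OF posY_measurable Es, symmetric])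
  finally show "emeasure (distr M code_space code) ?E = emeasure (distr N code_space (\<lambda>y j. posY j y)) ?E" .
next
  show "finite_measure (distr M code_space code)"
    by (rule X.finite_measure_distr[OF code_space_measurable])
qed auto

text \<open>Since \<open>code\<close> has the distribution of the genuine codes of points of
  \<open>N\<close>, it can be followed by the inverse \<open>G\<close> of that coding.\<close>

theorem matching_map:
  "\<exists>\<phi>. \<phi> \<in> measurable M N \<and> distr M N \<phi> = N \<and> (AE x in M. eventually (\<lambda>j. posY j (\<phi> x) = p j x) sequentially)"
proof -
  let ?P = "distr N code_space (\<lambda>y j. posY j y)"
  obtain G where "measure_iso N (completion ?P) (\<lambda>y j. posY j y) G" using Y.iso by blast
  then have G: "G \<in> measurable (completion ?P) N" "distr (completion ?P) N G = N"
    "AE z in completion ?P. (\<lambda>j. posY j (G z)) = z" by (auto simp: measure_iso_def)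
  have c: "code \<in> measurable M ?P" "distr M ?P code = ?P"
    using code_space_measurable distr_code by (auto cong: measurable_cong_sets distr_cong)
  note c2 = measurable_distr_completion[OF X.complete c]
  have "AE z in distr M (completion ?P) code. (\<lambda>j. posY j (G z)) = z" unfolding c2(2) by (rule G(3))
  then have "AE x in M. (\<lambda>j. posY j (G (code x))) = code x" by (rule AE_distrD[OF c2(1)])
  then have "AE x in M. eventually (\<lambda>j. posY j (G (code x)) = p j x) sequentially"
    using AE_code
  proof eventually_elim
    case (elim x)
    from elim(2) have "eventually (\<lambda>j. code x j = p j x) sequentially" by blast
    then show ?case by eventually_elim (use fun_cong[OF elim(1)] in simp)
  qed
  moreover have "G \<circ> code \<in> measurable M N" by (rule measurable_comp[OF c2(1) G(1)])
  moreover have "distr M N (G \<circ> code) = N"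
    using distr_distr[OF G(1) c2(1)] unfolding c2(2) G(2) by simp
  ultimately show ?thesis by (intro exI[of _ "G \<circ> code"]) simp
qed

end

section \<open>The orbit cocycle and its integrability\<close>

context orbit_matching
begin

definition "stage_cocycle j x = incr (Suc (a j)) (posX (Suc j) x)"
text \<open>Says that the step from \<open>x\<close> to \<open>T x\<close> stays in the tower and in
  one chunk. These are the side conditions that \<open>incr_two_step\<close> passes on to the
  preceding stage, so they support a descending induction.\<close>

definition "tracked j x \<longleftrightarrow> posX (Suc j) x + 1 < H (a (Suc j)) \<and> (posX (Suc j) x + 1) mod H (Suc (a j)) \<noteq> 0"
definition "cocycle x = ev (\<lambda>j. stage_cocycle j x)"

lemma stage_cocycle_measurable: "stage_cocycle j \<in> measurable M (count_space UNIV)"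
  unfolding stage_cocycle_def[abs_def] by (rule measurable_compose[OF X.pos_measurable]) simp

lemma cocycle_measurable: "cocycle \<in> measurable M (count_space UNIV)"
  unfolding cocycle_def[abs_def] by (rule measurable_ev) (rule stage_cocycle_measurable)

lemma eventually_stage_cocycle: "AE x in M. eventually (\<lambda>j. stage_cocycle j x = cocycle x) sequentially"
  using eventually_regular eventually_regular_p X.coherent
proof eventually_elim
  case (elim x)
  note coh = elim(3)
  have "eventually (\<lambda>j. posX (Suc (Suc j)) x + 1 < H (a (Suc (Suc j))) \<and> mtch (a (Suc j)) (posX (Suc (Suc j)) x)
      \<and> posX (Suc (Suc j)) x \<notin> fwd (a (Suc j))) sequentially"
    using elim(1) by (subst eventually_sequentially_Suc)
  with elim(2) have "eventually (\<lambda>j. stage_cocycle (Suc j) x = stage_cocycle j x) sequentially"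
  proof eventually_elim
    case (elim j)
    have s: "copy_offset (H (Suc (Suc (a j)))) (W (Suc (Suc (a j)))) (posX (Suc (Suc j)) x) = posX (Suc j) x"
      using coh[rule_format, of "Suc j"] by (simp add: a_Suc)
    have "posX (Suc (Suc j)) x \<notin> fwd (Suc (Suc (a j)))" using elim(2) by (simp add: a_Suc)
    from incr_two_step(2)[OF this] elim
    have "incr (Suc (Suc (Suc (a j)))) (posX (Suc (Suc j)) x) = incr (Suc (a j)) (posX (Suc j) x)"
      unfolding s by (auto simp: p_def a_Suc)
    then show ?case by (simp add: stage_cocycle_def a_Suc)
  qed
  then obtain J where J: "\<And>j. J \<le> j \<Longrightarrow> stage_cocycle (Suc j) x = stage_cocycle j x"
    by (auto simp: eventually_sequentially)
  have const: "stage_cocycle j x = stage_cocycle J x" if "J \<le> j" for j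
    using that by (induction j rule: dec_induct) (simp_all add: J)
  then have e: "eventually (\<lambda>j. stage_cocycle j x = stage_cocycle J x) sequentially"
    unfolding eventually_sequentially by blast
  show ?case using e unfolding cocycle_def ev_eq[OF e] .
qed

text \<open>At late stages \<open>\<phi> (T x)\<close> has position \<open>p j (T x)\<close>, and so
  has the iterate of \<open>\<phi> x\<close>, because virtual positions never leave the tower of
  \<open>S\<close>. Points with eventually equal positions coincide.\<close>

lemma matching_orbit:
  assumes \<phi>: "\<phi> \<in> measurable M N" "distr M N \<phi> = N"
    and lim: "AE x in M. eventually (\<lambda>j. posY j (\<phi> x) = p j x) sequentially"
  shows "AE x in M. \<phi> (T x) = iterate_int N S (cocycle x) (\<phi> x)"
proof -
  have pull: "AE x in M. P (\<phi> x)" if "AE y in N. P y" for P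
    by (rule AE_distrD[OF \<phi>(1)]) (unfold \<phi>(2), rule that)
  obtain Q where Q: "AE y in N. Q y"
    "\<And>y y'. Q y \<Longrightarrow> Q y' \<Longrightarrow> eventually (\<lambda>j. posY j y = posY j y') sequentially \<Longrightarrow> y = y'"
    using Y.separating_positions by blast
  have "AE x in M. Q (\<phi> (T x))" by (rule X.AE_T[OF pull[OF Q(1)]])
  moreover have "\<forall>c. AE x in M. Q (iterate_int N S c (\<phi> x))" by (intro allI pull Y.AE_iterate_int Q(1))
  then have "AE x in M. \<forall>c. Q (iterate_int N S c (\<phi> x))" unfolding AE_all_countable .
  moreover note pull[OF Y.orbit] X.orbit lim X.AE_T[OF lim] eventually_stage_cocycle eventually_regular
  ultimately show ?thesis
  proof eventually_elim
    case (elim x)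
    note orbY = elim(3) and orbX = elim(4)
    have "eventually (\<lambda>j. posY j (\<phi> (T x)) = posY j (iterate_int N S (cocycle x) (\<phi> x))) sequentially"
      using elim(5-8)
    proof eventually_elim
      case (elim j)
      have "int (posX (Suc j) (iterate_int M T 1 x)) = int (posX (Suc j) x) + 1"
        using orbX[rule_format, of "Suc j" 1] elim(4) by simp
      then have T: "posX (Suc j) (T x) = posX (Suc j) x + 1" by (simp add: iterate_int_def)
      have c: "cocycle x = int (p j (T x)) - int (p j x)"
        unfolding elim(3)[symmetric] stage_cocycle_def incr_def p_def T by simp
      have "int (posY j (iterate_int N S (cocycle x) (\<phi> x))) = int (posY j (\<phi> x)) + cocycle x"
        by (rule orbY[rule_format]) (use elim(1) c p_less[of j x] p_less[of j "T x"] in auto)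
      then show ?case using elim(1,2) c by simp
    qed
    then show ?case by (rule Q(2)[OF elim(1) elim(2)[rule_format]])
  qed
qed

definition "fwd_set j = {x\<in>space M. posX (Suc (Suc j)) x < H (a (Suc (Suc j))) \<and> posX (Suc (Suc j)) x \<in> fwd (Suc (Suc (a j)))}"
definition "bwd_set j = {x\<in>space M. posX (Suc (Suc j)) x < H (a (Suc (Suc j))) \<and>
  posX (Suc (Suc j)) x \<in> {t. virt (Suc (Suc (Suc (a j)))) t \<in> bwd (Suc (a j))}}"

lemma break_sets: "fwd_set j \<in> sets M" "bwd_set j \<in> sets M"
  unfolding fwd_set_def bwd_set_def by (rule X.pos_less_sets)+

lemma real_card_div:
  assumes "c * n \<le> C * K" "0 < c" shows "real n \<le> real C / real c * real K"
proof -
  have "real (c * n) \<le> real (C * K)" using assms(1) by (simp only: of_nat_le_iff)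
  then show ?thesis using assms(2) by (simp add: field_simps)
qed

lemma measure_fwd_set: "measure M (fwd_set j) \<le> 6 / H (Suc (Suc (a j)))"
  unfolding fwd_set_def
proof (rule X.measure_pos_in_le)
  show "real (card {t. t < H (a (Suc (Suc j))) \<and> t \<in> fwd (Suc (Suc (a j)))}) \<le> 6 / H (Suc (Suc (a j))) * H (a (Suc (Suc j)))"
    using real_card_div[OF card_fwd H_pos, of "Suc (Suc (a j))"] by (simp add: a_Suc)
qed

lemma measure_bwd_set: "measure M (bwd_set j) \<le> 14 / H (Suc (a j))"
  unfolding bwd_set_def
proof (rule X.measure_pos_in_le)
  show "real (card {t. t < H (a (Suc (Suc j))) \<and> t \<in> {t. virt (Suc (Suc (Suc (a j)))) t \<in> bwd (Suc (a j))}})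
      \<le> 14 / H (Suc (a j)) * H (a (Suc (Suc j)))"
    using real_card_div[OF card_pullback_frac[OF card_bwd] H_pos, of "Suc (a j)"] by (simp add: a_Suc)
qed

text \<open>A value is inherited from the preceding stage unless it equals 1 or arises at a break,
  whose kind and stage determine the bound. The first alternative covers the value 1 and the initial
  stage. Since no bound depends on \<open>j\<close>, the estimate passes to the eventual
  value.\<close>

lemma stage_cocycle_bound:
  assumes coh: "\<forall>j. posX j x = copy_offset (H (a j)) (W (a j)) (posX (Suc j) x)" and x: "x \<in> space M"
  shows "tracked j x \<Longrightarrow> \<bar>stage_cocycle j x\<bar> \<le> int (H (Suc (a 0))) \<or>
    (\<exists>l. x \<in> fwd_set l \<and> \<bar>stage_cocycle j x\<bar> \<le> 2 * int (len (Suc (Suc (a l))))) \<or>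
    (\<exists>l. x \<in> bwd_set l \<and> \<bar>stage_cocycle j x\<bar> \<le> 2 * int (len (Suc (a l))))"
proof (induction j)
  case 0 then show ?case using incr_le by (simp add: stage_cocycle_def)
next
  case (Suc j)
  let ?t = "posX (Suc (Suc j)) x" and ?i = "Suc (a j)"
  have t: "?t + 1 < H (a (Suc (Suc j)))" "(?t + 1) mod H (Suc (Suc ?i)) \<noteq> 0"
    using Suc.prems by (simp_all add: tracked_def a_Suc)
  have sc: "stage_cocycle (Suc j) x = incr (Suc (Suc ?i)) ?t" by (simp add: stage_cocycle_def a_Suc)
  have s: "copy_offset (H (Suc ?i)) (W (Suc ?i)) ?t = posX (Suc j) x"
    using coh[rule_format, of "Suc j"] by (simp add: a_Suc)
  show ?case
  proof (cases "?t \<in> fwd (Suc ?i)")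
    case True
    then have "x \<in> fwd_set j" using t x by (simp add: fwd_set_def)
    moreover have "\<bar>stage_cocycle (Suc j) x\<bar> \<le> 2 * int (len (Suc ?i))"
      unfolding sc by (rule incr_forward_bound[OF t(2)])
    ultimately show ?thesis by blast
  next
    case f: False
    note two = incr_two_step[OF f, unfolded s]
    show ?thesis
    proof (cases "virt (Suc (Suc ?i)) ?t \<in> bwd ?i")
      case True
      then have "x \<in> bwd_set j" using t x by (simp add: bwd_set_def)
      moreover have "\<bar>stage_cocycle (Suc j) x\<bar> \<le> 2 * int (len ?i)" unfolding sc by (rule two(1))
      ultimately show ?thesis by blast
    next
      case False
      from two(2)[OF this] show ?thesis
      proof
        assume "incr (Suc (Suc ?i)) ?t = 1 \<and> \<not> (mtch (Suc ?i) ?t \<and> mtch ?i (virt (Suc (Suc ?i)) ?t))"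
        then have "\<bar>stage_cocycle (Suc j) x\<bar> \<le> int (H (Suc (a 0)))" using sc H_pos[of "Suc (a 0)"] by simp
        then show ?thesis by blast
      next
        assume *: "posX (Suc j) x + 1 < H (Suc ?i) \<and> (posX (Suc j) x + 1) mod H ?i \<noteq> 0 \<and>
          incr (Suc (Suc ?i)) ?t = incr ?i (posX (Suc j) x)"
        then have "tracked j x" by (simp add: tracked_def a_Suc)
        moreover have "stage_cocycle (Suc j) x = stage_cocycle j x" using * sc by (simp add: stage_cocycle_def)
        ultimately show ?thesis using Suc.IH by simp
      qed
    qed
  qed
qed

lemma AE_cocycle_bound:
  "AE x in M. \<bar>cocycle x\<bar> \<le> int (H (Suc (a 0))) \<or>
    (\<exists>l. x \<in> fwd_set l \<and> \<bar>cocycle x\<bar> \<le> 2 * int (len (Suc (Suc (a l))))) \<or>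
    (\<exists>l. x \<in> bwd_set l \<and> \<bar>cocycle x\<bar> \<le> 2 * int (len (Suc (a l))))"
  using X.coherent eventually_stage_cocycle eventually_regular AE_space
proof eventually_elim
  case (elim x)
  have "eventually (\<lambda>j. tracked j x) sequentially"
    using elim(3) by eventually_elim (use not_fwd in \<open>auto simp: tracked_def\<close>)
  with elim(2) have "eventually (\<lambda>j. stage_cocycle j x = cocycle x \<and> tracked j x) sequentially"
    by (rule eventually_conj)
  then obtain j where "stage_cocycle j x = cocycle x" "tracked j x" by (auto simp: eventually_sequentially)
  then show ?case using stage_cocycle_bound[OF elim(1) elim(4), of j] by simp
qed

lemma cocycle_integrable:
  fixes \<omega> :: "real \<Rightarrow> real"
  assumes nonneg: "\<And>r. 0 \<le> r \<Longrightarrow> 0 \<le> \<omega> r" and mono: "mono_on {0..} \<omega>"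
    and small: "\<And>i. 2 ^ i * \<omega> (2 * len i) \<le> H i"
  shows "(\<integral>\<^sup>+ x. ennreal (\<omega> (real_of_int \<bar>cocycle x\<bar>)) \<partial>M) < \<infinity>"
proof -
  have mono': "\<omega> (real_of_int \<bar>z\<bar>) \<le> \<omega> (real n)" if "\<bar>z\<bar> \<le> int n" for z n
    by (rule mono_onD[OF mono]) (use that in auto)
  let ?f = "\<lambda>j x. ennreal (\<omega> (2 * len (Suc (Suc (a j))))) * indicator (fwd_set j) x
      + ennreal (\<omega> (2 * len (Suc (a j)))) * indicator (bwd_set j) x"
  let ?C = "ennreal (\<omega> (H (Suc (a 0))))"
  have "(\<integral>\<^sup>+ x. ennreal (\<omega> (real_of_int \<bar>cocycle x\<bar>)) \<partial>M) \<le> (\<integral>\<^sup>+ x. ?C + (\<Sum>j. ?f j x) \<partial>M)"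
  proof (rule nn_integral_mono_AE)
    show "AE x in M. ennreal (\<omega> (real_of_int \<bar>cocycle x\<bar>)) \<le> ?C + (\<Sum>j. ?f j x)"
      using AE_cocycle_bound
    proof eventually_elim
      case (elim x)
      have single: "?f l x \<le> (\<Sum>j. ?f j x)" for l
        using sum_le_suminf[of "\<lambda>j. ?f j x" "{l}"] by simp
      from elim consider "\<bar>cocycle x\<bar> \<le> int (H (Suc (a 0)))"
        | l where "x \<in> fwd_set l" "\<bar>cocycle x\<bar> \<le> int (2 * len (Suc (Suc (a l))))"
        | l where "x \<in> bwd_set l" "\<bar>cocycle x\<bar> \<le> int (2 * len (Suc (a l)))" by auto
      then show ?case
      proof cases
        case 1
        then have "ennreal (\<omega> (real_of_int \<bar>cocycle x\<bar>)) \<le> ?C" by (intro ennreal_leI mono')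
        then show ?thesis by (rule order_trans) simp
      next
        case (2 l)
        have "ennreal (\<omega> (real_of_int \<bar>cocycle x\<bar>)) \<le> ennreal (\<omega> (real (2 * len (Suc (Suc (a l))))))"
          by (rule ennreal_leI[OF mono'[OF 2(2)]])
        also have "\<dots> \<le> ?f l x" using 2(1) by simp
        also note single[of l]
        also have "(\<Sum>j. ?f j x) \<le> ?C + (\<Sum>j. ?f j x)" by simp
        finally show ?thesis .
      next
        case (3 l)
        have "ennreal (\<omega> (real_of_int \<bar>cocycle x\<bar>)) \<le> ennreal (\<omega> (real (2 * len (Suc (a l)))))"
          by (rule ennreal_leI[OF mono'[OF 3(2)]])
        also have "\<dots> \<le> ?f l x" using 3(1) by simp
        also note single[of l]
        also have "(\<Sum>j. ?f j x) \<le> ?C + (\<Sum>j. ?f j x)" by simp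
        finally show ?thesis .
      qed
    qed
  qed
  also have "\<dots> = ?C + (\<Sum>j. \<integral>\<^sup>+ x. ?f j x \<partial>M)"
    using break_sets by (simp add: nn_integral_add nn_integral_suminf X.emeasure_space_1)
  \<comment> \<open>The constant is 6 + 14, from the measures of the forward and the backward break
    sets.\<close>
  also have "\<dots> \<le> ?C + (\<Sum>j. ennreal (20 / 2 ^ j))"
  proof (intro add_left_mono suminf_le)
    fix j
    \<comment> \<open>The factor \<open>H i\<close> in \<open>small\<close> cancels the denominator
      of the measure bound, leaving a geometric series.\<close>
    have weight: "\<omega> (2 * len i) * \<mu> \<le> C / 2 ^ j" if "\<mu> \<le> C / H i" "j \<le> i" "0 \<le> \<mu>" "0 \<le> C" for i \<mu> C
    proof -
      have "0 \<le> \<omega> (2 * len i)" by (rule nonneg) simp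
      then have "\<omega> (2 * len i) * \<mu> \<le> \<omega> (2 * len i) * (C / H i)" by (rule mult_left_mono[OF that(1)])
      moreover have "\<omega> (2 * len i) \<le> H i / 2 ^ i" using small[of i] by (simp add: field_simps)
      then have "\<omega> (2 * len i) * (C / H i) \<le> H i / 2 ^ i * (C / H i)"
        by (rule mult_right_mono) (use that in simp)
      moreover have "H i / 2 ^ i * (C / H i) = C / 2 ^ i" using H_pos[of i] by simp
      moreover have "C / 2 ^ i \<le> C / 2 ^ j"
        using that by (intro divide_left_mono power_increasing) auto
      ultimately show ?thesis by linarith
    qed
    have 1: "\<omega> (2 * len (Suc (Suc (a j)))) * measure M (fwd_set j) \<le> 6 / 2 ^ j"
      by (rule weight) (use measure_fwd_set[of j] a_ge[of j] in auto)
    have 2: "\<omega> (2 * len (Suc (a j))) * measure M (bwd_set j) \<le> 14 / 2 ^ j"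
      by (rule weight) (use measure_bwd_set[of j] a_ge[of j] in auto)
    have "(\<integral>\<^sup>+ x. ?f j x \<partial>M) = ennreal (\<omega> (2 * len (Suc (Suc (a j))))) * emeasure M (fwd_set j)
        + ennreal (\<omega> (2 * len (Suc (a j)))) * emeasure M (bwd_set j)"
      using break_sets by (simp add: nn_integral_add nn_integral_cmult_indicator)
    also have "\<dots> = ennreal (\<omega> (2 * len (Suc (Suc (a j)))) * measure M (fwd_set j)
        + \<omega> (2 * len (Suc (a j))) * measure M (bwd_set j))"
      by (simp add: X.emeasure_eq_measure ennreal_mult'' ennreal_plus nonneg)
    also have "\<dots> \<le> ennreal (20 / 2 ^ j)"
    proof (rule ennreal_leI)
      have "(6::real) / 2 ^ j + 14 / 2 ^ j = 20 / 2 ^ j" by (simp add: add_divide_distrib[symmetric])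
      then show "\<omega> (2 * len (Suc (Suc (a j)))) * measure M (fwd_set j)
          + \<omega> (2 * len (Suc (a j))) * measure M (bwd_set j) \<le> 20 / 2 ^ j" using 1 2 by linarith
    qed
    finally show "(\<integral>\<^sup>+ x. ?f j x \<partial>M) \<le> ennreal (20 / 2 ^ j)" .
  qed auto
  also have "\<dots> < \<infinity>"
  proof -
    have "(\<Sum>j. ennreal (20 / 2 ^ j)) \<noteq> top" by (rule ennreal_suminf_neq_top[OF summable_pow2]) simp
    then have "(\<Sum>j. ennreal (20 / 2 ^ j)) < top" by (simp only: less_top)
    then show ?thesis unfolding infinity_ennreal_def ennreal_add_less_top by (intro conjI ennreal_less_top)
  qed
  finally show ?thesis .
qed

end

section \<open>Choice of the stages\<close>

lemma sublinear_eventually_small: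
  fixes \<omega> :: "real \<Rightarrow> real"
  assumes lim: "((\<lambda>r. \<omega> r / r) \<longlongrightarrow> 0) at_top" and c: "0 < (c::real)" "0 < (C::real)"
    and h: "filterlim (h :: nat \<Rightarrow> nat) at_top sequentially"
  shows "eventually (\<lambda>n. C * \<omega> (c * h n) \<le> h n) sequentially"
proof -
  have real_h: "filterlim (\<lambda>n. real (h n)) at_top sequentially"
    by (rule filterlim_compose[OF filterlim_real_sequentially h])
  then have "filterlim (\<lambda>n. c * real (h n)) at_top sequentially"
    by (rule filterlim_tendsto_pos_mult_at_top[OF tendsto_const c(1)])
  then have "((\<lambda>n. \<omega> (c * h n) / (c * h n)) \<longlongrightarrow> 0) sequentially" by (rule filterlim_compose[OF lim])
  moreover have "0 < 1 / (c * C)" using c by simp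
  ultimately have "eventually (\<lambda>n. \<omega> (c * h n) / (c * h n) < 1 / (c * C)) sequentially" by (rule order_tendstoD(2))
  moreover have "eventually (\<lambda>n. 0 < real (h n)) sequentially"
    using real_h[unfolded filterlim_at_top_dense, rule_format, of 0] .
  ultimately show ?thesis
  proof eventually_elim
    case (elim n)
    then show ?case using c by (simp add: field_simps)
  qed
qed

text \<open>Both instances share \<open>H\<close>, \<open>r\<close>, \<open>W\<close> and therefore
  \<open>virt\<close>, with the roles shifted by one tower. At a late stage the position of
  \<open>\<psi> (\<phi> x)\<close> arises by two successive uses of \<open>virt\<close>, which
  \<open>eventually_virt_p\<close> evaluates as the position of \<open>x\<close>; likewise for the
  other composition.\<close>

lemma matching_orbit_equivalence:
  assumes A: "orbit_matching H r W a M T posX bX N S posY bY"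
    and B: "orbit_matching H r W (\<lambda>j. Suc (a j)) N S posY bY M T (\<lambda>j. posX (Suc j)) bX'"
    and nonneg: "\<And>r. 0 \<le> r \<Longrightarrow> 0 \<le> \<omega> r" and mono: "mono_on {0..} \<omega>"
    and small: "\<And>i. 2 ^ i * \<omega> (real (2 * (r i * H i))) \<le> real (H i)"
  shows "integrably_orbit_equivalent \<omega> M N T S"
proof -
  interpret A: orbit_matching H r W a M T posX bX N S posY bY by (rule A)
  interpret B: orbit_matching H r W "\<lambda>j. Suc (a j)" N S posY bY M T "\<lambda>j. posX (Suc j)" bX' by (rule B)
  have small': "2 ^ i * \<omega> (real (2 * A.len i)) \<le> real (H i)" for i using small[of i] by (simp add: A.len_eq)
  obtain \<phi> where \<phi>: "\<phi> \<in> measurable M N" "distr M N \<phi> = N"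
    "AE x in M. eventually (\<lambda>j. posY j (\<phi> x) = A.p j x) sequentially" using A.matching_map by blast
  obtain \<psi> where \<psi>: "\<psi> \<in> measurable N M" "distr N M \<psi> = M"
    "AE y in N. eventually (\<lambda>j. posX (Suc j) (\<psi> y) = B.p j y) sequentially" using B.matching_map by blast
  have pull\<phi>: "AE x in M. P (\<phi> x)" if "AE y in N. P y" for P
    by (rule AE_distrD[OF \<phi>(1)]) (unfold \<phi>(2), rule that)
  have pull\<psi>: "AE y in N. P (\<psi> y)" if "AE x in M. P x" for P
    by (rule AE_distrD[OF \<psi>(1)]) (unfold \<psi>(2), rule that)
  have "AE x in M. \<psi> (\<phi> x) = x"
  proof -
    obtain Q where Q: "AE x in M. Q x"
      "\<And>x x'. Q x \<Longrightarrow> Q x' \<Longrightarrow> eventually (\<lambda>j. posX (Suc j) x = posX (Suc j) x') sequentially \<Longrightarrow> x = x'"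
      using B.Y.separating_positions by blast
    show ?thesis
      using Q(1) pull\<phi>[OF pull\<psi>[OF Q(1)]] \<phi>(3) pull\<phi>[OF \<psi>(3)] A.eventually_virt_p
    proof eventually_elim
      case (elim x)
      have "eventually (\<lambda>j. posY (Suc j) (\<phi> x) = A.p (Suc j) x) sequentially"
        using elim(3) by (subst eventually_sequentially_Suc)
      moreover have "eventually (\<lambda>j. A.virt (a (Suc j)) (A.p (Suc j) x) = posX (Suc j) x) sequentially"
        using elim(5) by (subst eventually_sequentially_Suc)
      ultimately have "eventually (\<lambda>j. posX (Suc j) (\<psi> (\<phi> x)) = posX (Suc j) x) sequentially"
        using elim(4)
      proof eventually_elim
        case (elim j)
        have "posX (Suc j) (\<psi> (\<phi> x)) = A.virt (Suc (Suc (a j))) (posY (Suc j) (\<phi> x))"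
          unfolding elim(3) B.p_def ..
        also have "\<dots> = posX (Suc j) x" unfolding elim(1) using elim(2) by (simp only: A.a_Suc)
        finally show ?case .
      qed
      then show ?case by (rule Q(2)[OF elim(2,1)])
    qed
  qed
  moreover have "AE y in N. \<phi> (\<psi> y) = y"
  proof -
    obtain Q where Q: "AE y in N. Q y"
      "\<And>y y'. Q y \<Longrightarrow> Q y' \<Longrightarrow> eventually (\<lambda>j. posY j y = posY j y') sequentially \<Longrightarrow> y = y'"
      using A.Y.separating_positions by blast
    show ?thesis
      using Q(1) pull\<psi>[OF pull\<phi>[OF Q(1)]] \<psi>(3) pull\<psi>[OF \<phi>(3)] B.eventually_virt_p
    proof eventually_elim
      case (elim y)
      have "eventually (\<lambda>j. posY j (\<phi> (\<psi> y)) = posY j y) sequentially"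
        using elim(3-5)
      proof eventually_elim
        case (elim j)
        have "posY j (\<phi> (\<psi> y)) = A.virt (Suc (a j)) (posX (Suc j) (\<psi> y))"
          unfolding elim(2) A.p_def ..
        also have "\<dots> = posY j y" unfolding elim(1) by (rule elim(3))
        finally show ?case .
      qed
      then show ?case by (rule Q(2)[OF elim(2,1)])
    qed
  qed
  ultimately have "measure_iso M N \<phi> \<psi>" using \<phi> \<psi> by (simp add: measure_iso_def)
  moreover have "orbit_cocycles M N T S \<phi> \<psi> A.cocycle B.cocycle"
    unfolding orbit_cocycles_def
    using A.cocycle_measurable B.cocycle_measurable A.matching_orbit[OF \<phi>] B.matching_orbit[OF \<psi>] by blast
  moreover have "(\<integral>\<^sup>+ x. ennreal (\<omega> (real_of_int \<bar>A.cocycle x\<bar>)) \<partial>M) < \<infinity>"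
    by (rule A.cocycle_integrable[OF nonneg mono small'])
  moreover have "(\<integral>\<^sup>+ y. ennreal (\<omega> (real_of_int \<bar>B.cocycle y\<bar>)) \<partial>N) < \<infinity>"
    by (rule B.cocycle_integrable[OF nonneg mono small'])
  ultimately show ?thesis unfolding integrably_orbit_equivalent_def by blast
qed

lemma dense_copies:
  assumes "coded_system M T H W pos b" and out: "1 - H j * b j \<le> 1 / (real r)\<^sup>2" and r: "0 < r"
  shows "r * r * (H (Suc j) - card (W j) * H j) \<le> H (Suc j)"
proof (cases "card (W j) * H j \<le> H (Suc j)")
  case True
  interpret coded_system M T H W pos b by fact
  have "real (H (Suc j) - card (W j) * H j) = real (H (Suc j)) - card (W j) * H j" using True by (simp add: of_nat_diff)
  also have "\<dots> \<le> (1 - H j * b j) * H (Suc j)" by (rule W_density)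
  also have "\<dots> \<le> 1 / (real r)\<^sup>2 * H (Suc j)" by (rule mult_right_mono[OF out]) simp
  finally have "real (r * r * (H (Suc j) - card (W j) * H j)) \<le> real (H (Suc j))"
    using r by (simp add: field_simps power2_eq_square)
  then show ?thesis by (simp only: of_nat_le_iff)
qed simp

theorem theoremA:
  fixes M :: "'a measure" and N :: "'b measure"
    and T :: "'a \<Rightarrow> 'a" and S :: "'b \<Rightarrow> 'b"
  assumes "lebesgue_prob_space M" and "non_atomic M"
    and "lebesgue_prob_space N" and "non_atomic N"
    and "rank_one M T" and "rank_one N S"
  shows "\<forall>\<omega> :: real \<Rightarrow> real.
           (\<forall>r\<ge>0. \<omega> r \<ge> 0) \<and> mono_on {0..} \<omega> \<and> ((\<lambda>r. \<omega> r / r) \<longlongrightarrow> 0) at_top \<longrightarrow>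
             integrably_orbit_equivalent \<omega> M N T S"
proof (intro allI impI, elim conjE)
  fix \<omega> :: "real \<Rightarrow> real"
  assume nonneg: "\<forall>r\<ge>0. \<omega> r \<ge> 0" and mono: "mono_on {0..} \<omega>" and lim: "((\<lambda>r. \<omega> r / r) \<longlongrightarrow> 0) at_top"
  obtain k\<^sub>X B\<^sub>X where "tower_sequence M T k\<^sub>X B\<^sub>X"
    using rank_one_tower_sequence assms(1,2,5) by (metis lebesgue_prob_space_def)
  then interpret X: tower_sequence M T k\<^sub>X B\<^sub>X .
  obtain k\<^sub>Y B\<^sub>Y where "tower_sequence N S k\<^sub>Y B\<^sub>Y"
    using rank_one_tower_sequence assms(3,4,6) by (metis lebesgue_prob_space_def)
  then interpret Y: tower_sequence N S k\<^sub>Y B\<^sub>Y .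
  define h where "h i = (if even i then k\<^sub>X else k\<^sub>Y)" for i :: nat
  define \<mu> where "\<mu> i n = (if even i then measure M (X.R n) else measure N (Y.R n))" for i n :: nat
  \<comment> \<open>Fixed before any height: at least 3 for the rearrangement, and growing
    geometrically for Borel-Cantelli.\<close>
  define r :: "nat \<Rightarrow> nat" where "r i = 2 ^ (i + 2)" for i
  have h_top: "filterlim (h i) at_top sequentially" for i
    using X.k_at_top Y.k_at_top by (cases "even i") (simp_all add: h_def)
  have \<mu>_lim: "(\<lambda>n. \<mu> i n) \<longlonglongrightarrow> 1" for i
    using X.R_limit Y.R_limit by (cases "even i") (simp_all add: \<mu>_def)
  \<comment> \<open>Conditions on a single tower: coverage up to \<open>1 / r\<^sup>2\<close>, which
    \<open>dense_copies\<close> turns into density of its copies in later towers, and smallness of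
    \<open>\<omega>\<close> at the largest jumps of this stage. \<open>E\<close> relates consecutive
    choices; its part \<open>n < n'\<close> makes the stages increase within each parity as
    well.\<close>
  define P where "P i n \<longleftrightarrow> 1 - 1 / (real (r i))\<^sup>2 < \<mu> i n \<and> 2 ^ i * \<omega> (real (2 * (r i * h i n))) \<le> h i n" for i n
  define E where "E i n n' \<longleftrightarrow> n < n' \<and> r i * r i * h i n \<le> h (Suc i) n'" for i n n'
  have evP: "eventually (P i) sequentially" for i
  proof -
    have "eventually (\<lambda>n. 1 - 1 / (real (r i))\<^sup>2 < \<mu> i n) sequentially"
      by (rule order_tendstoD(1)[OF \<mu>_lim]) (simp add: r_def)
    moreover have "eventually (\<lambda>n. 2 ^ i * \<omega> (real (2 * r i) * h i n) \<le> h i n) sequentially"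
      by (rule sublinear_eventually_small[OF lim _ _ h_top]) (simp_all add: r_def)
    ultimately show ?thesis unfolding P_def by eventually_elim (simp add: mult.assoc)
  qed
  have "\<exists>n. \<forall>i. P i (n i) \<and> E i (n i) (n (Suc i))"
  proof (rule dependent_nat_choice)
    show "\<exists>n. P 0 n" using eventually_happens[OF evP] by simp
    fix n i
    have "eventually (\<lambda>n'. r i * r i * h i n \<le> h (Suc i) n') sequentially"
      using h_top[of "Suc i"] by (simp add: filterlim_at_top)
    then have "eventually (\<lambda>n'. P (Suc i) n' \<and> E i n n') sequentially"
      using evP[of "Suc i"] eventually_gt_at_top[of n] unfolding E_def by eventually_elim simp
    then show "\<exists>n'. P (Suc i) n' \<and> E i n n'" using eventually_happens by fastforce
  qed
  then obtain n where P: "\<And>i. P i (n i)" and E: "\<And>i. E i (n i) (n (Suc i))" by blast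
  have n_mono: "strict_mono n" using E by (simp add: strict_mono_Suc_iff E_def)
  define H where "H i = h i (n i)" for i
  define W where "W i = (if even i then X.cover else Y.cover) (n i) (n (Suc (Suc i)))" for i
  have HX: "H (2 * j) = k\<^sub>X (n (2 * j))" and HX': "H (Suc (Suc (2 * j))) = k\<^sub>X (n (Suc (Suc (2 * j))))"
    and HY: "H (Suc (2 * j)) = k\<^sub>Y (n (Suc (2 * j)))" for j by (simp_all add: H_def h_def)
  have WX: "W (2 * j) = X.cover (n (2 * j)) (n (Suc (Suc (2 * j))))"
    and WX': "W (Suc (Suc (2 * j))) = X.cover (n (Suc (Suc (2 * j)))) (n (Suc (Suc (Suc (Suc (2 * j))))))"
    and WY: "W (Suc (2 * j)) = Y.cover (n (Suc (2 * j))) (n (Suc (Suc (Suc (2 * j)))))" for j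
    by (simp_all add: W_def)
  have r_ge: "3 \<le> r i" for i
  proof -
    have "r i = 4 * 2 ^ i" "1 \<le> (2::nat) ^ i" by (simp_all add: r_def)
    then show ?thesis by linarith
  qed
  have small_out: "1 / (real (r i))\<^sup>2 \<le> 1 / 2 ^ j" if "j \<le> i" for i j
  proof -
    have "(2::real) ^ j \<le> 2 ^ ((i + 2) * 2)" using that by (intro power_increasing) auto
    then show ?thesis by (simp add: r_def power_mult[symmetric] frac_le)
  qed
  have r_gt1: "1 / (real (r i))\<^sup>2 < 1" for i
  proof -
    have "1 < (real (r i))\<^sup>2" by (rule one_less_power) (use r_ge[of i] in auto)
    moreover from this have "0 < (real (r i))\<^sup>2" by linarith
    ultimately show ?thesis using divide_less_eq_1_pos by blast
  qed
  have outX: "1 - k\<^sub>X (n i) * measure M (B\<^sub>X (n i)) \<le> 1 / (real (r i))\<^sup>2" "0 < measure M (B\<^sub>X (n i))" if "even i" for i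
  proof -
    have lt: "1 - 1 / (real (r i))\<^sup>2 < k\<^sub>X (n i) * measure M (B\<^sub>X (n i))"
      using P[of i] that by (simp add: P_def \<mu>_def X.measure_R)
    then show "1 - k\<^sub>X (n i) * measure M (B\<^sub>X (n i)) \<le> 1 / (real (r i))\<^sup>2" by simp
    show "0 < measure M (B\<^sub>X (n i))" unfolding zero_less_measure_iff using lt r_gt1[of i] by auto
  qed
  have outY: "1 - k\<^sub>Y (n i) * measure N (B\<^sub>Y (n i)) \<le> 1 / (real (r i))\<^sup>2" "0 < measure N (B\<^sub>Y (n i))" if "odd i" for i
  proof -
    have lt: "1 - 1 / (real (r i))\<^sup>2 < k\<^sub>Y (n i) * measure N (B\<^sub>Y (n i))"
      using P[of i] that by (simp add: P_def \<mu>_def Y.measure_R)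
    then show "1 - k\<^sub>Y (n i) * measure N (B\<^sub>Y (n i)) \<le> 1 / (real (r i))\<^sup>2" by simp
    show "0 < measure N (B\<^sub>Y (n i))" unfolding zero_less_measure_iff using lt r_gt1[of i] by auto
  qed
  have mono_even: "strict_mono (\<lambda>j. n (2 * j))" and mono_odd: "strict_mono (\<lambda>j. n (Suc (2 * j)))"
    and mono_even': "strict_mono (\<lambda>j. n (Suc (Suc (2 * j))))"
    using n_mono by (auto simp: strict_mono_def)
  have CX: "coded_system M T (\<lambda>j. H (2 * j)) (\<lambda>j. W (2 * j)) (\<lambda>j. X.pos (n (2 * j))) (\<lambda>j. measure M (B\<^sub>X (n (2 * j))))"
    using X.coded_subsystem[OF assms(1) mono_even] outX(2) by (simp add: HX WX)
  have CX': "coded_system M T (\<lambda>j. H (Suc (Suc (2 * j)))) (\<lambda>j. W (Suc (Suc (2 * j)))) (\<lambda>j. X.pos (n (Suc (Suc (2 * j)))))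
      (\<lambda>j. measure M (B\<^sub>X (n (Suc (Suc (2 * j))))))"
    using X.coded_subsystem[OF assms(1) mono_even'] outX(2) by (simp add: HX' WX')
  have CY: "coded_system N S (\<lambda>j. H (Suc (2 * j))) (\<lambda>j. W (Suc (2 * j))) (\<lambda>j. Y.pos (n (Suc (2 * j)))) (\<lambda>j. measure N (B\<^sub>Y (n (Suc (2 * j)))))"
    using Y.coded_subsystem[OF assms(3) mono_odd] outY(2) by (simp add: HY WY)
  interpret CX: coded_system M T "\<lambda>j. H (2 * j)" "\<lambda>j. W (2 * j)" "\<lambda>j. X.pos (n (2 * j))" "\<lambda>j. measure M (B\<^sub>X (n (2 * j)))"
    by (rule CX)
  interpret CY: coded_system N S "\<lambda>j. H (Suc (2 * j))" "\<lambda>j. W (Suc (2 * j))" "\<lambda>j. Y.pos (n (Suc (2 * j)))" "\<lambda>j. measure N (B\<^sub>Y (n (Suc (2 * j))))"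
    by (rule CY)
  have parity: "(\<exists>j. i = 2 * j) \<or> (\<exists>j. i = Suc (2 * j))" for i :: nat by presburger
  have I: "interleaving H r W"
  proof
    fix i
    show "0 < H i" using X.k_pos Y.k_pos by (simp add: H_def h_def)
    show "3 \<le> r i" by (rule r_ge)
    show "separated (H i) (W i)" using parity[of i] CX.W_sep CY.W_sep by blast
    show "w + H i \<le> H (Suc (Suc i))" if "w \<in> W i" for w
      using parity[of i] CX.W_le CY.W_le that by fastforce
    have g: "r i * r i * H i \<le> H (Suc i)" for i using E[of i] by (simp add: E_def H_def)
    show "r i * r i * H i \<le> H (Suc i)" by (rule g)
    have "r i * 1 \<le> r (Suc i) * r (Suc i)" by (rule mult_le_mono) (simp_all add: r_def)
    then have "r i * H (Suc i) \<le> r (Suc i) * r (Suc i) * H (Suc i)" by (intro mult_le_mono1) simp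
    then show "r i * H (Suc i) \<le> H (Suc (Suc i))" using g[of "Suc i"] by (rule le_trans)
    show "r i * r i * (H (Suc (Suc i)) - card (W i) * H i) \<le> H (Suc (Suc i))"
      using parity[of i]
    proof (elim disjE exE)
      fix j assume i: "i = 2 * j"
      show ?thesis
        using dense_copies[OF CX, of j "r i"] outX(1)[of i] r_ge[of i] unfolding i HX HX' by simp
    next
      fix j assume i: "i = Suc (2 * j)"
      show ?thesis
        using dense_copies[OF CY, of j "r i"] outY(1)[of i] r_ge[of i] unfolding i HY HY[of "Suc j", simplified] by simp
    qed
  qed
  have r_large: "2 ^ i \<le> r i" for i by (simp add: r_def)
  have bndX: "1 - H (2 * j) * measure M (B\<^sub>X (n (2 * j))) \<le> 1 / 2 ^ j" for j
    using outX(1)[of "2 * j"] small_out[of j "2 * j"] by (simp add: HX)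
  have bndX': "1 - H (Suc (Suc (2 * j))) * measure M (B\<^sub>X (n (Suc (Suc (2 * j))))) \<le> 1 / 2 ^ j" for j
    using outX(1)[of "Suc (Suc (2 * j))"] small_out[of j "Suc (Suc (2 * j))"] by (simp add: HX')
  have bndY: "1 - H (Suc (2 * j)) * measure N (B\<^sub>Y (n (Suc (2 * j)))) \<le> 1 / 2 ^ j" for j
    using outY(1)[of "Suc (2 * j)"] small_out[of j "Suc (2 * j)"] by (simp add: HY)
  have A: "orbit_matching H r W (\<lambda>j. 2 * j) M T (\<lambda>j. X.pos (n (2 * j))) (\<lambda>j. measure M (B\<^sub>X (n (2 * j))))
      N S (\<lambda>j. Y.pos (n (Suc (2 * j)))) (\<lambda>j. measure N (B\<^sub>Y (n (Suc (2 * j)))))"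
    unfolding orbit_matching_def orbit_matching_axioms_def
    by (intro conjI I CX CY allI r_large bndX bndY) simp
  have B: "orbit_matching H r W (\<lambda>j. Suc (2 * j)) N S (\<lambda>j. Y.pos (n (Suc (2 * j)))) (\<lambda>j. measure N (B\<^sub>Y (n (Suc (2 * j)))))
      M T (\<lambda>j. X.pos (n (2 * Suc j))) (\<lambda>j. measure M (B\<^sub>X (n (Suc (Suc (2 * j))))))"
    unfolding orbit_matching_def orbit_matching_axioms_def mult_Suc_right add_2_eq_Suc
    by (intro conjI I CX' CY allI r_large bndX' bndY) simp
  show "integrably_orbit_equivalent \<omega> M N T S"
  proof (rule matching_orbit_equivalence[OF A B])
    show "2 ^ i * \<omega> (real (2 * (r i * H i))) \<le> real (H i)" for i using P[of i] by (simp add: P_def H_def)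
  qed (use nonneg mono in auto)
qed

end
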